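(* Let $\mathbb{F}_q$ be a finite field, and let $m_0,m_1,m_2$ be nonnegative integers and $m_3,m_4,m_5,m_6$ positive integers with $m_0\le\min(m_3,m_4)$, $m_1\le\min(m_4,m_5)$, $m_2\le\min(m_6,m_3)$ (there is no further restriction on $m_5$ and $m_6$). Assume that $m_2+m_1<m_0$. Then there exist positive integers $l_n$, nonnegative integers $k_n$, and a sequence of codes $\Phi_n$ ($n=1,2,\dots$) of block-length $l_n$ on $\mathbb{F}_q$ with message set $\mathbb{F}_q^{k_n}$ such that $$\lim_{n\to\infty}\frac{k_n}{l_n}=m_0-m_1-m_2,$$ $$\lim_{n\to\infty}\ \max_{\boldsymbol K,\boldsymbol H}\ \max_{\alpha^n}\ P_e[\Phi_n,\boldsymbol K,\boldsymbol H,\alpha^n]=0,$$ and, for every $n$, $$\max_{\boldsymbol K,\boldsymbol H}\ \max_{\alpha^n}\ I(M;Y_E)[\Phi_n,\boldsymbol K,\boldsymbol H,\alpha^n]=0.$$ Here $\max_{\boldsymbol K,\boldsymbol H}$ is over all $\boldsymbol K=(K_B,K_E)$, $\boldsymbol H=(H_B,H_E)$ with $(K_B,H_B,K_E,H_E)\in\mathbb{F}_q^{m_4\times m_3}\times\mathbb{F}_q^{m_4\times m_5}\times\mathbb{F}_q^{m_6\times m_3}\times\mathbb{F}_q^{m_6\times m_5}$ satisfying $\operatorname{rank}K_B=m_0$, $\operatorname{rank}H_B=m_1$, $\operatorname{rank}K_E=m_2$, and $\max_{\alpha^n}$ is over all of Eve's strategies for block-length $l_n$ (relative to $K_E,H_E$).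 In particular, $\Phi_n$ does not depend on $(\boldsymbol K,\boldsymbol H)$ or on the strategy.
   Context: Network model. A sender (Alice), a receiver (Bob) and an adversary (Eve) are connected by a network that acts linearly over $\mathbb{F}_q$. The network is used $l$ times with the same matrices. Alice's input is a matrix $X\in\mathbb{F}_q^{m_3\times l}$, Eve injects a matrix $Z\in\mathbb{F}_q^{m_5\times l}$, Bob receives $Y_B\in\mathbb{F}_q^{m_4\times l}$ and Eve observes $Y_E\in\mathbb{F}_q^{m_6\times l}$, where $$Y_B=K_BX+H_BZ,\qquad Y_E=K_EX+H_EZ,$$ with $K_B\in\mathbb{F}_q^{m_4\times m_3}$, $H_B\in\mathbb{F}_q^{m_4\times m_5}$, $K_E\in\mathbb{F}_q^{m_6\times m_3}$, $H_E\in\mathbb{F}_q^{m_6\times m_5}$. Write $\boldsymbol K=(K_B,K_E)$ and $\boldsymbol H=(H_B,H_E)$. Strategy. A strategy of Eve for block-length $l$ (relative to $K_E,H_E$) is a function $\alpha:\mathbb{F}_q^{m_6\times l}\to\mathbb{F}_q^{m_5\times l}$ satisfying the uniqueness condition: for every $X\in\mathbb{F}_q^{m_3\times l}$ there is exactly one $Y_E\in\mathbb{F}_q^{m_6\times l}$ with $Y_E=K_EX+H_E\,\alpha(Y_E)$. Under strategy $\alpha$, Eve's observation is this $Y_E$ and her injected noise is $Z=\alpha(Y_E)$. Code. A (non-local) code of block-length $l$ is a pair $\Phi=(\phi,\psi)$ consisting of an encoder $\phi:\mathcal M\times\mathcal L\to\mathbb{F}_q^{m_3\times l}$ and a decoder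 $\psi:\mathbb{F}_q^{m_4\times l}\to\mathcal M$, where $\mathcal M$ is the finite message set and $\mathcal L$ is a finite set of values of a scramble random number. The message $M$ and the scramble random number $L$ are independent and uniformly distributed on $\mathcal M$ and $\mathcal L$, and Alice inputs $X=\phi(M,L)$. Quantities. $P_e[\Phi,\boldsymbol K,\boldsymbol H,\alpha]$ is the decoding error probability $\Pr\{\psi(Y_B)\ne M\}$, and $I(M;Y_E)[\Phi,\boldsymbol K,\boldsymbol H,\alpha]$ is the mutual information between $M$ and Eve's observation $Y_E$ (since $Z$ is a function of $Y_E$, it equals $I(M;Y_E,Z)$), both when code $\Phi$ is used and Eve uses strategy $\alpha$. *)

theory Defs
  imports
    "HOL-Probability.Probability"
    "Jordan_Normal_Form.DL_Rank"
begin

text \<open>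
  All matrices are Jordan-Normal-Form matrices over a type 'a of class field and finite,
  which plays the role of the finite field with q elements. Dimensions are values, so that the
  block-length may vary along a sequence of codes.
\<close>

abbreviation mat_rank :: "'a :: field mat \<Rightarrow> nat"
  where "mat_rank A \<equiv> vec_space.rank (dim_row A) A"

record ('a, 'm, 's) network_code =
  messages :: "'m set"
  scrambles :: "'s set"
  encoder :: "'m \<Rightarrow> 's \<Rightarrow> 'a mat"
  decoder :: "'a mat \<Rightarrow> 'm"

definition is_network_code ::
    "nat \<Rightarrow> nat \<Rightarrow> nat \<Rightarrow> ('a, 'm, 's) network_code \<Rightarrow> bool"
  where "is_network_code m3 m4 l \<Phi> \<longleftrightarrow>
    finite (messages \<Phi>) \<and> messages \<Phi> \<noteq> {} \<and>
    finite (scrambles \<Phi>) \<and> scrambles \<Phi> \<noteq> {} \<and>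
    (\<forall>m\<in>messages \<Phi>. \<forall>s\<in>scrambles \<Phi>. encoder \<Phi> m s \<in> carrier_mat m3 l) \<and>
    (\<forall>Y\<in>carrier_mat m4 l. decoder \<Phi> Y \<in> messages \<Phi>)"

definition networks ::
    "nat \<Rightarrow> nat \<Rightarrow> nat \<Rightarrow> nat \<Rightarrow> nat \<Rightarrow> nat \<Rightarrow> nat \<Rightarrow>
     (('a :: field mat \<times> 'a mat) \<times> ('a mat \<times> 'a mat)) set"
  where "networks m0 m1 m2 m3 m4 m5 m6 = {((K\<^sub>B, K\<^sub>E), (H\<^sub>B, H\<^sub>E)).
    K\<^sub>B \<in> carrier_mat m4 m3 \<and> H\<^sub>B \<in> carrier_mat m4 m5 \<and>
    K\<^sub>E \<in> carrier_mat m6 m3 \<and> H\<^sub>E \<in> carrier_mat m6 m5 \<and>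
    mat_rank K\<^sub>B = m0 \<and> mat_rank H\<^sub>B = m1 \<and> mat_rank K\<^sub>E = m2}"

text \<open>
  Strategies are extensional functions on matrices of the right size, so that there are only
  finitely many of them. The remaining dimensions are read off from the matrices.
\<close>

definition strategies :: "nat \<Rightarrow> 'a :: semiring_0 mat \<Rightarrow> 'a mat \<Rightarrow> ('a mat \<Rightarrow> 'a mat) set"
  where "strategies l K\<^sub>E H\<^sub>E =
    {\<alpha> \<in> carrier_mat (dim_row K\<^sub>E) l \<rightarrow>\<^sub>E carrier_mat (dim_col H\<^sub>E) l.
      \<forall>X\<in>carrier_mat (dim_col K\<^sub>E) l.
        \<exists>!Y. Y \<in> carrier_mat (dim_row K\<^sub>E) l \<and> Y = K\<^sub>E * X + H\<^sub>E * \<alpha> Y}"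

definition eve_obs ::
    "'a :: semiring_0 mat \<Rightarrow> 'a mat \<Rightarrow> ('a mat \<Rightarrow> 'a mat) \<Rightarrow> 'a mat \<Rightarrow> 'a mat"
  where "eve_obs K\<^sub>E H\<^sub>E \<alpha> X =
    (THE Y. Y \<in> carrier_mat (dim_row K\<^sub>E) (dim_col X) \<and> Y = K\<^sub>E * X + H\<^sub>E * \<alpha> Y)"

definition bob_obs ::
    "'a :: semiring_0 mat \<times> 'a mat \<Rightarrow> 'a mat \<times> 'a mat \<Rightarrow> ('a mat \<Rightarrow> 'a mat) \<Rightarrow> 'a mat \<Rightarrow> 'a mat"
  where "bob_obs = (\<lambda>(K\<^sub>B, K\<^sub>E) (H\<^sub>B, H\<^sub>E) \<alpha> X.
    K\<^sub>B * X + H\<^sub>B * \<alpha> (eve_obs K\<^sub>E H\<^sub>E \<alpha> X))"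

definition code_space :: "('a, 'm, 's) network_code \<Rightarrow> ('m \<times> 's) measure"
  where "code_space \<Phi> =
    uniform_count_measure (messages \<Phi>) \<Otimes>\<^sub>M uniform_count_measure (scrambles \<Phi>)"

definition error_prob ::
    "('a :: semiring_0, 'm, 's) network_code \<Rightarrow> 'a mat \<times> 'a mat \<Rightarrow> 'a mat \<times> 'a mat \<Rightarrow>
     ('a mat \<Rightarrow> 'a mat) \<Rightarrow> real"
  where "error_prob \<Phi> K H \<alpha> =
    measure (code_space \<Phi>)
      {(m, s) \<in> space (code_space \<Phi>). decoder \<Phi> (bob_obs K H \<alpha> (encoder \<Phi> m s)) \<noteq> m}"

text \<open>
  The mutual information of the message and Eve's observation, in bits. The target spaces are the
  (finite) ranges of the two random variables, as for simple functions in
  \<^locale>\<open>information_space\<close>.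
\<close>

definition eve_information ::
    "('a :: semiring_0, 'm, 's) network_code \<Rightarrow> 'a mat \<times> 'a mat \<Rightarrow> 'a mat \<times> 'a mat \<Rightarrow>
     ('a mat \<Rightarrow> 'a mat) \<Rightarrow> real"
  where "eve_information \<Phi> K H \<alpha> =
    (let P = code_space \<Phi>;
         M = (\<lambda>(m, s). m);
         Y\<^sub>E = (\<lambda>(m, s). eve_obs (snd K) (snd H) \<alpha> (encoder \<Phi> m s))
     in prob_space.mutual_information P 2
          (count_space (M ` space P)) (count_space (Y\<^sub>E ` space P)) M Y\<^sub>E)"

end

theory Submission
  imports Defs "HOL-Library.Function_Algebras" "HOL-Real_Asymp.Real_Asymp"
begin

text \<open>
  Bob has only boundedly many candidates for \<open>K\<^sub>B\<close> and the image of \<open>H\<^sub>B\<close>. Were he sure of the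
  image, he could decode a linear code of dimension about \<open>(m\<^sub>0 - m\<^sub>1) l\<close> modulo it; a scramble part
  of dimension about \<open>m\<^sub>2 l\<close> that \<open>K\<^sub>E\<close> maps onto everything Eve can see gives perfect secrecy.
  To reject false candidates, Alice cuts the code word into \<open>N\<^sup>3\<close> blocks \<open>X\<^sub>j\<close> of \<open>N\<^sup>3\<close> columns, draws a
  random key \<open>R\<close> with \<open>N\<close> columns, and tells Bob the key and the products \<open>X\<^sub>j R\<close>. If Eve's noise is
  independent of \<open>R\<close>, a candidate that agrees with these products agrees with the whole
  transmission, up to a probability of at most \<open>2\<^sup>-\<^sup>N\<close>.

  These \<open>O(N\<^sup>4)\<close> symbols are sent secretly and reliably in \<open>O(N\<^sup>5)\<close> columns: for each symbol \<open>s\<close> and each value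
  \<open>v\<close>, Alice sends \<open>N\<close> blocks of constant length, each a random word of a linear code of dimension about
  \<open>m\<^sub>2 l\<close> if \<open>s\<close> has the value \<open>v\<close>, and uniformly random otherwise. Eve's \<open>m\<^sub>2\<close> dimensions are uniform
  in both cases. Bob accepts \<open>v\<close> if some candidate explains all \<open>N\<close> blocks; as \<open>m\<^sub>1 + m\<^sub>2 < m\<^sub>0\<close>, some
  direction invisible to Eve survives modulo the image of every candidate, so that each
  uniform block is explained with probability at most a half.
\<close>

section \<open>Finite additive groups\<close>

text \<open>Eve's noise may depend on her observation, which itself solves a fixed point equation
  containing the noise. For a fixed network and strategy, however, the input enters this equation
  only through \<open>K\<^sub>E X\<close>, so that observation and noise are functions of
  \<open>K\<^sub>E X\<close>. Secrecy and the independence needed for hashing thus become one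
  statement about this product: a permutation of Alice's randomness (\<open>recode\<close>), which
  may depend on the message and the network because it occurs in the analysis only, turns it into a
  function of the scramble parts.

  The noise lies columnwise in the image of \<open>H\<^sub>B\<close>, so decoding works modulo a
  subspace. Bob need not find the true candidate; it suffices that all candidates surviving his
  tests name the same message.

  With \<open>p\<close> blocks of \<open>p\<close> columns and \<open>n\<close> key columns, key and
  products are of the order of \<open>n p\<close> symbols, each of which costs a multiple of
  \<open>n\<close> columns. The overhead of order \<open>n^2 p\<close> is negligible against
  \<open>p^2\<close> for \<open>p = n^3\<close>, while the number of unwanted events stays
  polynomial in \<open>n\<close>, each of probability at most \<open>2^-n\<close>.\<close>

definition addsub :: "'g::ab_group_add set \<Rightarrow> bool"
  where "addsub A \<longleftrightarrow> 0 \<in> A \<and> (\<forall>x\<in>A. \<forall>y\<in>A. x - y \<in> A)"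

lemma addsub_zero: "addsub A \<Longrightarrow> 0 \<in> A"
  and addsub_diff: "addsub A \<Longrightarrow> x \<in> A \<Longrightarrow> y \<in> A \<Longrightarrow> x - y \<in> A"
  by (auto simp: addsub_def)

lemma addsub_minus: "addsub A \<Longrightarrow> x \<in> A \<Longrightarrow> - x \<in> A"
  using addsub_diff[of A 0 x] by (simp add: addsub_zero)

lemma addsub_add: "addsub A \<Longrightarrow> x \<in> A \<Longrightarrow> y \<in> A \<Longrightarrow> x + y \<in> A"
  using addsub_diff[of A x "- y"] by (simp add: addsub_minus)

lemma addsub_sum: "addsub A \<Longrightarrow> (\<And>i. i \<in> I \<Longrightarrow> f i \<in> A) \<Longrightarrow> sum f I \<in> A"
  by (induction I rule: infinite_finite_induct) (auto simp: addsub_zero addsub_add)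

text \<open>Functions vanishing off the index set, instead of extensional ones: such families form a
  subgroup of the function space under pointwise operations, and they nest, since the values may be
  families again.\<close>

definition fam :: "'t set \<Rightarrow> 'g::zero set \<Rightarrow> ('t \<Rightarrow> 'g) set"
  where "fam T A = {f. (\<forall>t\<in>T. f t \<in> A) \<and> (\<forall>t. t \<notin> T \<longrightarrow> f t = 0)}"

lemma famI: "(\<And>t. t \<in> T \<Longrightarrow> f t \<in> A) \<Longrightarrow> (\<And>t. t \<notin> T \<Longrightarrow> f t = 0) \<Longrightarrow> f \<in> fam T A"
  by (auto simp: fam_def)

lemma fam_mem: "f \<in> fam T A \<Longrightarrow> t \<in> T \<Longrightarrow> f t \<in> A"
  and fam_out: "f \<in> fam T A \<Longrightarrow> t \<notin> T \<Longrightarrow> f t = 0"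
  by (auto simp: fam_def)

lemma fam_mem': "f \<in> fam T A \<Longrightarrow> 0 \<in> A \<Longrightarrow> f t \<in> A"
  by (cases "t \<in> T") (auto simp: fam_def)

lemma addsub_fam: "addsub A \<Longrightarrow> addsub (fam T A)"
  by (auto simp: addsub_def fam_def)

lemma fam_bij: "bij_betw (\<lambda>f. restrict f T) {f \<in> fam T A. \<forall>t\<in>T. f t \<in> S t} (PiE T (\<lambda>t. A \<inter> S t))"
proof (rule bij_betw_byWitness[where f' = "\<lambda>g t. if t \<in> T then g t else 0"])
  show "(\<lambda>f. restrict f T) ` {f \<in> fam T A. \<forall>t\<in>T. f t \<in> S t} \<subseteq> (\<Pi>\<^sub>E t\<in>T. A \<inter> S t)"
    by (auto simp: fam_def)
qed (auto simp: fam_def PiE_def extensional_def fun_eq_iff)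

lemma card_fam_subset:
  "finite T \<Longrightarrow> card {f \<in> fam T A. \<forall>t\<in>T. f t \<in> S t} = (\<Prod>t\<in>T. card (A \<inter> S t))"
  using bij_betw_same_card[OF fam_bij[of T A S]] by (simp add: card_PiE)

lemma card_fam: "finite T \<Longrightarrow> card (fam T A) = card A ^ card T"
  using card_fam_subset[of T A "\<lambda>_. UNIV"] by simp

lemma finite_fam:
  assumes "finite T" "finite A" shows "finite (fam T A)"
proof -
  have "finite (PiE T (\<lambda>t. A \<inter> UNIV))" using assms by (intro finite_PiE) auto
  then have "finite {f \<in> fam T A. \<forall>t\<in>T. f t \<in> UNIV}"
    using bij_betw_finite[OF fam_bij[of T A "\<lambda>_. UNIV"]] by simp
  then show ?thesis by simp
qed

text \<open>Under the uniform distribution the coordinates of a family are independent, so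
  conditions of probability at most a half multiply. It serves for the repeated signal blocks and
  for the columns of the hash key.\<close>

lemma fam_amplify:
  assumes "finite T" "\<And>t. t \<in> T \<Longrightarrow> 2 * card (A \<inter> S t) \<le> card A"
  shows "card {f \<in> fam T A. \<forall>t\<in>T. f t \<in> S t} * 2 ^ card T \<le> card (fam T A)"
proof -
  have "card {f \<in> fam T A. \<forall>t\<in>T. f t \<in> S t} * 2 ^ card T = (\<Prod>t\<in>T. 2 * card (A \<inter> S t))"
    using assms(1) by (simp add: card_fam_subset prod.distrib mult.commute)
  also have "\<dots> \<le> (\<Prod>t\<in>T. card A)" using assms(2) by (intro prod_mono) auto
  finally show ?thesis using assms(1) by (simp add: card_fam)
qed

text \<open>\<open>S\<close> fits into one coset of \<open>D\<close>, and the translate of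
  \<open>D\<close> by \<open>a\<close> is disjoint from \<open>D\<close>. As only differences in
  \<open>S\<close> are constrained, \<open>S\<close> may be an affine condition with an unknown
  offset, such as Eve's noise.\<close>

lemma half_coset:
  assumes A: "finite A" "addsub A" and D: "addsub D" "D \<subseteq> A" "a \<in> A" "a \<notin> D"
    and S: "S \<subseteq> A" "\<And>x y. x \<in> S \<Longrightarrow> y \<in> S \<Longrightarrow> x - y \<in> D"
  shows "2 * card S \<le> card A"
proof (cases "S = {}")
  case False
  then obtain s where s: "s \<in> S" by auto
  have "card S \<le> card D"
    using S s D(2) A(1) by (intro card_inj_on_le[where f = "\<lambda>x. x - s"]) (auto simp: inj_on_def finite_subset)
  moreover have "card D + card ((+) a ` D) = card (D \<union> (+) a ` D)"
  proof (rule card_Un_disjoint[symmetric])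
    show "D \<inter> (+) a ` D = {}"
    proof (safe, goal_cases)
      case (1 x d)
      then have "(a + d) - d \<in> D" using D(1) addsub_diff by blast
      then show ?case using D(4) by simp
    qed
  qed (use A D finite_subset in auto)
  moreover have "card (D \<union> (+) a ` D) \<le> card A"
    using A D by (intro card_mono) (auto intro: addsub_add)
  moreover have "card ((+) a ` D) = card D" by (simp add: card_image)
  ultimately show ?thesis by linarith
qed auto

text \<open>Nonempty fibres of a homomorphism are translates of its kernel.\<close>

lemma card_preimage:
  fixes f :: "'g::ab_group_add \<Rightarrow> 'h::ab_group_add"
  assumes A: "finite A" "addsub A" and f: "\<And>x y. x \<in> A \<Longrightarrow> y \<in> A \<Longrightarrow> f (x - y) = f x - f y"
  shows "card {x \<in> A. f x \<in> T} = card {x \<in> A. f x = 0} * card (T \<inter> f ` A)"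
proof -
  have fib: "card {x \<in> A. f x = b} = card {x \<in> A. f x = 0}" if b: "b \<in> f ` A" for b
  proof -
    obtain a where a: "a \<in> A" "b = f a" using b by auto
    have fadd: "f (x + y) = f x + f y" if "x \<in> A" "y \<in> A" for x y
      using f[of "x + y" y] that A(2) by (simp add: addsub_add algebra_simps)
    have "bij_betw (\<lambda>x. x - a) {x \<in> A. f x = b} {x \<in> A. f x = 0}"
      by (rule bij_betw_byWitness[where f' = "\<lambda>x. x + a"])
         (use a A f fadd in \<open>auto simp: addsub_add addsub_diff\<close>)
    then show ?thesis by (rule bij_betw_same_card)
  qed
  have "{x \<in> A. f x \<in> T} = (\<Union>b\<in>T \<inter> f ` A. {x \<in> A. f x = b})" by auto
  also have "card \<dots> = (\<Sum>b\<in>T \<inter> f ` A. card {x \<in> A. f x = b})"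
    using A(1) by (intro card_UN_disjoint) auto
  also have "\<dots> = (\<Sum>b\<in>T \<inter> f ` A. card {x \<in> A. f x = 0})" using fib by (intro sum.cong) auto
  finally show ?thesis by simp
qed

lemma card_ker_image:
  fixes f :: "'g::ab_group_add \<Rightarrow> 'h::ab_group_add"
  assumes "finite A" "addsub A" "\<And>x y. x \<in> A \<Longrightarrow> y \<in> A \<Longrightarrow> f (x - y) = f x - f y"
  shows "card A = card {x \<in> A. f x = 0} * card (f ` A)"
  using card_preimage[OF assms, of UNIV] by simp

text \<open>Each \<open>sh y\<close> preserves the uniform distribution on \<open>\<Omega>\<close>,
  so \<open>P\<close> may be tested at \<open>sh y \<omega>\<close> with \<open>y\<close> uniform as
  well. With \<open>\<omega>\<close> frozen, only the randomness of \<open>y\<close> is used, and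
  the conditional bound \<open>bad\<close> averages to the same bound.\<close>

lemma shift_average:
  assumes fin: "finite \<Omega>" "finite Y" "Y \<noteq> {}"
    and bij: "\<And>y. y \<in> Y \<Longrightarrow> bij_betw (sh y) \<Omega> \<Omega>"
    and bad: "\<And>\<omega>. \<omega> \<in> \<Omega> \<Longrightarrow> card {y \<in> Y. P (sh y \<omega>)} * K \<le> card Y"
  shows "card {\<omega> \<in> \<Omega>. P \<omega>} * K \<le> card \<Omega>"
proof -
  have inv: "card {\<omega> \<in> \<Omega>. P (sh y \<omega>)} = card {\<omega> \<in> \<Omega>. P \<omega>}" if y: "y \<in> Y" for y
  proof (rule bij_betw_same_card[of "sh y"])
    have "sh y ` {\<omega> \<in> \<Omega>. P (sh y \<omega>)} = {\<omega> \<in> \<Omega>. P \<omega>}"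
      using bij[OF y] unfolding bij_betw_def by auto
    moreover have "inj_on (sh y) {\<omega> \<in> \<Omega>. P (sh y \<omega>)}"
      using bij[OF y] unfolding bij_betw_def by (auto intro: inj_on_subset)
    ultimately show "bij_betw (sh y) {\<omega> \<in> \<Omega>. P (sh y \<omega>)} {\<omega> \<in> \<Omega>. P \<omega>}"
      by (simp add: bij_betw_def)
  qed
  have cnt: "card {x \<in> X. Q x} = (\<Sum>x\<in>X. of_bool (Q x))" if "finite X" for X :: "'x set" and Q
    using that by (simp add: of_bool_def sum.If_cases Int_def)
  \<comment> \<open>The pairs of \<open>y\<close> and \<open>\<omega>\<close> with
    \<open>P (sh y \<omega>)\<close> are counted in both orders.\<close>
  have "card Y * card {\<omega> \<in> \<Omega>. P \<omega>} = (\<Sum>y\<in>Y. card {\<omega> \<in> \<Omega>. P (sh y \<omega>)})"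
    using inv by simp
  also have "\<dots> = (\<Sum>y\<in>Y. \<Sum>\<omega>\<in>\<Omega>. of_bool (P (sh y \<omega>)))"
    using cnt[OF fin(1)] by simp
  also have "\<dots> = (\<Sum>\<omega>\<in>\<Omega>. \<Sum>y\<in>Y. of_bool (P (sh y \<omega>)))" by (rule sum.swap)
  also have "\<dots> = (\<Sum>\<omega>\<in>\<Omega>. card {y \<in> Y. P (sh y \<omega>)})"
    using cnt[OF fin(2)] by simp
  finally have "card Y * (card {\<omega> \<in> \<Omega>. P \<omega>} * K) = (\<Sum>\<omega>\<in>\<Omega>. card {y \<in> Y. P (sh y \<omega>)} * K)"
    by (simp only: mult.assoc[symmetric] sum_distrib_right)
  also have "\<dots> \<le> (\<Sum>\<omega>\<in>\<Omega>. card Y)" using bad by (intro sum_mono) auto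
  finally have "card Y * (card {\<omega> \<in> \<Omega>. P \<omega>} * K) \<le> card Y * card \<Omega>" by simp
  moreover have "card Y > 0" using fin by (simp add: card_gt_0_iff)
  ultimately show ?thesis by simp
qed

section \<open>Vectors over a finite field\<close>

abbreviation vecs :: "'i set \<Rightarrow> ('i \<Rightarrow> 'a::zero) set"
  where "vecs I \<equiv> fam I UNIV"

definition smul :: "'a::times \<Rightarrow> ('i \<Rightarrow> 'a) \<Rightarrow> 'i \<Rightarrow> 'a"
  where "smul c x = (\<lambda>i. c * x i)"

definition subspc :: "('i \<Rightarrow> 'a::field) set \<Rightarrow> bool"
  where "subspc S \<longleftrightarrow> addsub S \<and> (\<forall>c. \<forall>x\<in>S. smul c x \<in> S)"

definition dot :: "'i set \<Rightarrow> ('i \<Rightarrow> 'a::comm_ring_1) \<Rightarrow> ('i \<Rightarrow> 'a) \<Rightarrow> 'a"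
  where "dot I x y = (\<Sum>i\<in>I. x i * y i)"

definition perp :: "'i set \<Rightarrow> ('i \<Rightarrow> 'a::field) set \<Rightarrow> ('i \<Rightarrow> 'a) set"
  where "perp I S = {y \<in> vecs I. \<forall>x\<in>S. dot I y x = 0}"

lemma subspc_addsub: "subspc S \<Longrightarrow> addsub S"
  and subspc_smul: "subspc S \<Longrightarrow> x \<in> S \<Longrightarrow> smul c x \<in> S"
  by (auto simp: subspc_def)

lemma addsub_UNIV: "addsub UNIV"
  by (simp add: addsub_def)

lemma addsub_vecs: "addsub (vecs I :: ('i \<Rightarrow> 'a::ab_group_add) set)"
  by (intro addsub_fam addsub_UNIV)

lemma smul_fam: "(\<And>x. x \<in> A \<Longrightarrow> c * x \<in> A) \<Longrightarrow> f \<in> fam I A \<Longrightarrow> smul (c::'a::mult_zero) f \<in> fam I A"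
  by (auto simp: fam_def smul_def)

lemma smul_vecs: "f \<in> vecs I \<Longrightarrow> smul (c::'a::mult_zero) f \<in> vecs I"
  by (rule smul_fam) auto

lemma subspc_vecs: "subspc (vecs I)"
  by (simp add: subspc_def addsub_vecs smul_vecs)

lemma card_vecs: "finite I \<Longrightarrow> card (vecs I :: ('i \<Rightarrow> 'a::{finite,zero}) set) = CARD('a) ^ card I"
  by (simp add: card_fam)

lemma finite_vecs: "finite I \<Longrightarrow> finite (vecs I :: ('i \<Rightarrow> 'a::{finite,zero}) set)"
  by (simp add: finite_fam)

lemma dot_commute: "dot I x y = dot I y x"
  by (simp add: dot_def mult.commute)

lemma dot_diff: "dot I z (x - y) = dot I z x - dot I z y"
  by (simp add: dot_def sum_subtractf algebra_simps)

lemma dot_smul: "dot I z (smul c x) = c * dot I z x"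
  by (simp add: dot_def smul_def sum_distrib_left algebra_simps)

lemma CARD_field_ge_2: "CARD('a::{field,finite}) \<ge> 2"
proof -
  have "card {0, 1::'a} \<le> CARD('a)" by (intro card_mono) auto
  then show ?thesis by simp
qed

text \<open>Scaling \<open>x\<close> reaches every field element, so \<open>f\<close> maps
  \<open>S\<close> onto the field and all its fibres have the size of the kernel.\<close>

lemma functional_kernel:
  fixes f :: "('i \<Rightarrow> 'a::{field,finite}) \<Rightarrow> 'a"
  assumes S: "finite S" "subspc S"
    and f: "\<And>x y. f (x - y) = f x - f y" "\<And>c x. f (smul c x) = c * f x"
    and nz: "x \<in> S" "f x \<noteq> 0"
  shows "card S = card {x \<in> S. f x = 0} * CARD('a)"
proof -
  have "f ` S = UNIV"
  proof (intro equalityI subsetI)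
    fix c :: 'a
    have "f (smul (c / f x) x) = c" using nz(2) by (simp add: f(2))
    then show "c \<in> f ` S" using subspc_smul[OF S(2) nz(1)] by (metis image_eqI)
  qed simp
  then show ?thesis using card_ker_image[OF S(1) subspc_addsub[OF S(2)], of f] f(1) by simp
qed

lemma dot_unit: "finite I \<Longrightarrow> i \<in> I \<Longrightarrow> dot I y (\<lambda>j. if j = i then c else 0) = y i * c"
  by (simp add: dot_def if_distrib[of "(*) _"] cong: if_cong)

lemma dot_nondegenerate:
  fixes y :: "'i \<Rightarrow> 'a::field"
  assumes "finite I" "y \<in> vecs I" "y \<noteq> 0"
  obtains x where "x \<in> vecs I" "dot I y x \<noteq> 0"
proof -
  from assms(3) obtain i where i: "y i \<noteq> 0" by (auto simp: fun_eq_iff)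
  then have "i \<in> I" using fam_out[OF assms(2)] by blast
  then have "dot I y (\<lambda>j. if j = i then 1 else 0) \<noteq> 0" using i assms(1) by (simp add: dot_unit)
  moreover have "(\<lambda>j. if j = i then 1 else 0) \<in> vecs I" using \<open>i \<in> I\<close> by (auto intro!: famI)
  ultimately show thesis using that by blast
qed

text \<open>Both sides are computed by counting the pairs of orthogonal vectors in
  \<open>vecs I \<times> S\<close> row by row and column by column.\<close>

lemma card_perp:
  fixes S :: "('i \<Rightarrow> 'a::{field,finite}) set"
  assumes I: "finite I" and S: "subspc S" "S \<subseteq> vecs I"
  shows "card S * card (perp I S) = CARD('a) ^ card I"
proof -
  let ?q = "CARD('a)" and ?V = "vecs I :: ('i \<Rightarrow> 'a) set" and ?P = "perp I S"
  have fV: "finite ?V" using I by (rule finite_vecs)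
  have fS: "finite S" using S(2) fV by (rule finite_subset)
  have P: "?P \<subseteq> ?V" by (auto simp: perp_def)
  have zS: "0 \<in> S" using S(1) by (simp add: subspc_addsub addsub_zero)
  have row: "?q * card {x \<in> S. dot I y x = 0} = (if y \<in> ?P then ?q * card S else card S)" if y: "y \<in> ?V" for y
  proof (cases "y \<in> ?P")
    case True
    then have "{x \<in> S. dot I y x = 0} = S" by (auto simp: perp_def)
    then show ?thesis using True by simp
  next
    case False
    then obtain x where "x \<in> S" "dot I y x \<noteq> 0" using y by (auto simp: perp_def)
    then have "card S = card {x \<in> S. dot I y x = 0} * ?q"
      using functional_kernel[OF fS S(1), of "dot I y" x] by (simp add: dot_diff dot_smul)
    then show ?thesis using False by simp
  qed
  have col: "?q * card {y \<in> ?V. dot I y x = 0} = (if x = 0 then ?q * card ?V else card ?V)" if x: "x \<in> S" for x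
  proof (cases "x = 0")
    case True
    then show ?thesis by (simp add: dot_def)
  next
    case False
    then obtain y where "y \<in> ?V" "dot I x y \<noteq> 0" using dot_nondegenerate[OF I] x S(2) by blast
    then have "card ?V = card {y \<in> ?V. dot I x y = 0} * ?q"
      using functional_kernel[OF fV subspc_vecs, of "dot I x" y] by (simp add: dot_diff dot_smul)
    then show ?thesis using False by (simp add: dot_commute)
  qed
  have "(\<Sum>y\<in>?V. card {x \<in> S. dot I y x = 0}) = (\<Sum>x\<in>S. card {y \<in> ?V. dot I y x = 0})"
    by (rule sum_multicount_gen) (use fS fV in auto)
  then have "(\<Sum>y\<in>?V. ?q * card {x \<in> S. dot I y x = 0}) = (\<Sum>x\<in>S. ?q * card {y \<in> ?V. dot I y x = 0})"
    by (simp only: sum_distrib_left[symmetric])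
  moreover have "(\<Sum>y\<in>?V. ?q * card {x \<in> S. dot I y x = 0})
      = card ?P * (?q * card S) + (card ?V - card ?P) * card S"
    using row fV P by (simp add: sum.If_cases card_Diff_subset Int_absorb1 finite_subset Diff_eq[symmetric])
  moreover have "(\<Sum>x\<in>S. ?q * card {y \<in> ?V. dot I y x = 0})
      = ?q * card ?V + (card S - 1) * card ?V"
    using col fS zS by (simp add: sum.remove[OF fS zS] card_Diff_singleton)
  ultimately have eq: "card ?P * (?q * card S) + (card ?V - card ?P) * card S
      = ?q * card ?V + (card S - 1) * card ?V" by simp
  have "card ?P \<le> card ?V" using fV P by (rule card_mono)
  moreover have "card S \<noteq> 0" using fS zS by auto
  then have "1 \<le> card S" by linarith
  ultimately have "int (card ?P) * (int ?q * int (card S)) + (int (card ?V) - int (card ?P)) * int (card S)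
      = int ?q * int (card ?V) + (int (card S) - 1) * int (card ?V)"
    using arg_cong[OF eq, of int] by (simp add: of_nat_diff)
  \<comment> \<open>After expansion the terms \<open>card ?V * card S\<close> cancel and a factor
    \<open>q - 1\<close> remains on both sides; \<open>int\<close> is used because of the
    subtractions.\<close>
  then have "(int ?q - 1) * (int (card S) * int (card ?P)) = (int ?q - 1) * int (card ?V)"
    by (simp add: algebra_simps)
  then have "int (card S) * int (card ?P) = int (card ?V)"
    using CARD_field_ge_2[where 'a = 'a] by simp
  then show ?thesis using card_vecs[OF I, where 'a = 'a] by (metis of_nat_eq_iff of_nat_mult)
qed

text \<open>By \<open>card_perp\<close>, a trivial annihilator would force \<open>S\<close> to be
  everything. This supplies the dual vector in the surjectivity argument for random codes.\<close>

lemma perp_nontrivial: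
  fixes S :: "('i \<Rightarrow> 'a::{field,finite}) set"
  assumes I: "finite I" and S: "subspc S" "S \<subset> vecs I"
  obtains y where "y \<in> perp I S" "y \<noteq> 0"
proof -
  have "card S < card (vecs I :: ('i \<Rightarrow> 'a) set)" using S(2) I by (intro psubset_card_mono finite_vecs)
  moreover have "card S * card (perp I S) = card (vecs I :: ('i \<Rightarrow> 'a) set)"
    using card_perp[OF I S(1)] S(2) by (simp add: card_vecs[OF I])
  ultimately have "card (perp I S) \<noteq> 1" by (metis less_irrefl mult.right_neutral)
  moreover have "0 \<in> perp I S" by (auto simp: perp_def dot_def fam_def)
  ultimately have "perp I S \<noteq> {0}" by (metis card_1_singleton_iff One_nat_def)
  then show thesis using \<open>0 \<in> perp I S\<close> that by blast
qed

section \<open>Random linear codes\<close>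

text \<open>\<open>G\<close> is a generator matrix whose rows are words with entries indexed by a
  column \<open>c\<close> and a position \<open>b\<close> in it. Currying makes
  \<open>cw I G u c\<close> a single network input, to which a linear map can be applied.\<close>

definition cw :: "'i set \<Rightarrow> ('i \<Rightarrow> 'c \<times> 'b \<Rightarrow> 'a::comm_ring_1) \<Rightarrow> ('i \<Rightarrow> 'a) \<Rightarrow> 'c \<Rightarrow> 'b \<Rightarrow> 'a"
  where "cw I G u = (\<lambda>c b. \<Sum>i\<in>I. u i * G i (c, b))"

lemma cw_diff: "cw I G (u - v) c = cw I G u c - cw I G v c"
  and cw_add: "cw I G (u + v) c = cw I G u c + cw I G v c"
  and cw_smul: "cw I G (smul k u) c = smul k (cw I G u c)"
  and cw_0: "cw I G 0 c = 0"
  by (simp_all add: cw_def fun_eq_iff smul_def sum_subtractf sum.distrib algebra_simps sum_distrib_left)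

lemma cw_unit: "finite I \<Longrightarrow> i \<in> I \<Longrightarrow> cw I G (\<lambda>j. if j = i then 1 else 0) c = (\<lambda>b. G i (c, b))"
  by (simp add: cw_def if_distrib[of "\<lambda>x. x * _"] cong: if_cong)

lemma cw_vecs:
  assumes "\<And>i. i \<in> I \<Longrightarrow> G i \<in> vecs (C \<times> B)"
  shows "cw I G u \<in> fam C (vecs B)"
proof (intro famI)
  fix t b assume "b \<notin> B"
  then show "cw I G u t b = 0" using assms by (auto simp: cw_def fam_def intro!: sum.neutral)
next
  fix t assume "t \<notin> C"
  then show "cw I G u t = 0" using assms by (auto simp: cw_def fam_def fun_eq_iff intro!: sum.neutral)
qed auto

lemma card_PiE_constraint:
  assumes "finite I" "J \<subseteq> I"
  shows "card {G \<in> PiE I (\<lambda>_. W). \<forall>i\<in>J. P (G i)} = card {x \<in> W. P x} ^ card J * card W ^ card (I - J)"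
proof -
  have "{G \<in> PiE I (\<lambda>_. W). \<forall>i\<in>J. P (G i)} = PiE I (\<lambda>i. if i \<in> J then {x \<in> W. P x} else W)"
    using assms(2) by (auto simp: PiE_def Pi_def)
  moreover have "(\<Prod>i\<in>I. card (if i \<in> J then {x \<in> W. P x} else W))
      = (\<Prod>i\<in>I. if i \<in> J then card {x \<in> W. P x} else card W)" by (intro prod.cong) auto
  moreover have "\<dots> = card {x \<in> W. P x} ^ card J * card W ^ card (I - J)"
    using assms by (simp add: prod.If_cases Int_absorb1 Diff_eq[symmetric] Int_commute)
  ultimately show ?thesis using assms(1) by (simp add: card_PiE)
qed

text \<open>A uniform vector is orthogonal to the nonzero \<open>y\<close> with probability
  \<open>1 / q\<close>, independently for each generator in \<open>J\<close>.\<close>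

lemma card_orthogonal_generators:
  fixes y :: "'k \<Rightarrow> 'a::{field,finite}"
  assumes "finite K" "y \<in> vecs K" "y \<noteq> 0" and I: "finite I" "J \<subseteq> I"
  shows "card {G \<in> PiE I (\<lambda>_. vecs K). \<forall>i\<in>J. dot K y (G i) = 0} * CARD('a) ^ card J
    = card (PiE I (\<lambda>_. vecs K :: ('k \<Rightarrow> 'a) set))"
proof -
  let ?W = "vecs K :: ('k \<Rightarrow> 'a) set"
  obtain x where "x \<in> ?W" "dot K y x \<noteq> 0" using dot_nondegenerate[OF assms(1-3)] by blast
  then have W: "card ?W = card {x \<in> ?W. dot K y x = 0} * CARD('a)"
    using functional_kernel[OF finite_vecs[OF assms(1)] subspc_vecs, of "dot K y" x]
    by (simp add: dot_diff dot_smul)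
  have "card I = card J + card (I - J)"
    using I by (metis card_Diff_subset card_mono finite_subset le_add_diff_inverse)
  then have "card (PiE I (\<lambda>_. ?W)) = card ?W ^ card J * card ?W ^ card (I - J)"
    using I(1) by (simp add: card_PiE power_add)
  also have "card ?W ^ card J = card {x \<in> ?W. dot K y x = 0} ^ card J * CARD('a) ^ card J"
    by (subst W) (simp add: power_mult_distrib)
  finally show ?thesis
    using card_PiE_constraint[OF I, of ?W "\<lambda>x. dot K y x = 0"] by (simp add: mult_ac)
qed

text \<open>A nonzero \<open>u\<close> makes its codeword uniform: with the other generators fixed,
  the generator at a position where \<open>u\<close> is nonzero is determined by the codeword. The
  columns then lie in \<open>N\<close> independently, each with probability at most
  \<open>q ^ - r\<close>.\<close>

lemma card_generators_into:
  fixes u :: "'i \<Rightarrow> 'a::{field,finite}" and N :: "('b \<Rightarrow> 'a) set"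
  assumes fin: "finite I" "finite C" "finite B" and N: "N \<subseteq> vecs B" "card N * CARD('a) ^ r \<le> CARD('a) ^ card B"
    and u: "u \<in> vecs I" "u \<noteq> 0"
  shows "card {G \<in> PiE I (\<lambda>_. vecs (C \<times> B)). \<forall>c\<in>C. cw I G u c \<in> N} * CARD('a) ^ (r * card C)
    \<le> card (PiE I (\<lambda>_. vecs (C \<times> B) :: ('c \<times> 'b \<Rightarrow> 'a) set))"
proof -
  let ?q = "CARD('a)" and ?W = "vecs (C \<times> B) :: ('c \<times> 'b \<Rightarrow> 'a) set"
  let ?A = "{G \<in> PiE I (\<lambda>_. ?W). \<forall>c\<in>C. cw I G u c \<in> N}"
  from u obtain i where i: "u i \<noteq> 0" "i \<in> I" by (metis fam_out ext zero_fun_apply)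
  have fW: "finite ?W" using fin by (intro finite_vecs) auto
  have fN: "finite N" using N(1) finite_vecs[OF fin(3)] by (rule finite_subset)
  have inj: "inj_on (\<lambda>G. (cw I G u, restrict G (I - {i}))) ?A"
  proof (rule inj_onI)
    fix G H assume G: "G \<in> ?A" and H: "H \<in> ?A"
      and eq: "(cw I G u, restrict G (I - {i})) = (cw I H u, restrict H (I - {i}))"
    have off: "G j = H j" if "j \<in> I - {i}" for j
      using eq that by (metis restrict_apply' prod.inject)
    have "G i (c, b) = H i (c, b)" for c b
    proof -
      have "(\<Sum>j\<in>I. u j * G j (c, b)) = (\<Sum>j\<in>I. u j * H j (c, b))"
        using eq by (simp add: cw_def fun_eq_iff)
      moreover have "(\<Sum>j\<in>I - {i}. u j * G j (c, b)) = (\<Sum>j\<in>I - {i}. u j * H j (c, b))"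
        using off by (intro sum.cong) auto
      ultimately have "u i * G i (c, b) = u i * H i (c, b)"
        using sum.remove[OF fin(1) i(2), of "\<lambda>j. u j * G j (c, b)"]
          sum.remove[OF fin(1) i(2), of "\<lambda>j. u j * H j (c, b)"] by simp
      then show ?thesis using i by simp
    qed
    then have "G j = H j" if "j \<in> I" for j using off that by (cases "j = i") auto
    moreover have "G \<in> PiE I (\<lambda>_. ?W)" "H \<in> PiE I (\<lambda>_. ?W)" using G H by auto
    ultimately show "G = H" by (metis PiE_ext)
  qed
  have "(\<lambda>G. (cw I G u, restrict G (I - {i}))) ` ?A \<subseteq> fam C N \<times> PiE (I - {i}) (\<lambda>_. ?W)"
  proof (intro image_subsetI SigmaI)
    fix G assume G: "G \<in> ?A"
    then show "cw I G u \<in> fam C N" using cw_vecs[of I G C B u] by (auto simp: fam_def)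
    show "restrict G (I - {i}) \<in> PiE (I - {i}) (\<lambda>_. ?W)" using G by auto
  qed
  then have "card ?A \<le> card (fam C N \<times> PiE (I - {i}) (\<lambda>_. ?W))"
    by (rule card_inj_on_le[OF inj]) (use fin fW fN in \<open>auto intro!: finite_fam finite_PiE\<close>)
  also have "\<dots> = card N ^ card C * card ?W ^ (card I - 1)"
    using fin i by (simp add: card_cartesian_product card_fam card_PiE)
  finally have "card ?A * ?q ^ (r * card C) \<le> (card N * ?q ^ r) ^ card C * card ?W ^ (card I - 1)"
    by (simp add: power_mult power_mult_distrib mult_ac)
  also have "\<dots> \<le> (?q ^ card B) ^ card C * card ?W ^ (card I - 1)"
    using N(2) by (intro mult_right_mono power_mono) auto
  also have "(?q ^ card B) ^ card C = card ?W"
    using fin by (simp add: card_vecs card_cartesian_product power_mult[symmetric] mult.commute)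
  also have "card ?W * card ?W ^ (card I - 1) = card (PiE I (\<lambda>_. ?W))"
    using fin i by (cases "card I") (auto simp: card_PiE)
  finally show ?thesis .
qed

text \<open>Duality: the words that agree with some codeword from \<open>J\<close> modulo
  \<open>V\<close> in every column form a subspace. Were it proper, a nonzero \<open>y\<close> would
  annihilate it; testing \<open>y\<close> on elements of \<open>V\<close> placed in one column and
  on the generators contradicts \<open>nz\<close>.\<close>

lemma surjective_mod_or_orthogonal:
  fixes V :: "('b \<Rightarrow> 'a::{field,finite}) set" and G :: "'i \<Rightarrow> 'c \<times> 'b \<Rightarrow> 'a"
  assumes fin: "finite I" "finite C" "finite B" and J: "J \<subseteq> I"
    and V: "subspc V" "V \<subseteq> vecs B" and G: "\<And>i. i \<in> I \<Longrightarrow> G i \<in> vecs (C \<times> B)"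
    and nz: "\<And>y. y \<in> vecs (C \<times> B) \<Longrightarrow> (\<And>c. c \<in> C \<Longrightarrow> (\<lambda>b. y (c, b)) \<in> perp B V) \<Longrightarrow>
      (\<And>i. i \<in> J \<Longrightarrow> dot (C \<times> B) y (G i) = 0) \<Longrightarrow> y = 0"
    and X: "X \<in> fam C (vecs B)"
  shows "\<exists>L\<in>vecs J. \<forall>c\<in>C. X c - cw I G L c \<in> V"
proof -
  let ?W = "vecs (C \<times> B) :: ('c \<times> 'b \<Rightarrow> 'a) set"
  define S where "S = {X \<in> ?W. \<exists>L\<in>vecs J. \<forall>c\<in>C. (\<lambda>b. X (c, b)) - cw I G L c \<in> V}"
  have fW: "finite (C \<times> B)" using fin by auto
  have zV: "0 \<in> V" using V(1) by (simp add: subspc_addsub addsub_zero)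
  have "S = ?W"
  proof (rule ccontr)
    assume "S \<noteq> ?W"
    then have "S \<subset> ?W" by (auto simp: S_def)
    moreover have "subspc S"
      unfolding subspc_def addsub_def
    proof (intro conjI ballI allI)
      show "0 \<in> S" using zV unfolding S_def
        by (auto simp: addsub_zero[OF addsub_vecs] cw_0 zero_fun_def[symmetric] intro!: bexI[of _ 0])
    next
      fix x y assume "x \<in> S" "y \<in> S"
      then obtain K L where xy: "x \<in> ?W" "y \<in> ?W" "K \<in> vecs J" "L \<in> vecs J"
        "\<forall>c\<in>C. (\<lambda>b. x (c, b)) - cw I G K c \<in> V" "\<forall>c\<in>C. (\<lambda>b. y (c, b)) - cw I G L c \<in> V"
        by (auto simp: S_def)
      have "\<forall>c\<in>C. (\<lambda>b. (x - y) (c, b)) - cw I G (K - L) c \<in> V"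
      proof
        fix c assume "c \<in> C"
        then have "((\<lambda>b. x (c, b)) - cw I G K c) - ((\<lambda>b. y (c, b)) - cw I G L c) \<in> V"
          using xy subspc_addsub[OF V(1)] by (blast intro: addsub_diff)
        moreover have "((\<lambda>b. x (c, b)) - cw I G K c) - ((\<lambda>b. y (c, b)) - cw I G L c)
          = (\<lambda>b. (x - y) (c, b)) - cw I G (K - L) c" by (simp add: cw_diff fun_eq_iff)
        ultimately show "(\<lambda>b. (x - y) (c, b)) - cw I G (K - L) c \<in> V" by simp
      qed
      then show "x - y \<in> S" using xy(1-4) by (auto simp: S_def intro: addsub_diff[OF addsub_vecs])
    next
      fix k x assume "x \<in> S"
      then obtain K where x: "x \<in> ?W" "K \<in> vecs J" "\<forall>c\<in>C. (\<lambda>b. x (c, b)) - cw I G K c \<in> V"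
        by (auto simp: S_def)
      have "\<forall>c\<in>C. (\<lambda>b. smul k x (c, b)) - cw I G (smul k K) c \<in> V"
      proof
        fix c assume "c \<in> C"
        then have "smul k ((\<lambda>b. x (c, b)) - cw I G K c) \<in> V"
          using x subspc_smul[OF V(1)] by blast
        moreover have "smul k ((\<lambda>b. x (c, b)) - cw I G K c) = (\<lambda>b. smul k x (c, b)) - cw I G (smul k K) c"
          by (simp add: cw_smul fun_eq_iff) (simp add: smul_def algebra_simps)
        ultimately show "(\<lambda>b. smul k x (c, b)) - cw I G (smul k K) c \<in> V" by simp
      qed
      then show "smul k x \<in> S" using x by (auto simp: S_def smul_vecs)
    qed
    ultimately obtain y where y: "y \<in> perp (C \<times> B) S" "y \<noteq> 0"
      using perp_nontrivial[OF fW, of S] by metis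
    then have yW: "y \<in> ?W" and yS: "\<And>x. x \<in> S \<Longrightarrow> dot (C \<times> B) y x = 0" by (auto simp: perp_def)
    have "y = 0"
    proof (rule nz[OF yW])
      fix c assume c: "c \<in> C"
      have "dot B (\<lambda>b. y (c, b)) v = 0" if v: "v \<in> V" for v
      proof -
        let ?x = "\<lambda>(c', b). if c' = c then v b else 0"
        have "?x \<in> ?W" using V(2) v c by (auto simp: fam_def)
        moreover have "(\<lambda>b. ?x (c', b)) - cw I G 0 c' \<in> V" for c'
          using v zV by (cases "c' = c") (auto simp: cw_0 zero_fun_def[symmetric])
        ultimately have "?x \<in> S" unfolding S_def
          using addsub_zero[OF addsub_vecs, of J] by blast
        then have "dot (C \<times> B) y ?x = 0" by (rule yS)
        moreover have "dot (C \<times> B) y ?x = (\<Sum>c'\<in>C. \<Sum>b\<in>B. y (c', b) * (if c' = c then v b else 0))"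
          by (simp add: dot_def sum.cartesian_product split_def)
        moreover have "\<dots> = (\<Sum>c'\<in>C. if c' = c then \<Sum>b\<in>B. y (c', b) * v b else 0)"
          by (intro sum.cong) auto
        moreover have "\<dots> = dot B (\<lambda>b. y (c, b)) v" using fin c by (simp add: dot_def)
        ultimately show ?thesis by simp
      qed
      moreover have "(\<lambda>b. y (c, b)) \<in> vecs B" using yW by (auto simp: fam_def)
      ultimately show "(\<lambda>b. y (c, b)) \<in> perp B V" by (simp add: perp_def)
    next
      fix i assume i: "i \<in> J"
      have "(\<lambda>b. G i (c, b)) - cw I G (\<lambda>j. if j = i then 1 else 0) c \<in> V" for c
        using zV J i cw_unit[OF fin(1), of i G c] by auto
      moreover have "(\<lambda>j. if j = i then 1 else 0) \<in> vecs J" using i by (auto intro!: famI)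
      ultimately have "G i \<in> S" unfolding S_def using G J i by blast
      then show "dot (C \<times> B) y (G i) = 0" by (rule yS)
    qed
    then show False using y(2) by simp
  qed
  moreover have "(\<lambda>(c, b). X c b) \<in> ?W" using X by (auto simp: fam_def)
  ultimately have "(\<lambda>(c, b). X c b) \<in> S" by simp
  then show ?thesis by (simp add: S_def)
qed

text \<open>Random coding: the generators are drawn uniformly. By the union bound over the nonzero
  functionals that vanish modulo some \<open>V\<close>, fewer than half of the draws fail to be surjective
  modulo some \<open>V\<close>; Markov's inequality bounds the number of codewords in the sets \<open>N\<close>.\<close>

lemma code_exists:
  fixes VV NN :: "('b \<Rightarrow> 'a::{field,finite}) set set" and C :: "'c set" and I J :: "'i set"
  assumes fin: "finite I" "finite C" "finite B" "finite VV" "finite NN" and J: "J \<subseteq> I"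
    and V: "\<And>V. V \<in> VV \<Longrightarrow> subspc V \<and> V \<subseteq> vecs B \<and> card (perp B V) \<le> CARD('a) ^ m"
    and N: "\<And>N. N \<in> NN \<Longrightarrow> N \<subseteq> vecs B \<and> card N * CARD('a) ^ r \<le> CARD('a) ^ card B"
    and size: "2 * card VV * CARD('a) ^ (m * card C) < CARD('a) ^ card J"
  obtains G :: "'i \<Rightarrow> 'c \<times> 'b \<Rightarrow> 'a" where "\<And>i. i \<in> I \<Longrightarrow> G i \<in> vecs (C \<times> B)"
    "\<And>V X. V \<in> VV \<Longrightarrow> X \<in> fam C (vecs B) \<Longrightarrow> \<exists>L\<in>vecs J. \<forall>c\<in>C. X c - cw I G L c \<in> V"
    "\<And>N. N \<in> NN \<Longrightarrow> card {u \<in> vecs I. u \<noteq> 0 \<and> (\<forall>c\<in>C. cw I G u c \<in> N)} * CARD('a) ^ (r * card C)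
      \<le> 2 * card NN * CARD('a) ^ card I"
proof -
  let ?q = "CARD('a)" and ?W = "vecs (C \<times> B) :: ('c \<times> 'b \<Rightarrow> 'a) set"
  let ?GG = "PiE I (\<lambda>_. ?W)"
  \<comment> \<open>The members of \<open>E V\<close> are the possible witnesses against
    surjectivity modulo \<open>V\<close>; each column of one lies in \<open>perp B V\<close>, which
    leaves at most \<open>q ^ m\<close> choices.\<close>
  define E where "E V = {y \<in> ?W. y \<noteq> 0 \<and> (\<forall>c\<in>C. (\<lambda>b. y (c, b)) \<in> perp B V)}" for V :: "('b \<Rightarrow> 'a) set"
  define bad where "bad = (\<Union>V\<in>VV. \<Union>y\<in>E V. {G \<in> ?GG. \<forall>i\<in>J. dot (C \<times> B) y (G i) = 0})"
  have fCB: "finite (C \<times> B)" using fin by auto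
  have fW: "finite ?W" using fCB by (rule finite_vecs)
  have fGG: "finite ?GG" using fin fW by (intro finite_PiE) auto
  have GG0: "card ?GG > 0" using fin fW addsub_zero[OF addsub_vecs, of "C \<times> B"]
    by (auto simp: card_PiE card_gt_0_iff)
  have fE: "finite (E V)" for V using fW by (rule rev_finite_subset) (auto simp: E_def)
  have cE: "card (E V) \<le> ?q ^ (m * card C)" if "V \<in> VV" for V
  proof -
    have "inj_on (\<lambda>y c b. y (c, b)) (E V)" by (auto simp: inj_on_def fun_eq_iff)
    moreover have "(\<lambda>y c b. y (c, b)) ` E V \<subseteq> fam C (perp B V)"
      by (auto simp: E_def fam_def fun_eq_iff)
    moreover have fP: "finite (perp B V)"
      using finite_vecs[OF fin(3)] by (rule rev_finite_subset) (auto simp: perp_def)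
    ultimately have "card (E V) \<le> card (fam C (perp B V))"
      using fin(2) by (intro card_inj_on_le finite_fam) auto
    also have "\<dots> \<le> (?q ^ m) ^ card C"
      using V[OF that] fin(2) by (simp add: card_fam power_mono)
    finally show ?thesis by (simp add: power_mult)
  qed
  have "card bad * ?q ^ card J \<le> (\<Sum>V\<in>VV. \<Sum>y\<in>E V. card {G \<in> ?GG. \<forall>i\<in>J. dot (C \<times> B) y (G i) = 0}) * ?q ^ card J"
    unfolding bad_def
    by (intro mult_right_mono order_trans[OF card_UN_le] sum_mono fin fE) auto
  also have "\<dots> = (\<Sum>V\<in>VV. \<Sum>y\<in>E V. card ?GG)"
    unfolding sum_distrib_right
  proof (intro sum.cong refl)
    fix V y assume "V \<in> VV" "y \<in> E V"
    then have "y \<in> ?W" "y \<noteq> 0" by (auto simp: E_def)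
    then show "card {G \<in> ?GG. \<forall>i\<in>J. dot (C \<times> B) y (G i) = 0} * ?q ^ card J = card ?GG"
      by (rule card_orthogonal_generators[OF fCB _ _ fin(1) J])
  qed
  also have "\<dots> \<le> (\<Sum>V\<in>VV. ?q ^ (m * card C) * card ?GG)"
    using cE by (intro sum_mono) (simp add: mult_right_mono)
  finally have "card bad * ?q ^ card J \<le> card VV * ?q ^ (m * card C) * card ?GG" by (simp add: mult_ac)
  then have "2 * card bad * ?q ^ card J \<le> 2 * card VV * ?q ^ (m * card C) * card ?GG" by simp
  also have "\<dots> < ?q ^ card J * card ?GG" using size GG0 by (rule mult_strict_right_mono)
  finally have few: "2 * card bad < card ?GG" by (simp add: mult.commute)
  \<comment> \<open>All sets \<open>N\<close> are counted together, so that one choice of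
    \<open>G\<close> serves every \<open>N\<close>.\<close>
  define f where "f G = (\<Sum>N\<in>NN. card {u \<in> vecs I. u \<noteq> 0 \<and> (\<forall>c\<in>C. cw I G u c \<in> N)})"
    for G :: "'i \<Rightarrow> 'c \<times> 'b \<Rightarrow> 'a"
  let ?U = "{u \<in> vecs I. u \<noteq> 0} :: ('i \<Rightarrow> 'a) set" and ?Q = "?q ^ (r * card C)"
  have fU: "finite ?U" using finite_vecs[OF fin(1)] by auto
  have "(\<Sum>G\<in>?GG. f G) = (\<Sum>N\<in>NN. \<Sum>G\<in>?GG. card {u \<in> ?U. \<forall>c\<in>C. cw I G u c \<in> N})"
    unfolding f_def by (subst sum.swap) (simp add: conj_assoc)
  also have "\<dots> = (\<Sum>N\<in>NN. \<Sum>u\<in>?U. card {G \<in> ?GG. \<forall>c\<in>C. cw I G u c \<in> N})"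
    by (intro sum.cong refl sum_multicount_gen) (use fGG fU in auto)
  finally have "(\<Sum>G\<in>?GG. f G) * ?Q = (\<Sum>N\<in>NN. \<Sum>u\<in>?U. card {G \<in> ?GG. \<forall>c\<in>C. cw I G u c \<in> N} * ?Q)"
    by (simp add: sum_distrib_right)
  also have "\<dots> \<le> (\<Sum>N\<in>NN. \<Sum>u\<in>?U. card ?GG)"
    using N by (intro sum_mono card_generators_into fin) auto
  also have "\<dots> \<le> card NN * ?q ^ card I * card ?GG"
  proof -
    have "card ?U \<le> ?q ^ card I"
      using card_mono[OF finite_vecs[OF fin(1)], of ?U] by (auto simp: card_vecs[OF fin(1)])
    then show ?thesis by (simp add: mult_right_mono)
  qed
  finally have avg: "(\<Sum>G\<in>?GG. f G * ?Q) \<le> card NN * ?q ^ card I * card ?GG"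
    by (simp add: sum_distrib_right)
  have "\<exists>G\<in>?GG - bad. f G * ?Q \<le> 2 * card NN * ?q ^ card I"
  proof (rule ccontr)
    assume "\<not> ?thesis"
    \<comment> \<open>The \<open>+ 1\<close> restates strictness in the naturals and keeps the
      factor positive when \<open>NN\<close> is empty. More than half of the draws avoid
      \<open>bad\<close>, so their sum alone would exceed the bound \<open>avg\<close>.\<close>
    then have "2 * card NN * ?q ^ card I + 1 \<le> f G * ?Q" if "G \<in> ?GG - bad" for G using that by force
    then have "(\<Sum>G\<in>?GG - bad. 2 * card NN * ?q ^ card I + 1) \<le> (\<Sum>G\<in>?GG - bad. f G * ?Q)"
      by (intro sum_mono)
    also have "\<dots> \<le> (\<Sum>G\<in>?GG. f G * ?Q)" using fGG by (intro sum_mono2) auto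
    finally have "card (?GG - bad) * (2 * card NN * ?q ^ card I + 1) \<le> card NN * ?q ^ card I * card ?GG"
      using avg by simp
    then have "2 * card (?GG - bad) * (2 * (card NN * ?q ^ card I) + 1) \<le> 2 * (card NN * ?q ^ card I) * card ?GG"
      by (simp add: algebra_simps)
    moreover have "card ?GG < 2 * card (?GG - bad)"
    proof -
      have "bad \<subseteq> ?GG" by (auto simp: bad_def)
      then show ?thesis using few fGG by (simp add: card_Diff_subset finite_subset)
    qed
    then have "card ?GG * (2 * (card NN * ?q ^ card I) + 1) < 2 * card (?GG - bad) * (2 * (card NN * ?q ^ card I) + 1)"
      by (intro mult_strict_right_mono) auto
    ultimately have "card ?GG * (2 * (card NN * ?q ^ card I) + 1) < 2 * (card NN * ?q ^ card I) * card ?GG"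
      by (rule order.strict_trans2[rotated])
    then show False by (simp add: algebra_simps)
  qed
  then obtain G where G: "G \<in> ?GG" "G \<notin> bad" "f G * ?Q \<le> 2 * card NN * ?q ^ card I" by blast
  show thesis
  proof (rule that)
    show GW: "G i \<in> ?W" if "i \<in> I" for i using G(1) that by auto
    show "\<exists>L\<in>vecs J. \<forall>c\<in>C. X c - cw I G L c \<in> V" if V': "V \<in> VV" and X: "X \<in> fam C (vecs B)" for V X
    proof (rule surjective_mod_or_orthogonal[OF fin(1-3) J _ _ GW _ X])
      fix y assume y: "y \<in> ?W" "\<And>c. c \<in> C \<Longrightarrow> (\<lambda>b. y (c, b)) \<in> perp B V" "\<And>i. i \<in> J \<Longrightarrow> dot (C \<times> B) y (G i) = 0"
      show "y = 0"
      proof (rule ccontr)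
        assume "y \<noteq> 0"
        then have "G \<in> bad" using y G(1) V' by (auto simp: bad_def E_def)
        then show False using G(2) by simp
      qed
    qed (use V[OF V'] in auto)
    show "card {u \<in> vecs I. u \<noteq> 0 \<and> (\<forall>c\<in>C. cw I G u c \<in> N)} * ?Q \<le> 2 * card NN * ?q ^ card I"
      if "N \<in> NN" for N
    proof -
      have "card {u \<in> vecs I. u \<noteq> 0 \<and> (\<forall>c\<in>C. cw I G u c \<in> N)} \<le> f G"
        unfolding f_def by (rule member_le_sum[OF that]) (use fin in auto)
      then show ?thesis using G(3) by (meson le_trans mult_right_mono zero_le)
    qed
  qed
qed

section \<open>The secret signalling scheme\<close>

definition lin :: "(('i \<Rightarrow> 'a::field) \<Rightarrow> 'j \<Rightarrow> 'a) \<Rightarrow> bool"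
  where "lin f \<longleftrightarrow> (\<forall>x y. f (x - y) = f x - f y) \<and> (\<forall>c x. f (smul c x) = smul c (f x))"

lemma lin_diff: "lin f \<Longrightarrow> f (x - y) = f x - f y"
  and lin_smul: "lin f \<Longrightarrow> f (smul c x) = smul c (f x)"
  by (auto simp: lin_def)

lemma lin_0: "lin f \<Longrightarrow> f 0 = 0"
  using lin_diff[of f 0 0] by simp

lemma lin_minus: "lin f \<Longrightarrow> f (- x) = - f x"
  using lin_diff[of f 0 x] by (simp only: lin_0 diff_0)

lemma lin_add: "lin f \<Longrightarrow> f (x + y) = f x + f y"
  using lin_diff[of f x "- y"] by (simp only: lin_minus diff_minus_eq_add)

lemma lin_sum: "lin f \<Longrightarrow> f (sum g A) = (\<Sum>i\<in>A. f (g i))"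
  by (induction A rule: infinite_finite_induct) (auto simp: lin_0 lin_add)

lemma smul_diff: "smul (c::'a::ring) (x - y) = smul c x - smul c y"
  and smul_diff_left: "smul (c - d) x = smul c x - smul d x"
  and smul_0: "smul 0 x = 0"
  by (simp_all add: smul_def fun_eq_iff algebra_simps)

lemma smul_1: "smul (1::'a::monoid_mult) x = x"
  by (simp add: smul_def)

lemma sum_fun_apply: "sum f A x = (\<Sum>i\<in>A. f i x)" for f :: "'i \<Rightarrow> 'x \<Rightarrow> 'a::comm_monoid_add"
  by (induction A rule: infinite_finite_induct) auto

lemma fam_vecs_out: "X \<in> fam C (vecs B) \<Longrightarrow> b \<notin> B \<Longrightarrow> X c b = 0"
  by (cases "c \<in> C") (auto simp: fam_def)

text \<open>The secret symbols: \<open>Inl (t, i)\<close> is entry \<open>i\<close> of key column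
  \<open>t\<close>, and \<open>Inr (t, j, b)\<close> is entry \<open>b\<close> of the product of
  block \<open>j\<close> with key column \<open>t\<close>.\<close>

type_synonym sym = "nat \<times> nat + nat \<times> nat \<times> nat"

text \<open>\<open>m\<close> is the height of a column, \<open>n\<close> both the number of key
  columns and of repetitions of a signal, \<open>p\<close> the number of blocks and their width,
  \<open>l\<close> the length of a signal block. \<open>KK\<close> holds Bob's candidates, each a
  channel map with the subspace filled by the noise; \<open>EE\<close> holds the maps from the input
  to Eve. \<open>G_inj\<close> makes the code decodable modulo the noise of any candidate,
  \<open>G_surj\<close> and \<open>H_surj\<close> let the scramble imitate anything Eve could see,
  and \<open>separating\<close> with \<open>H_thin\<close> lets uniform blocks escape false
  explanations.\<close>

locale secret_scheme =
  fixes m n p l :: nat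
    and KK :: "(((nat \<Rightarrow> 'a::{field,finite}) \<Rightarrow> nat \<Rightarrow> 'a) \<times> (nat \<Rightarrow> 'a) set) set"
    and EE :: "((nat \<Rightarrow> 'a) \<Rightarrow> nat \<Rightarrow> 'a) set"
    and IM IL J :: "nat set"
    and G :: "nat \<Rightarrow> (nat \<times> nat) \<times> nat \<Rightarrow> 'a" and H :: "nat \<Rightarrow> nat \<times> nat \<Rightarrow> 'a"
  assumes fin: "finite KK" "finite IM" "finite IL" "finite J" and disj: "IM \<inter> IL = {}"
    and KK: "\<And>K S. (K, S) \<in> KK \<Longrightarrow> lin K" "\<And>K S. (K, S) \<in> KK \<Longrightarrow> subspc S"
    and EE: "\<And>E. E \<in> EE \<Longrightarrow> lin E"
    and separating: "\<And>K S K' S' E. (K, S) \<in> KK \<Longrightarrow> (K', S') \<in> KK \<Longrightarrow> E \<in> EE \<Longrightarrow>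
      \<exists>v\<in>vecs {..<m}. E v = 0 \<and> K v \<notin> S'"
    and G: "\<And>i. i \<in> IM \<union> IL \<Longrightarrow> G i \<in> vecs (({..<p} \<times> {..<p}) \<times> {..<m})"
    and G_inj: "\<And>K S u. (K, S) \<in> KK \<Longrightarrow> u \<in> vecs (IM \<union> IL) \<Longrightarrow>
      (\<And>c. c \<in> {..<p} \<times> {..<p} \<Longrightarrow> K (cw (IM \<union> IL) G u c) \<in> S) \<Longrightarrow> u = 0"
    and G_surj: "\<And>E X. E \<in> EE \<Longrightarrow> X \<in> fam ({..<p} \<times> {..<p}) (vecs {..<m}) \<Longrightarrow>
      \<exists>L\<in>vecs IL. \<forall>c\<in>{..<p} \<times> {..<p}. E (cw (IM \<union> IL) G L c) = E (X c)"
    and H: "\<And>i. i \<in> J \<Longrightarrow> H i \<in> vecs ({..<l} \<times> {..<m})"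
    and H_surj: "\<And>E X. E \<in> EE \<Longrightarrow> X \<in> fam {..<l} (vecs {..<m}) \<Longrightarrow>
      \<exists>L\<in>vecs J. \<forall>c\<in>{..<l}. E (cw J H L c) = E (X c)"
    and H_thin: "\<And>K S x. (K, S) \<in> KK \<Longrightarrow> x \<notin> S \<Longrightarrow>
      \<exists>y\<in>vecs {..<l}. \<not> (\<exists>L\<in>vecs J. \<forall>c\<in>{..<l}. smul (y c) x - K (cw J H L c) \<in> S)"
begin

abbreviation "mcols \<equiv> {..<p} \<times> {..<p}"

definition syms :: "sym set"
  where "syms = ({..<n} \<times> {..<p}) <+> ({..<n} \<times> {..<p} \<times> {..<m})"

abbreviation "sigs \<equiv> syms \<times> (UNIV :: 'a set) \<times> {..<n}"

lemma finite_syms: "finite syms"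
  by (simp add: syms_def)

lemma card_syms: "card syms = n * p * (m + 1)"
  by (simp add: syms_def card_Plus card_cartesian_product algebra_simps)

text \<open>\<open>M\<close> and \<open>L\<close> live on the disjoint index sets \<open>IM\<close>
  and \<open>IL\<close>, so \<open>M + L\<close> is their concatenation.\<close>

definition xmain :: "(nat \<Rightarrow> 'a) \<Rightarrow> (nat \<Rightarrow> 'a) \<Rightarrow> nat \<times> nat \<Rightarrow> nat \<Rightarrow> 'a"
  where "xmain M L = cw (IM \<union> IL) G (M + L)"

text \<open>Column \<open>t\<close> of the product of block \<open>j\<close> with the key; a sum
  over columns, it commutes with every linear channel map.\<close>

definition hash :: "(nat \<Rightarrow> nat \<Rightarrow> 'a) \<Rightarrow> (nat \<times> nat \<Rightarrow> nat \<Rightarrow> 'a) \<Rightarrow> nat \<Rightarrow> nat \<Rightarrow> nat \<Rightarrow> 'a"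
  where "hash R X t j = (\<Sum>i<p. smul (R t i) (X (j, i)))"

definition secret :: "(nat \<Rightarrow> nat \<Rightarrow> 'a) \<Rightarrow> (nat \<times> nat \<Rightarrow> nat \<Rightarrow> 'a) \<Rightarrow> sym \<Rightarrow> 'a"
  where "secret R X s = (case s of Inl (t, i) \<Rightarrow> R t i | Inr (t, j, b) \<Rightarrow> hash R X t j b)"

text \<open>The triple \<open>\<sigma>\<close> names a symbol, a proposed value and a repetition.
  The random codeword is present in the uniform case too: it leaves the block uniform, and it is
  what absorbs Eve's image of \<open>US\<close> when the randomness is recoded.\<close>

definition xsig :: "(sym \<Rightarrow> 'a) \<Rightarrow> (sym \<times> 'a \<times> nat \<Rightarrow> nat \<Rightarrow> 'a) \<Rightarrow>
    (sym \<times> 'a \<times> nat \<Rightarrow> nat \<Rightarrow> nat \<Rightarrow> 'a) \<Rightarrow> sym \<times> 'a \<times> nat \<Rightarrow> nat \<Rightarrow> nat \<Rightarrow> 'a"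
  where "xsig k LS US \<sigma> c = cw J H (LS \<sigma>) c + (if k (fst \<sigma>) = fst (snd \<sigma>) then 0 else US \<sigma> c)"

section \<open>Bob's decoder and its correctness outside the bad events\<close>

definition accepts where
  "accepts K S ys s v \<longleftrightarrow> (\<forall>r<n. \<exists>L\<in>vecs J. \<forall>c\<in>{..<l}. ys (s, v, r) c - K (cw J H L c) \<in> S)"

definition read_secret :: "(sym \<times> 'a \<times> nat \<Rightarrow> nat \<Rightarrow> nat \<Rightarrow> 'a) \<Rightarrow> sym \<Rightarrow> 'a"
  where "read_secret ys s = (SOME v. \<exists>(K, S)\<in>KK. accepts K S ys s v)"

text \<open>The function under \<open>K\<close> reassembles a product column from its separately
  transmitted symbols.\<close>

definition passes :: "((nat \<Rightarrow> 'a) \<Rightarrow> nat \<Rightarrow> 'a) \<Rightarrow> (nat \<Rightarrow> 'a) set \<Rightarrow> (sym \<Rightarrow> 'a) \<Rightarrow>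
    (nat \<times> nat \<Rightarrow> nat \<Rightarrow> 'a) \<Rightarrow> bool"
  where "passes K S k ym \<longleftrightarrow> (\<forall>t<n. \<forall>j<p.
    hash (\<lambda>t i. k (Inl (t, i))) ym t j - K (\<lambda>b. if b < m then k (Inr (t, j, b)) else 0) \<in> S)"

definition explains where
  "explains k ym M \<longleftrightarrow> (\<exists>(K, S)\<in>KK. passes K S k ym \<and> (\<exists>L\<in>vecs IL. \<forall>c\<in>mcols. ym c - K (xmain M L c) \<in> S))"

definition decode :: "(nat \<times> nat \<Rightarrow> nat \<Rightarrow> 'a) \<Rightarrow> (sym \<times> 'a \<times> nat \<Rightarrow> nat \<Rightarrow> nat \<Rightarrow> 'a) \<Rightarrow> nat \<Rightarrow> 'a"
  where "decode ym ys = (if \<exists>M\<in>vecs IM. explains (read_secret ys) ym M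
    then SOME M. M \<in> vecs IM \<and> explains (read_secret ys) ym M else 0)"

lemma xmain_fam: "xmain M L \<in> fam mcols (vecs {..<m})"
  unfolding xmain_def by (rule cw_vecs) (rule G)

lemma xmain_diff: "xmain M L c - xmain M' L' c = cw (IM \<union> IL) G (M - M' + (L - L')) c"
  unfolding xmain_def cw_diff[symmetric] by (simp add: algebra_simps)

text \<open>By linearity, the hash of the received word minus \<open>K\<close> of the announced hash
  is the hash of the residuals \<open>ym c - K (X c)\<close>. Passing thus means that random linear
  combinations of the residuals lie in \<open>S\<close>.\<close>

lemma hash_passes:
  assumes "lin K" "X \<in> fam mcols (vecs {..<m})"
  shows "passes K S (secret R X) ym \<longleftrightarrow>
    (\<forall>t<n. \<forall>j<p. (\<Sum>i<p. smul (R t i) (ym (j, i) - K (X (j, i)))) \<in> S)"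
proof -
  have "hash R ym t j - K (\<lambda>b. if b < m then hash R X t j b else 0)
    = (\<Sum>i<p. smul (R t i) (ym (j, i) - K (X (j, i))))" if "j < p" for t j
  proof -
    have "X (j, i) b = 0" if "b \<ge> m" for i b
      using fam_vecs_out[OF assms(2), of b "(j, i)"] that by simp
    then have "(\<lambda>b. if b < m then hash R X t j b else 0) = hash R X t j"
      by (auto simp: hash_def sum_fun_apply smul_def fun_eq_iff)
    then show ?thesis
      using assms(1) by (simp add: hash_def lin_sum lin_smul smul_diff sum_subtractf)
  qed
  then show ?thesis by (simp add: passes_def secret_def cong: if_cong)
qed

text \<open>The deterministic half of correctness, with both kinds of bad event excluded. A
  candidate that passes agrees with the true word modulo its \<open>S\<close>; if it also explains
  \<open>M'\<close>, it maps the difference of the two codewords into \<open>S\<close>, and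
  \<open>G_inj\<close> makes them equal.\<close>

lemma decode_correct:
  assumes K: "(K\<^sub>0, S\<^sub>0) \<in> KK" and M: "M \<in> vecs IM" and L: "L \<in> vecs IL"
    and LS: "LS \<in> fam sigs (vecs J)"
    and k: "k = secret R (xmain M L)"
    and ym: "\<And>c. c \<in> mcols \<Longrightarrow> ym c - K\<^sub>0 (xmain M L c) \<in> S\<^sub>0"
    and ys: "\<And>\<sigma> c. \<sigma> \<in> sigs \<Longrightarrow> c < l \<Longrightarrow> ys \<sigma> c - K\<^sub>0 (xsig k LS US \<sigma> c) \<in> S\<^sub>0"
    and no_false_symbol: "\<And>K S s v. (K, S) \<in> KK \<Longrightarrow> s \<in> syms \<Longrightarrow> v \<noteq> k s \<Longrightarrow> \<not> accepts K S ys s v"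
    and no_false_pass: "\<And>K S c. (K, S) \<in> KK \<Longrightarrow> passes K S k ym \<Longrightarrow> c \<in> mcols \<Longrightarrow>
      ym c - K (xmain M L c) \<in> S"
  shows "decode ym ys = M"
proof -
  have read: "read_secret ys s = k s" if s: "s \<in> syms" for s
  proof -
    have "accepts K\<^sub>0 S\<^sub>0 ys s (k s)"
      unfolding accepts_def
    proof (intro allI impI)
      fix r assume "r < n"
      then have "(s, k s, r) \<in> sigs" using s by auto
      then show "\<exists>L\<in>vecs J. \<forall>c\<in>{..<l}. ys (s, k s, r) c - K\<^sub>0 (cw J H L c) \<in> S\<^sub>0"
        using ys[of "(s, k s, r)"] fam_mem[OF LS, of "(s, k s, r)"] by (auto simp: xsig_def)
    qed
    then show ?thesis
      unfolding read_secret_def using K no_false_symbol[OF _ s] by (intro some_equality) auto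
  qed
  have passes_read: "passes K S (read_secret ys) ym \<longleftrightarrow> passes K S k ym" for K S
  proof -
    have "read_secret ys (Inl (t, i)) = k (Inl (t, i))" if "t < n" "i < p" for t i
      using that by (intro read) (auto simp: syms_def)
    then have "hash (\<lambda>t i. read_secret ys (Inl (t, i))) ym t j = hash (\<lambda>t i. k (Inl (t, i))) ym t j"
      if "t < n" for t j using that by (simp add: hash_def)
    moreover have "(\<lambda>b. if b < m then read_secret ys (Inr (t, j, b)) else 0)
        = (\<lambda>b. if b < m then k (Inr (t, j, b)) else 0)" if "t < n" "j < p" for t j
      using that by (intro ext) (auto simp: syms_def intro!: read)
    ultimately show ?thesis by (simp add: passes_def)
  qed
  have "passes K\<^sub>0 S\<^sub>0 k ym"
    unfolding k hash_passes[OF KK(1)[OF K] xmain_fam]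
    using ym by (intro allI impI addsub_sum subspc_addsub subspc_smul KK(2)[OF K]) auto
  then have expl: "explains (read_secret ys) ym M"
    unfolding explains_def passes_read using K L ym by blast
  have uniq: "M' = M" if M': "M' \<in> vecs IM" and ex: "explains (read_secret ys) ym M'" for M'
  proof -
    from ex obtain K S L' where K': "(K, S) \<in> KK" and pass: "passes K S k ym" and L': "L' \<in> vecs IL"
      and close: "\<And>c. c \<in> mcols \<Longrightarrow> ym c - K (xmain M' L' c) \<in> S"
      unfolding explains_def passes_read by blast
    have "M' - M + (L' - L) = 0"
    proof (rule G_inj[OF K'])
      show "M' - M + (L' - L) \<in> vecs (IM \<union> IL)"
        using M M' L L' by (auto simp: fam_def)
      fix c assume c: "c \<in> mcols"
      have "(ym c - K (xmain M L c)) - (ym c - K (xmain M' L' c)) \<in> S"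
        using no_false_pass[OF K' pass c] close[OF c] subspc_addsub[OF KK(2)[OF K']] by (blast intro: addsub_diff)
      then show "K (cw (IM \<union> IL) G (M' - M + (L' - L)) c) \<in> S"
        by (simp add: xmain_diff[symmetric] lin_diff[OF KK(1)[OF K']])
    qed
    then have zero: "(M' - M + (L' - L)) i = 0" for i by simp
    show "M' = M"
    proof
      fix i show "M' i = M i"
      proof (cases "i \<in> IM")
        case True
        then have "i \<notin> IL" using disj by auto
        then show ?thesis using zero[of i] fam_out[OF L] fam_out[OF L'] by simp
      next
        case False
        then show ?thesis using fam_out[OF M] fam_out[OF M'] by simp
      qed
    qed
  qed
  show ?thesis
  proof -
    have "(SOME M. M \<in> vecs IM \<and> explains (read_secret ys) ym M) = M"
      by (rule some_equality[where P = "\<lambda>M. M \<in> vecs IM \<and> explains (read_secret ys) ym M", OF conjI[OF M expl]])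
         (rule uniq; blast)
    moreover have "\<exists>M\<in>vecs IM. explains (read_secret ys) ym M" using expl M by (rule bexI)
    ultimately show ?thesis unfolding decode_def by (simp only: if_True)
  qed
qed

section \<open>Alice's randomness (scramble, hash key, signal scrambles, uniform blocks) and Eve's
  view\<close>

definition rands :: "((nat \<Rightarrow> 'a) \<times> (nat \<Rightarrow> nat \<Rightarrow> 'a) \<times> (sym \<times> 'a \<times> nat \<Rightarrow> nat \<Rightarrow> 'a) \<times>
    (sym \<times> 'a \<times> nat \<Rightarrow> nat \<Rightarrow> nat \<Rightarrow> 'a)) set"
  where "rands = vecs IL \<times> fam {..<n} (vecs {..<p}) \<times> fam sigs (vecs J) \<times> fam sigs (fam {..<l} (vecs {..<m}))"

lemma finite_rands: "finite rands"
proof -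
  have v: "finite (vecs {..<k} :: (nat \<Rightarrow> 'a) set)" for k by (simp add: finite_vecs)
  have "finite sigs" by (simp add: finite_syms)
  then show ?thesis unfolding rands_def
    using finite_vecs[OF fin(3)] finite_fam[OF _ v, of "{..<n}" p] finite_fam[OF _ finite_vecs[OF fin(4)], of sigs]
      finite_fam[OF _ finite_fam[OF _ v], of sigs "{..<l}" m]
    by (intro finite_cartesian_product) simp_all
qed

lemma rands_nonempty: "rands \<noteq> {}"
proof -
  have "addsub (vecs IL :: (nat \<Rightarrow> 'a) set)" "addsub (fam {..<n} (vecs {..<p} :: (nat \<Rightarrow> 'a) set))"
    "addsub (fam sigs (vecs J :: (nat \<Rightarrow> 'a) set))"
    "addsub (fam sigs (fam {..<l} (vecs {..<m} :: (nat \<Rightarrow> 'a) set)))"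
    by (intro addsub_fam addsub_UNIV)+
  then show ?thesis unfolding rands_def by (blast dest: addsub_zero)
qed

definition enc_main where
  "enc_main M \<omega> = (case \<omega> of (L, R, LS, US) \<Rightarrow> xmain M L)"

definition enc_sig where
  "enc_sig M \<omega> = (case \<omega> of (L, R, LS, US) \<Rightarrow> xsig (secret R (xmain M L)) LS US)"

definition eve_view where
  "eve_view E M \<omega> = ((\<lambda>c. E (enc_main M \<omega> c)), (\<lambda>\<sigma> c. E (enc_sig M \<omega> \<sigma> c)))"

definition base_view where
  "base_view E L LS = ((\<lambda>c. E (cw (IM \<union> IL) G L c)), (\<lambda>\<sigma> c. E (cw J H (LS \<sigma>) c)))"

text \<open>A scramble vector that cancels Eve's image of the message.\<close>

definition mask_main :: "((nat \<Rightarrow> 'a) \<Rightarrow> nat \<Rightarrow> 'a) \<Rightarrow> (nat \<Rightarrow> 'a) \<Rightarrow> nat \<Rightarrow> 'a"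
  where "mask_main E M = (SOME L. L \<in> vecs IL \<and> (\<forall>c\<in>mcols. E (cw (IM \<union> IL) G L c) = - E (cw (IM \<union> IL) G M c)))"

text \<open>The choice depends on a uniform block only through Eve's image of it,
  \<open>snd w\<close> being that image. Moving the block in a direction invisible to Eve therefore
  leaves the mask untouched, on which \<open>false_symbol_count\<close> relies.\<close>

definition mask_sig :: "((nat \<Rightarrow> 'a) \<Rightarrow> nat \<Rightarrow> 'a) \<times> (nat \<Rightarrow> nat \<Rightarrow> 'a) \<Rightarrow> nat \<Rightarrow> 'a"
  where "mask_sig w = (SOME L. L \<in> vecs J \<and> (\<forall>c\<in>{..<l}. (fst w) (cw J H L c) = - snd w c))"

definition sig_shift :: "((nat \<Rightarrow> 'a) \<Rightarrow> nat \<Rightarrow> 'a) \<Rightarrow> (sym \<Rightarrow> 'a) \<Rightarrow>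
    (sym \<times> 'a \<times> nat \<Rightarrow> nat \<Rightarrow> nat \<Rightarrow> 'a) \<Rightarrow> sym \<times> 'a \<times> nat \<Rightarrow> nat \<Rightarrow> 'a"
  where "sig_shift E k US \<sigma> = (if \<sigma> \<in> sigs \<and> k (fst \<sigma>) \<noteq> fst (snd \<sigma>) then mask_sig (E, \<lambda>c. E (US \<sigma> c)) else 0)"

text \<open>A change of coordinates on the randomness that adds to each scramble part what hides the
  message, or the uniform block, from Eve. The shift of \<open>LS\<close> uses the secret belonging
  to the already shifted \<open>L\<close>, because that is the word actually encoded.\<close>

definition recode where
  "recode E M \<omega> = (case \<omega> of (L, R, LS, US) \<Rightarrow>
    (L + mask_main E M, R, (\<lambda>\<sigma>. LS \<sigma> + sig_shift E (secret R (xmain M (L + mask_main E M))) US \<sigma>), US))"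

lemma mask_main:
  assumes E: "E \<in> EE"
  shows "mask_main E M \<in> vecs IL" "c \<in> mcols \<Longrightarrow> E (cw (IM \<union> IL) G (mask_main E M) c) = - E (cw (IM \<union> IL) G M c)"
proof -
  have "(\<lambda>c. - cw (IM \<union> IL) G M c) \<in> fam mcols (vecs {..<m})"
    using cw_vecs[of "IM \<union> IL" G mcols "{..<m}" M, OF G] by (auto simp: fam_def)
  from G_surj[OF E this] obtain L where
    "L \<in> vecs IL \<and> (\<forall>c\<in>mcols. E (cw (IM \<union> IL) G L c) = - E (cw (IM \<union> IL) G M c))"
    by (auto simp: lin_minus[OF EE[OF E]])
  from someI[of "\<lambda>L. L \<in> vecs IL \<and> (\<forall>c\<in>mcols. E (cw (IM \<union> IL) G L c) = - E (cw (IM \<union> IL) G M c))", OF this]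
  show "mask_main E M \<in> vecs IL" "c \<in> mcols \<Longrightarrow> E (cw (IM \<union> IL) G (mask_main E M) c) = - E (cw (IM \<union> IL) G M c)"
    unfolding mask_main_def by blast+
qed

lemma mask_sig:
  assumes E: "E \<in> EE" and U: "U \<in> fam {..<l} (vecs {..<m})"
  shows "mask_sig (E, \<lambda>c. E (U c)) \<in> vecs J" "c < l \<Longrightarrow> E (cw J H (mask_sig (E, \<lambda>c. E (U c))) c) = - E (U c)"
proof -
  have "- U \<in> fam {..<l} (vecs {..<m})" using U by (auto simp: fam_def)
  from H_surj[OF E this] obtain L where
    "L \<in> vecs J \<and> (\<forall>c\<in>{..<l}. E (cw J H L c) = - E (U c))"
    by (auto simp: lin_minus[OF EE[OF E]])
  from someI[of "\<lambda>L. L \<in> vecs J \<and> (\<forall>c\<in>{..<l}. E (cw J H L c) = - E (U c))", OF this]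
  show "mask_sig (E, \<lambda>c. E (U c)) \<in> vecs J" "c < l \<Longrightarrow> E (cw J H (mask_sig (E, \<lambda>c. E (U c))) c) = - E (U c)"
    unfolding mask_sig_def by simp_all
qed

lemma sig_shift_fam:
  assumes "E \<in> EE" "US \<in> fam sigs (fam {..<l} (vecs {..<m}))"
  shows "sig_shift E k US \<in> fam sigs (vecs J)"
proof (intro famI[of sigs])
  fix \<sigma> assume "\<sigma> \<in> sigs"
  then have "mask_sig (E, \<lambda>c. E (US \<sigma> c)) \<in> vecs J" by (intro mask_sig assms fam_mem[OF assms(2)])
  then show "sig_shift E k US \<sigma> \<in> vecs J"
    using addsub_zero[OF addsub_vecs, of J] unfolding sig_shift_def by (cases "k (fst \<sigma>) = fst (snd \<sigma>)") auto
qed (auto simp: sig_shift_def)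

text \<open>The shift of \<open>L\<close> is constant and that of \<open>LS\<close> depends on the
  other components only, so the map is triangular and can be undone.\<close>

lemma recode_bij:
  assumes E: "E \<in> EE"
  shows "bij_betw (recode E M) rands rands"
proof (rule bij_betw_byWitness)
  \<comment> \<open>Here \<open>L\<close> is already shifted, so the secret is computed from
    \<open>L\<close> itself.\<close>
  define unrecode where "unrecode \<omega> = (case \<omega> of (L, R, LS, US) \<Rightarrow> (L - mask_main E M, R,
    LS - sig_shift E (secret R (xmain M L)) US, US))"
    for \<omega> :: "(nat \<Rightarrow> 'a) \<times> (nat \<Rightarrow> nat \<Rightarrow> 'a) \<times> (sym \<times> 'a \<times> nat \<Rightarrow> nat \<Rightarrow> 'a) \<times>
      (sym \<times> 'a \<times> nat \<Rightarrow> nat \<Rightarrow> nat \<Rightarrow> 'a)"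
  have *: "recode E M (L, R, LS, US) = (L + mask_main E M, R,
    LS + sig_shift E (secret R (xmain M (L + mask_main E M))) US, US)" for L R LS US
    by (simp add: recode_def plus_fun_def)
  show "\<forall>\<omega>\<in>rands. unrecode (recode E M \<omega>) = \<omega>"
  proof
    fix \<omega> assume "\<omega> \<in> rands"
    obtain L R LS US where "\<omega> = (L, R, LS, US)" by (cases \<omega>)
    then show "unrecode (recode E M \<omega>) = \<omega>" by (simp only: * unrecode_def prod.case add_diff_cancel_right')
  qed
  show "\<forall>\<omega>\<in>rands. recode E M (unrecode \<omega>) = \<omega>"
  proof
    fix \<omega> assume "\<omega> \<in> rands"
    obtain L R LS US where "\<omega> = (L, R, LS, US)" by (cases \<omega>)
    then show "recode E M (unrecode \<omega>) = \<omega>" by (simp only: * unrecode_def prod.case diff_add_cancel)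
  qed
  have gr: "addsub (vecs IL :: (nat \<Rightarrow> 'a) set)" "addsub (fam sigs (vecs J :: (nat \<Rightarrow> 'a) set))"
    by (intro addsub_fam addsub_UNIV)+
  show "recode E M ` rands \<subseteq> rands"
    using mask_main(1)[OF E, of M] sig_shift_fam[OF E] gr
    by (auto simp: rands_def * addsub_add)
  show "unrecode ` rands \<subseteq> rands"
    using mask_main(1)[OF E, of M] sig_shift_fam[OF E] gr
    by (auto simp: rands_def unrecode_def addsub_diff)
qed

lemma enc_main_fam: "enc_main M \<omega> \<in> fam mcols (vecs {..<m})"
  by (cases \<omega>) (simp add: enc_main_def xmain_fam)

lemma enc_sig_fam:
  assumes "\<omega> \<in> rands"
  shows "enc_sig M \<omega> \<in> fam sigs (fam {..<l} (vecs {..<m}))"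
proof -
  obtain L R LS US where w: "\<omega> = (L, R, LS, US)" by (cases \<omega>)
  have LS: "LS \<in> fam sigs (vecs J)" and US: "US \<in> fam sigs (fam {..<l} (vecs {..<m}))"
    using assms by (auto simp: w rands_def)
  have cwf: "cw J H (LS \<sigma>) \<in> fam {..<l} (vecs {..<m})" for \<sigma> by (rule cw_vecs) (rule H)
  have gr: "addsub (vecs {..<m} :: (nat \<Rightarrow> 'a) set)" "addsub (fam {..<l} (vecs {..<m} :: (nat \<Rightarrow> 'a) set))"
    by (intro addsub_fam addsub_UNIV)+
  show ?thesis
  proof (rule famI)
    fix \<sigma> assume "\<sigma> \<in> sigs"
    then have "(\<lambda>c. if b then 0 else US \<sigma> c) \<in> fam {..<l} (vecs {..<m})" for b
      using fam_mem[OF US] addsub_zero[OF gr(2)] by (cases b) (auto simp: zero_fun_def)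
    from addsub_add[OF gr(2) cwf this] show "enc_sig M \<omega> \<sigma> \<in> fam {..<l} (vecs {..<m})"
      unfolding w enc_sig_def prod.case xsig_def plus_fun_def by auto
  next
    fix \<sigma> assume "\<sigma> \<notin> sigs"
    then have "LS \<sigma> = 0" "US \<sigma> = 0" using fam_out[OF LS] fam_out[OF US] by blast+
    then show "enc_sig M \<omega> \<sigma> = 0"
      by (intro ext[of "enc_sig M \<omega> \<sigma>"]) (simp add: w enc_sig_def xsig_def cw_0)
  qed
qed

text \<open>In the new coordinates Eve's view is a function of the scramble parts \<open>L\<close> and \<open>LS\<close> alone;
  message, hash key and uniform blocks are independent of it.\<close>

lemma eve_view_recode:
  assumes E: "E \<in> EE" and w: "(L, R, LS, US) \<in> rands"
  shows "eve_view E M (recode E M (L, R, LS, US)) = base_view E L LS"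
proof -
  have LS: "LS \<in> fam sigs (vecs J)" and US: "US \<in> fam sigs (fam {..<l} (vecs {..<m}))"
    using w by (auto simp: rands_def)
  have l: "lin E" by (rule EE[OF E])
  let ?k = "secret R (xmain M (L + mask_main E M))"
  have main: "E (xmain M (L + mask_main E M) c) = E (cw (IM \<union> IL) G L c)" for c
  proof (cases "c \<in> mcols")
    case True
    then show ?thesis using mask_main(2)[OF E True, of M]
      by (simp add: xmain_def cw_add lin_add[OF l])
  next
    case False
    have "xmain M (L + mask_main E M) c = 0" "cw (IM \<union> IL) G L c = 0"
      using fam_out[OF xmain_fam False] fam_out[OF cw_vecs[of "IM \<union> IL" G mcols "{..<m}", OF G] False] by auto
    then show ?thesis by simp
  qed
  have sig: "E (xsig ?k (\<lambda>\<sigma>. LS \<sigma> + sig_shift E ?k US \<sigma>) US \<sigma> c) = E (cw J H (LS \<sigma>) c)" for \<sigma> c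
  proof (cases "\<sigma> \<in> sigs \<and> ?k (fst \<sigma>) \<noteq> fst (snd \<sigma>)")
    case True
    then have U: "US \<sigma> \<in> fam {..<l} (vecs {..<m})" using fam_mem[OF US] by blast
    show ?thesis
    proof (cases "c < l")
      case True
      then show ?thesis using \<open>\<sigma> \<in> sigs \<and> _\<close> mask_sig(2)[OF E U True]
        by (simp add: xsig_def sig_shift_def cw_add lin_add[OF l])
    next
      case False
      then have "US \<sigma> c = 0" "cw J H L c = 0" for L
        using fam_out[OF U, of c] fam_out[OF cw_vecs[of J H "{..<l}" "{..<m}", OF H], of c] by auto
      then show ?thesis by (simp add: xsig_def)
    qed
  next
    case False
    then have "(if ?k (fst \<sigma>) = fst (snd \<sigma>) then 0 else US \<sigma> c) = 0"
      using fam_out[OF US, of \<sigma>] by auto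
    moreover have "sig_shift E ?k US \<sigma> = 0" using False unfolding sig_shift_def by (rule if_not_P)
    ultimately show ?thesis unfolding xsig_def by simp
  qed
  show ?thesis
    unfolding eve_view_def base_view_def enc_main_def enc_sig_def recode_def prod.case
    by (simp only: main sig)
qed

text \<open>The right-hand side is free of \<open>M\<close>: Eve's view has the same distribution
  for every message, which is the secrecy of the scheme.\<close>

lemma eve_view_count:
  assumes E: "E \<in> EE"
  shows "card {\<omega> \<in> rands. Q (eve_view E M \<omega>)} = card {(L, R, LS, US) \<in> rands. Q (base_view E L LS)}"
proof (rule bij_betw_same_card[symmetric])
  let ?A = "{(L, R, LS, US) \<in> rands. Q (base_view E L LS)}"
  have "recode E M ` ?A = {\<omega> \<in> rands. Q (eve_view E M \<omega>)}"
  proof (intro equalityI subsetI)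
    fix \<omega> assume "\<omega> \<in> recode E M ` ?A"
    then obtain L R LS US where "(L, R, LS, US) \<in> rands" "Q (base_view E L LS)" "\<omega> = recode E M (L, R, LS, US)"
      by auto
    then show "\<omega> \<in> {\<omega> \<in> rands. Q (eve_view E M \<omega>)}"
      using recode_bij[OF E, of M] eve_view_recode[OF E] by (auto simp: bij_betw_def)
  next
    fix \<omega> assume w: "\<omega> \<in> {\<omega> \<in> rands. Q (eve_view E M \<omega>)}"
    then have "\<omega> \<in> recode E M ` rands" using recode_bij[OF E, of M] by (simp add: bij_betw_def)
    then obtain \<omega>' where w': "\<omega>' \<in> rands" "\<omega> = recode E M \<omega>'" by (rule imageE)
    obtain L R LS US where "\<omega>' = (L, R, LS, US)" by (cases \<omega>')
    then show "\<omega> \<in> recode E M ` ?A"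
      using w w' eve_view_recode[OF E, of L R LS US M] by auto
  qed
  moreover have "inj_on (recode E M) ?A"
    using recode_bij[OF E, of M] unfolding bij_betw_def by (rule conjE) (erule inj_on_subset, auto)
  ultimately show "bij_betw (recode E M) ?A {\<omega> \<in> rands. Q (eve_view E M \<omega>)}"
    by (simp add: bij_betw_def)
qed

end

section \<open>Decoding errors\<close>

context secret_scheme
begin

text \<open>\<open>z\<close> is the noise as it reaches Bob, a function of Eve's view alone; its two
  components act on the main and on the signal columns.\<close>

definition bob_main where
  "bob_main K E z M \<omega> c = K (enc_main M \<omega> c) + fst (z (eve_view E M \<omega>)) c"

definition bob_sig where
  "bob_sig K E z M \<omega> \<sigma> c = K (enc_sig M \<omega> \<sigma> c) + snd (z (eve_view E M \<omega>)) \<sigma> c"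

definition true_secret where
  "true_secret M \<omega> = (case \<omega> of (L, R, LS, US) \<Rightarrow> secret R (xmain M L))"

lemma true_secret_recode:
  "true_secret M (recode E M (L, R, LS, US)) = secret R (xmain M (L + mask_main E M))"
  by (simp add: true_secret_def recode_def)

lemma enc_main_recode:
  "enc_main M (recode E M (L, R, LS, US)) = xmain M (L + mask_main E M)"
  by (simp add: enc_main_def recode_def)

text \<open>Accepted coefficient vectors differ by elements of the subgroup \<open>D\<close>, which
  \<open>H_thin\<close> makes proper. The offset \<open>b\<close> stands for everything else in the
  received block, codeword and noise included.\<close>

lemma accepted_half:
  assumes K: "(K, S) \<in> KK" and x: "x \<notin> S"
  shows "2 * card (vecs {..<l} \<inter> {z. \<exists>L\<in>vecs J. \<forall>c\<in>{..<l}. b c + smul (z c) x - K (cw J H L c) \<in> S})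
    \<le> card (vecs {..<l} :: (nat \<Rightarrow> 'a) set)"
proof -
  let ?A = "vecs {..<l} :: (nat \<Rightarrow> 'a) set"
  define D where "D = {z \<in> ?A. \<exists>L\<in>vecs J. \<forall>c\<in>{..<l}. smul (z c) x - K (cw J H L c) \<in> S}"
  have S: "addsub S" "lin K" using KK[OF K] by (auto simp: subspc_addsub)
  obtain y where y: "y \<in> ?A" "y \<notin> D" using H_thin[OF K x] by (auto simp: D_def)
  have diff: "z - z' \<in> D" if z: "z \<in> ?A" "L \<in> vecs J" "\<forall>c\<in>{..<l}. b c + smul (z c) x - K (cw J H L c) \<in> S"
    and z': "z' \<in> ?A" "L' \<in> vecs J" "\<forall>c\<in>{..<l}. b c + smul (z' c) x - K (cw J H L' c) \<in> S"
    for b :: "nat \<Rightarrow> nat \<Rightarrow> 'a" and z z' L L'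
  proof -
    have "smul ((z - z') c) x - K (cw J H (L - L') c) \<in> S" if c: "c \<in> {..<l}" for c
    proof -
      have "(b c + smul (z c) x - K (cw J H L c)) - (b c + smul (z' c) x - K (cw J H L' c)) \<in> S"
        by (rule addsub_diff[OF S(1) bspec[OF z(3) c] bspec[OF z'(3) c]])
      then show ?thesis
        by (simp add: cw_diff lin_diff[OF S(2)] smul_diff_left algebra_simps)
    qed
    moreover have "z - z' \<in> ?A" "L - L' \<in> vecs J" using z z' by (auto intro: addsub_diff[OF addsub_vecs])
    ultimately show ?thesis unfolding D_def by blast
  qed
  show ?thesis
  proof (rule half_coset[OF _ addsub_vecs _ _ y(1) y(2)])
    show "finite ?A" by (simp add: finite_vecs)
    show "addsub D"
      unfolding addsub_def
    proof (intro conjI ballI)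
      have "smul ((0::nat \<Rightarrow> 'a) c) x - K (cw J H 0 c) \<in> S" for c
        using addsub_zero[OF S(1)] by (simp add: cw_0 lin_0[OF S(2)] smul_0)
      then show "0 \<in> D" unfolding D_def using addsub_zero[OF addsub_vecs] by blast
    next
      fix z z' assume "z \<in> D" "z' \<in> D"
      then obtain L L' where "z \<in> ?A" "L \<in> vecs J" "\<forall>c\<in>{..<l}. 0 + smul (z c) x - K (cw J H L c) \<in> S"
        "z' \<in> ?A" "L' \<in> vecs J" "\<forall>c\<in>{..<l}. 0 + smul (z' c) x - K (cw J H L' c) \<in> S"
        by (auto simp: D_def)
      then show "z - z' \<in> D" by (intro diff[of z L "\<lambda>_. 0" z' L']) auto
    qed
    show "D \<subseteq> ?A" by (auto simp: D_def)
  qed (auto intro: diff)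
qed

text \<open>In the recoded coordinates the uniform blocks of \<open>s\<close> and \<open>v\<close>
  are moved along a direction \<open>u\<close> with \<open>E u = 0\<close>. Eve's view, hence the
  noise, and the masks stay fixed, while Bob's block \<open>r\<close> moves along
  \<open>K u\<close>, which is outside \<open>S'\<close>, with uniform coefficients
  \<open>y r\<close>. So each of the \<open>n\<close> repetitions is accepted with probability at
  most a half.\<close>

lemma false_symbol_count:
  assumes K: "(K, S) \<in> KK" and K': "(K', S') \<in> KK" and E: "E \<in> EE" and s: "s \<in> syms"
  shows "card {\<omega> \<in> rands. v \<noteq> true_secret M \<omega> s \<and> accepts K' S' (bob_sig K E z M \<omega>) s v} * 2 ^ n
    \<le> card rands"
proof -
  obtain u where u: "u \<in> vecs {..<m}" "E u = 0" "K u \<notin> S'" using separating[OF K K' E] by blast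
  define Y where "Y = fam {..<n} (vecs {..<l} :: (nat \<Rightarrow> 'a) set)"
  define d :: "(nat \<Rightarrow> nat \<Rightarrow> 'a) \<Rightarrow> sym \<times> 'a \<times> nat \<Rightarrow> nat \<Rightarrow> nat \<Rightarrow> 'a" where
    "d y \<sigma> = (if fst \<sigma> = s \<and> fst (snd \<sigma>) = v then \<lambda>c. smul (y (snd (snd \<sigma>)) c) u else 0)" for y \<sigma>
  define sh where "sh y \<omega> = (case \<omega> of (L, R, LS, US) \<Rightarrow> (L, R, LS, US + d y))"
    for y and \<omega> :: "(nat \<Rightarrow> 'a) \<times> (nat \<Rightarrow> nat \<Rightarrow> 'a) \<times> (sym \<times> 'a \<times> nat \<Rightarrow> nat \<Rightarrow> 'a) \<times>
      (sym \<times> 'a \<times> nat \<Rightarrow> nat \<Rightarrow> nat \<Rightarrow> 'a)"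
  have lins: "lin K" "lin E" using KK(1)[OF K] EE[OF E] by auto
  have gr: "addsub (fam sigs (fam {..<l} (vecs {..<m} :: (nat \<Rightarrow> 'a) set)))" by (intro addsub_fam addsub_UNIV)
  have d: "d y \<in> fam sigs (fam {..<l} (vecs {..<m}))" if y: "y \<in> Y" for y
  proof (rule famI)
    fix \<sigma> assume "\<sigma> \<in> sigs"
    then have "snd (snd \<sigma>) < n" by auto
    then have "y (snd (snd \<sigma>)) \<in> vecs {..<l}" using y by (auto simp: Y_def fam_def)
    then have "y (snd (snd \<sigma>)) c = 0" if "c \<notin> {..<l}" for c using that by (rule fam_out)
    then have "(\<lambda>c. smul (y (snd (snd \<sigma>)) c) u) \<in> fam {..<l} (vecs {..<m})"
      using smul_vecs[OF u(1)] by (intro famI[of "{..<l}"]) (simp_all add: smul_0)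
    then show "d y \<sigma> \<in> fam {..<l} (vecs {..<m})"
      using addsub_zero[OF addsub_fam[OF addsub_vecs], of "{..<l}" "{..<m}"] unfolding d_def by auto
  next
    fix \<sigma> assume \<sigma>: "\<sigma> \<notin> sigs"
    show "d y \<sigma> = 0"
    proof (cases "fst \<sigma> = s \<and> fst (snd \<sigma>) = v")
      case True
      then have "snd (snd \<sigma>) \<notin> {..<n}" using \<sigma> s by (cases \<sigma>) auto
      then have "y (snd (snd \<sigma>)) = 0" using y unfolding Y_def by (rule fam_out[rotated])
      then show ?thesis using True by (simp add: d_def smul_0 fun_eq_iff)
    next
      case False
      then show ?thesis unfolding d_def by (rule if_not_P)
    qed
  qed
  have shr: "sh y \<omega> \<in> rands" if "y \<in> Y" "\<omega> \<in> rands" for y \<omega>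
    using that d gr by (auto simp: sh_def rands_def addsub_add)
  \<comment> \<open>The shift acts before recoding, so that it does not touch the components
    \<open>L\<close> and \<open>LS\<close> that determine Eve's view.\<close>
  show ?thesis
  proof (rule shift_average[where Y = Y and sh = "\<lambda>y \<omega>. recode E M (sh y \<omega>)"])
    show "finite rands" by (rule finite_rands)
    show "finite Y" unfolding Y_def by (intro finite_fam finite_vecs) auto
    show "Y \<noteq> {}" using addsub_zero[OF addsub_fam[OF addsub_vecs]] unfolding Y_def by blast
  next
    fix y assume y: "y \<in> Y"
    have "bij_betw (sh y) rands rands"
    proof (rule bij_betw_byWitness[where f' = "\<lambda>(L, R, LS, US). (L, R, LS, US - d y)"])
      show "sh y ` rands \<subseteq> rands" using shr[OF y] by auto
      show "(\<lambda>(L, R, LS, US). (L, R, LS, US - d y)) ` rands \<subseteq> rands"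
        using d[OF y] gr by (auto simp: rands_def addsub_diff)
    qed (auto simp: sh_def)
    from bij_betw_trans[OF this recode_bij[OF E, of M]]
    show "bij_betw (\<lambda>\<omega>. recode E M (sh y \<omega>)) rands rands" by (simp add: o_def)
  next
    fix \<omega> assume \<omega>: "\<omega> \<in> rands"
    obtain L R LS US where w: "\<omega> = (L, R, LS, US)" by (cases \<omega>)
    let ?k = "secret R (xmain M (L + mask_main E M))"
    \<comment> \<open>\<open>?b r\<close> collects the part of Bob's block that does not depend on
      \<open>y\<close>.\<close>
    let ?b = "\<lambda>r c. K (cw J H (LS (s, v, r) + mask_sig (E, \<lambda>c. E (US (s, v, r) c))) c + US (s, v, r) c)
      + snd (z (base_view E L LS)) (s, v, r) c"
    let ?S = "\<lambda>r. {x. \<exists>L\<in>vecs J. \<forall>c\<in>{..<l}. ?b r c + smul (x c) (K u) - K' (cw J H L c) \<in> S'}"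
    have "{y \<in> Y. v \<noteq> true_secret M (recode E M (sh y \<omega>)) s \<and>
        accepts K' S' (bob_sig K E z M (recode E M (sh y \<omega>))) s v}
      \<subseteq> {y \<in> Y. \<forall>r\<in>{..<n}. y r \<in> ?S r}"
    proof safe
      fix y r
      assume y: "y \<in> Y" and v: "v \<noteq> true_secret M (recode E M (sh y \<omega>)) s"
        and acc: "accepts K' S' (bob_sig K E z M (recode E M (sh y \<omega>))) s v" and r: "r < n"
      have shw: "sh y \<omega> = (L, R, LS, US + d y)" by (simp add: sh_def w)
      have ks: "?k s \<noteq> v" using v by (simp add: shw true_secret_recode)
      have "eve_view E M (recode E M (sh y \<omega>)) = base_view E L LS"
        using shr[OF y \<omega>] unfolding shw by (rule eve_view_recode[OF E])
      moreover have "enc_sig M (recode E M (sh y \<omega>)) (s, v, r) c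
        = cw J H (LS (s, v, r) + mask_sig (E, \<lambda>c. E (US (s, v, r) c))) c + US (s, v, r) c + smul (y r c) u" for c
      proof -
        have "(US + d y) (s, v, r) c = US (s, v, r) c + smul (y r c) u" for c by (simp add: d_def)
        \<comment> \<open>The mask sees only Eve's image of the block, to which \<open>u\<close>
          contributes nothing.\<close>
        moreover have "E (US (s, v, r) c + smul (y r c) u) = E (US (s, v, r) c)" for c
          using u(2) by (simp add: lin_add[OF lins(2)] lin_smul[OF lins(2)]) (simp add: smul_def fun_eq_iff)
        ultimately have "sig_shift E ?k (US + d y) (s, v, r) = mask_sig (E, \<lambda>c. E (US (s, v, r) c))"
          using s r ks by (simp add: sig_shift_def)
        then show ?thesis
          using ks by (simp add: shw recode_def enc_sig_def xsig_def d_def add.assoc)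
      qed
      ultimately have bob: "bob_sig K E z M (recode E M (sh y \<omega>)) (s, v, r) c = ?b r c + smul (y r c) (K u)" for c
        by (simp add: bob_sig_def lin_add[OF lins(1)] lin_smul[OF lins(1)] add_ac)
      show "\<exists>L\<in>vecs J. \<forall>c\<in>{..<l}. ?b r c + smul (y r c) (K u) - K' (cw J H L c) \<in> S'"
        using acc[unfolded accepts_def, rule_format, OF r] unfolding bob .
    qed
    moreover have "finite Y" unfolding Y_def by (intro finite_fam finite_vecs) auto
    ultimately have "card {y \<in> Y. v \<noteq> true_secret M (recode E M (sh y \<omega>)) s \<and>
        accepts K' S' (bob_sig K E z M (recode E M (sh y \<omega>))) s v} * 2 ^ n
      \<le> card {y \<in> Y. \<forall>r\<in>{..<n}. y r \<in> ?S r} * 2 ^ card {..<n}"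
      by (simp add: card_mono)
    also have "\<dots> \<le> card Y"
      unfolding Y_def by (rule fam_amplify[OF finite_lessThan accepted_half[OF K' u(3)]])
    finally show "card {y \<in> Y. v \<noteq> true_secret M (recode E M (sh y \<omega>)) s \<and>
        accepts K' S' (bob_sig K E z M (recode E M (sh y \<omega>))) s v} * 2 ^ n \<le> card Y" .
  qed
qed

text \<open>One residual outside \<open>S\<close> suffices: in its block \<open>j\<^sub>0\<close>
  the unit vector at \<open>i\<^sub>0\<close> reproduces exactly this residual, so the combinations
  landing in \<open>S\<close> form a proper subgroup.\<close>

lemma hash_half:
  fixes X :: "nat \<times> nat \<Rightarrow> nat \<Rightarrow> 'a"
  assumes S: "subspc S" and X: "i\<^sub>0 < p" "j\<^sub>0 < p" "X (j\<^sub>0, i\<^sub>0) \<notin> S"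
  shows "2 * card (vecs {..<p} \<inter> {x. \<forall>j<p. (\<Sum>i<p. smul (b i + x i) (X (j, i))) \<in> S})
    \<le> card (vecs {..<p} :: (nat \<Rightarrow> 'a) set)"
proof -
  let ?A = "vecs {..<p} :: (nat \<Rightarrow> 'a) set"
  define D where "D = {x \<in> ?A. (\<Sum>i<p. smul (x i) (X (j\<^sub>0, i))) \<in> S}"
  have S': "addsub S" using S by (rule subspc_addsub)
  have diff: "(\<Sum>i<p. smul ((x - y) i) (X (j\<^sub>0, i)))
      = (\<Sum>i<p. smul (b i + x i) (X (j\<^sub>0, i))) - (\<Sum>i<p. smul (b i + y i) (X (j\<^sub>0, i)))" for x y b
    by (simp add: sum_subtractf[symmetric] smul_diff_left[symmetric])
  show ?thesis
  proof (rule half_coset[OF _ addsub_vecs])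
    show "finite ?A" by (simp add: finite_vecs)
    have "0 \<in> D" using addsub_zero[OF S'] addsub_zero[OF addsub_vecs, of "{..<p}"] by (simp add: D_def smul_0)
    moreover have "x - y \<in> D" if "x \<in> D" "y \<in> D" for x y
      using that addsub_diff[OF addsub_vecs, of x "{..<p}" y] addsub_diff[OF S'] diff[of x y "\<lambda>_. 0"]
      by (simp add: D_def)
    ultimately show "addsub D" by (simp add: addsub_def)
    show "D \<subseteq> ?A" by (auto simp: D_def)
    show "(\<lambda>i. if i = i\<^sub>0 then 1 else 0) \<in> ?A" using X(1) by (auto simp: fam_def split: if_splits)
    have "(\<Sum>i<p. smul (if i = i\<^sub>0 then 1 else 0) (X (j\<^sub>0, i))) = (\<Sum>i<p. if i = i\<^sub>0 then X (j\<^sub>0, i) else 0)"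
      by (intro sum.cong) (auto simp: smul_0 smul_1)
    also have "\<dots> = X (j\<^sub>0, i\<^sub>0)" using X(1) by simp
    finally show "(\<lambda>i. if i = i\<^sub>0 then 1 else 0) \<notin> D" using X(3) by (simp add: D_def)
  next
    fix x y
    assume x: "x \<in> ?A \<inter> {x. \<forall>j<p. (\<Sum>i<p. smul (b i + x i) (X (j, i))) \<in> S}"
      and y: "y \<in> ?A \<inter> {x. \<forall>j<p. (\<Sum>i<p. smul (b i + x i) (X (j, i))) \<in> S}"
    then show "x - y \<in> D"
      using addsub_diff[OF addsub_vecs, of x "{..<p}" y] addsub_diff[OF S'] diff[of x y b] X(2)
      by (simp add: D_def)
  qed auto
qed

text \<open>In the recoded coordinates neither the main codeword nor Eve's view involves
  \<open>R\<close>: the signals change with the key, yet Eve's image of them does not. Shifting the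
  key thus leaves Bob's residuals fixed, and its \<open>n\<close> columns are independent
  tests.\<close>

lemma false_pass_count:
  assumes K': "(K', S') \<in> KK" and E: "E \<in> EE"
  shows "card {\<omega> \<in> rands. passes K' S' (true_secret M \<omega>) (bob_main K E z M \<omega>) \<and>
      \<not> (\<forall>c\<in>mcols. bob_main K E z M \<omega> c - K' (enc_main M \<omega> c) \<in> S')} * 2 ^ n \<le> card rands"
proof -
  define Y where "Y = fam {..<n} (vecs {..<p} :: (nat \<Rightarrow> 'a) set)"
  define sh where "sh y \<omega> = (case \<omega> of (L, R, LS, US) \<Rightarrow> (L, R + y, LS, US))"
    for y and \<omega> :: "(nat \<Rightarrow> 'a) \<times> (nat \<Rightarrow> nat \<Rightarrow> 'a) \<times> (sym \<times> 'a \<times> nat \<Rightarrow> nat \<Rightarrow> 'a) \<times>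
      (sym \<times> 'a \<times> nat \<Rightarrow> nat \<Rightarrow> nat \<Rightarrow> 'a)"
  have S': "subspc S'" "lin K'" using KK[OF K'] by auto
  have gr: "addsub Y" unfolding Y_def by (intro addsub_fam addsub_UNIV)
  have fY: "finite Y" unfolding Y_def by (intro finite_fam finite_vecs) auto
  have shr: "sh y \<omega> \<in> rands" if "y \<in> Y" "\<omega> \<in> rands" for y \<omega>
    using that gr by (auto simp: sh_def rands_def Y_def addsub_add)
  show ?thesis
  proof (rule shift_average[where Y = Y and sh = "\<lambda>y \<omega>. recode E M (sh y \<omega>)"])
    show "finite rands" by (rule finite_rands)
    show "finite Y" by (rule fY)
    show "Y \<noteq> {}" using addsub_zero[OF gr] by blast
  next
    fix y assume y: "y \<in> Y"
    have "bij_betw (sh y) rands rands"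
    proof (rule bij_betw_byWitness[where f' = "\<lambda>(L, R, LS, US). (L, R - y, LS, US)"])
      show "sh y ` rands \<subseteq> rands" using shr[OF y] by auto
      show "(\<lambda>(L, R, LS, US). (L, R - y, LS, US)) ` rands \<subseteq> rands"
        using y gr by (auto simp: rands_def Y_def addsub_diff)
    qed (auto simp: sh_def)
    from bij_betw_trans[OF this recode_bij[OF E, of M]]
    show "bij_betw (\<lambda>\<omega>. recode E M (sh y \<omega>)) rands rands" by (simp add: o_def)
  next
    fix \<omega> assume \<omega>: "\<omega> \<in> rands"
    obtain L R LS US where w: "\<omega> = (L, R, LS, US)" by (cases \<omega>)
    let ?X = "xmain M (L + mask_main E M)"
    let ?ym = "\<lambda>c. K (?X c) + fst (z (base_view E L LS)) c"
    let ?bad = "{y \<in> Y. passes K' S' (true_secret M (recode E M (sh y \<omega>))) (bob_main K E z M (recode E M (sh y \<omega>))) \<and>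
      \<not> (\<forall>c\<in>mcols. bob_main K E z M (recode E M (sh y \<omega>)) c - K' (enc_main M (recode E M (sh y \<omega>)) c) \<in> S')}"
    let ?S = "\<lambda>t. {x. \<forall>j<p. (\<Sum>i<p. smul (R t i + x i) (?ym (j, i) - K' (?X (j, i)))) \<in> S'}"
    have shw: "sh y \<omega> = (L, R + y, LS, US)" for y by (simp add: sh_def w)
    have view: "eve_view E M (recode E M (sh y \<omega>)) = base_view E L LS" if y: "y \<in> Y" for y
      using shr[OF y \<omega>] unfolding shw by (rule eve_view_recode[OF E])
    have bob: "bob_main K E z M (recode E M (sh y \<omega>)) = ?ym" if y: "y \<in> Y" for y
      unfolding bob_main_def view[OF y] by (simp add: shw enc_main_recode)
    have pass: "passes K' S' (true_secret M (recode E M (sh y \<omega>))) ?ym \<longleftrightarrow> (\<forall>t<n. y t \<in> ?S t)" for y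
      unfolding shw true_secret_recode hash_passes[OF S'(2) xmain_fam] by simp
    show "card ?bad * 2 ^ n \<le> card Y"
    proof (cases "\<forall>c\<in>mcols. ?ym c - K' (?X c) \<in> S'")
      case True
      have none: "y \<notin> ?bad" for y
      proof
        assume y: "y \<in> ?bad"
        then have "y \<in> Y" by simp
        from y have "\<not> (\<forall>c\<in>mcols. ?ym c - K' (enc_main M (recode E M (sh y \<omega>)) c) \<in> S')"
          unfolding mem_Collect_eq bob[OF \<open>y \<in> Y\<close>] by blast
        then show False using True unfolding shw enc_main_recode by blast
      qed
      have "?bad = {}" using none by blast
      then show ?thesis by (simp only: card.empty mult_0 le0)
    next
      case False
      then obtain j i where ji: "i < p" "j < p" "?ym (j, i) - K' (?X (j, i)) \<notin> S'" by auto
      have "?bad \<subseteq> {y \<in> Y. \<forall>t\<in>{..<n}. y t \<in> ?S t}"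
      proof
        fix y assume y: "y \<in> ?bad"
        then have yY: "y \<in> Y" by simp
        then have "passes K' S' (true_secret M (recode E M (sh y \<omega>))) ?ym" using y by (simp add: bob)
        then have "\<forall>t<n. y t \<in> ?S t" by (rule pass[THEN iffD1])
        then show "y \<in> {y \<in> Y. \<forall>t\<in>{..<n}. y t \<in> ?S t}" using yY by blast
      qed
      then have "card ?bad * 2 ^ n \<le> card {y \<in> Y. \<forall>t\<in>{..<n}. y t \<in> ?S t} * 2 ^ card {..<n}"
        using fY by (simp add: card_mono)
      also have "\<dots> \<le> card Y"
        unfolding Y_def by (rule fam_amplify[OF finite_lessThan])
          (rule hash_half[where X = "\<lambda>c. ?ym c - K' (?X c)", OF S'(1) ji])
      finally show ?thesis .
    qed
  qed
qed

text \<open>Union bound: each candidate contributes one event for every symbol and every false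
  value, and one event of a false pass; outside all of them \<open>decode_correct\<close>
  applies.\<close>

lemma decode_error_count:
  assumes K: "(K, S) \<in> KK" and E: "E \<in> EE" and M: "M \<in> vecs IM"
    and z: "\<And>w c. fst (z w) c \<in> S" "\<And>w \<sigma> c. snd (z w) \<sigma> c \<in> S"
  shows "card {\<omega> \<in> rands. decode (bob_main K E z M \<omega>) (bob_sig K E z M \<omega>) \<noteq> M} * 2 ^ n
    \<le> card KK * (card syms * CARD('a) + 1) * card rands"
proof -
  define A where "A k s v = {\<omega> \<in> rands. v \<noteq> true_secret M \<omega> s \<and>
      accepts (fst k) (snd k) (bob_sig K E z M \<omega>) s v}" for k s v
  define B where "B k = {\<omega> \<in> rands. passes (fst k) (snd k) (true_secret M \<omega>) (bob_main K E z M \<omega>) \<and>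
      \<not> (\<forall>c\<in>mcols. bob_main K E z M \<omega> c - (fst k) (enc_main M \<omega> c) \<in> snd k)}" for k
  define U where "U k = (\<Union>s\<in>syms. \<Union>v. A k s v) \<union> B k" for k
  have "decode (bob_main K E z M \<omega>) (bob_sig K E z M \<omega>) = M" if \<omega>: "\<omega> \<in> rands" and no: "\<omega> \<notin> (\<Union>k\<in>KK. U k)" for \<omega>
  proof -
    obtain L R LS US where w: "\<omega> = (L, R, LS, US)" by (cases \<omega>)
    have L: "L \<in> vecs IL" and LS: "LS \<in> fam sigs (vecs J)" using \<omega> by (auto simp: w rands_def)
    have k: "true_secret M \<omega> = secret R (xmain M L)" by (simp add: true_secret_def w)
    have xm: "enc_main M \<omega> = xmain M L" by (simp add: enc_main_def w)
    have xs: "enc_sig M \<omega> = xsig (true_secret M \<omega>) LS US" by (simp add: enc_sig_def true_secret_def w)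
    show ?thesis
    proof (rule decode_correct[OF K M L LS k])
      show "bob_main K E z M \<omega> c - K (xmain M L c) \<in> S" for c
        using z(1) by (simp add: bob_main_def xm)
      show "bob_sig K E z M \<omega> \<sigma> c - K (xsig (true_secret M \<omega>) LS US \<sigma> c) \<in> S" for \<sigma> c
        using z(2) by (simp add: bob_sig_def xs)
      show "\<not> accepts K' S' (bob_sig K E z M \<omega>) s v"
        if "(K', S') \<in> KK" "s \<in> syms" "v \<noteq> true_secret M \<omega> s" for K' S' s v
      proof -
        have "\<omega> \<notin> A (K', S') s v" using no that(1,2) by (auto simp: U_def)
        then show ?thesis using that(3) \<omega> by (simp add: A_def)
      qed
      show "bob_main K E z M \<omega> c - K' (xmain M L c) \<in> S'"
        if "(K', S') \<in> KK" "passes K' S' (true_secret M \<omega>) (bob_main K E z M \<omega>)" "c \<in> mcols" for K' S' c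
      proof -
        have "\<omega> \<notin> B (K', S')" using no that(1) by (auto simp: U_def)
        then show ?thesis using that(2,3) \<omega> unfolding xm[symmetric] by (auto simp: B_def)
      qed
    qed
  qed
  then have sub: "{\<omega> \<in> rands. decode (bob_main K E z M \<omega>) (bob_sig K E z M \<omega>) \<noteq> M} \<subseteq> (\<Union>k\<in>KK. U k)"
    by blast
  have Ur: "(\<Union>k\<in>KK. U k) \<subseteq> rands" by (auto simp: U_def A_def B_def)
  have cA: "card (A k s v) * 2 ^ n \<le> card rands" if "k \<in> KK" "s \<in> syms" for k s v
    using false_symbol_count[OF K _ E that(2), of "fst k" "snd k" v M z] that(1) by (cases k) (simp add: A_def)
  have cB: "card (B k) * 2 ^ n \<le> card rands" if "k \<in> KK" for k
    using false_pass_count[OF _ E, of "fst k" "snd k" M K z] that by (cases k) (simp add: B_def)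
  have cU: "card (U k) * 2 ^ n \<le> (card syms * CARD('a) + 1) * card rands" if k: "k \<in> KK" for k
  proof -
    have "card (\<Union>s\<in>syms. \<Union>v. A k s v) \<le> (\<Sum>s\<in>syms. card (\<Union>v. A k s v))"
      by (rule card_UN_le[OF finite_syms])
    also have "\<dots> \<le> (\<Sum>s\<in>syms. \<Sum>v\<in>UNIV. card (A k s v))"
      by (intro sum_mono card_UN_le) auto
    finally have "card (U k) \<le> (\<Sum>s\<in>syms. \<Sum>v\<in>UNIV. card (A k s v)) + card (B k)"
      using card_Un_le[of "\<Union>s\<in>syms. \<Union>v. A k s v" "B k"] unfolding U_def by linarith
    then have "card (U k) * 2 ^ n \<le> ((\<Sum>s\<in>syms. \<Sum>v\<in>UNIV. card (A k s v)) + card (B k)) * 2 ^ n"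
      by (rule mult_right_mono) simp
    also have "\<dots> = (\<Sum>s\<in>syms. \<Sum>v\<in>UNIV. card (A k s v) * 2 ^ n) + card (B k) * 2 ^ n"
      by (simp add: sum_distrib_right distrib_right)
    also have "\<dots> \<le> (\<Sum>s\<in>syms. \<Sum>v\<in>(UNIV :: 'a set). card rands) + card rands"
      using cA[OF k] cB[OF k] by (intro add_mono sum_mono)
    finally show ?thesis by (simp add: algebra_simps)
  qed
  have "card {\<omega> \<in> rands. decode (bob_main K E z M \<omega>) (bob_sig K E z M \<omega>) \<noteq> M} * 2 ^ n
      \<le> card (\<Union>k\<in>KK. U k) * 2 ^ n"
    using card_mono[OF finite_subset[OF Ur finite_rands] sub] by simp
  also have "\<dots> \<le> (\<Sum>k\<in>KK. card (U k)) * 2 ^ n"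
    using card_UN_le[OF fin(1), of U] by simp
  also have "\<dots> \<le> (\<Sum>k\<in>KK. (card syms * CARD('a) + 1) * card rands)"
    unfolding sum_distrib_right using cU by (intro sum_mono)
  finally show ?thesis by (simp add: algebra_simps)
qed

end

section \<open>Matrix ranks\<close>

definition app :: "'a::comm_ring_1 mat \<Rightarrow> (nat \<Rightarrow> 'a) \<Rightarrow> nat \<Rightarrow> 'a"
  where "app A x = (\<lambda>i. if i < dim_row A then \<Sum>j<dim_col A. A $$ (i, j) * x j else 0)"

lemma lin_app: "lin (app A)"
proof -
  have "app A (x - y) = app A x - app A y" for x y
    by (rule ext) (simp add: app_def sum_subtractf algebra_simps)
  moreover have "app A (smul c x) = smul c (app A x)" for c x
    by (rule ext) (simp add: app_def smul_def sum_distrib_left mult_ac)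
  ultimately show ?thesis by (simp add: lin_def)
qed

text \<open>Distinct coefficient functions on an independent set give distinct combinations.\<close>

lemma (in vec_space) card_span_indpt:
  assumes "finite (UNIV :: 'a set)" and S: "finite S" "S \<subseteq> carrier_vec n" "lin_indpt S"
  shows "card (span S) = CARD('a) ^ card S"
proof -
  have "span S = {lincomb a S |a. a \<in> S \<rightarrow> UNIV}"
    using finite_span[OF S(1)] S(2) by (simp add: class_ring_simps)
  also have "\<dots> = (\<lambda>a. lincomb a S) ` PiE S (\<lambda>_. UNIV)"
  proof (intro equalityI subsetI)
    fix v assume "v \<in> {lincomb a S |a. a \<in> S \<rightarrow> UNIV}"
    then obtain a where v: "v = lincomb a S" by auto
    have "lincomb a S = lincomb (restrict a S) S"
      by (rule lincomb_restrict) (use S in \<open>auto simp: class_ring_simps\<close>)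
    then show "v \<in> (\<lambda>a. lincomb a S) ` PiE S (\<lambda>_. UNIV)" unfolding v by (intro image_eqI) auto
  qed auto
  finally have "span S = (\<lambda>a. lincomb a S) ` PiE S (\<lambda>_. UNIV)" .
  moreover have "inj_on (\<lambda>a. lincomb a S) (PiE S (\<lambda>_. UNIV))"
  proof (rule inj_onI)
    fix a b assume a: "a \<in> PiE S (\<lambda>_. UNIV)" and b: "b \<in> PiE S (\<lambda>_. UNIV)" and eq: "lincomb a S = lincomb b S"
    have "lincomb (\<lambda>x. a x - b x) S = 0\<^sub>v n"
    proof (rule eq_vecI)
      fix i assume i: "i < dim_vec (0\<^sub>v n)"
      then have "lincomb (\<lambda>x. a x - b x) S $ i = lincomb a S $ i - lincomb b S $ i"
        using S(2) by (simp add: lincomb_index left_diff_distrib sum_subtractf)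
      then show "lincomb (\<lambda>x. a x - b x) S $ i = 0\<^sub>v n $ i" using i eq by simp
    qed (use S(2) lincomb_dim[OF S(1)] in auto)
    then have "(\<lambda>x. a x - b x) \<in> S \<rightarrow> {0}"
      using not_lindepD[OF S(3,1) subset_refl, of "\<lambda>x. a x - b x"] by (simp add: class_ring_simps module_vec_simps)
    then show "a = b" using a b by (intro PiE_ext) auto
  qed
  ultimately show ?thesis using S(1) assms(1) by (simp add: card_image card_PiE)
qed

text \<open>A maximal independent set of columns spans all columns, and its size is the
  rank.\<close>

lemma (in vec_space) card_col_space:
  assumes fin: "finite (UNIV :: 'a set)" and A: "A \<in> carrier_mat n nc"
  shows "card (col_space A) = CARD('a) ^ rank A"
proof -
  let ?C = "set (cols A)"
  have C: "?C \<subseteq> carrier_vec n" using cols_dim A by blast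
  obtain S where S: "finite S" "maximal S (\<lambda>T. T \<subseteq> ?C \<and> lin_indpt T)"
    using maximal_exists_superset[of ?C "\<lambda>T. T \<subseteq> ?C \<and> lin_indpt T" "{}"] lin_dep_def by auto
  then have S': "S \<subseteq> ?C" "lin_indpt S" by (auto simp: maximal_def)
  have "?C \<subseteq> span S"
  proof
    fix v assume v: "v \<in> ?C"
    show "v \<in> span S"
    proof (cases "v \<in> S")
      case True
      then show ?thesis using in_own_span[of S] S' C by auto
    next
      case False
      have "lin_dep (S \<union> {v})"
      proof (rule ccontr)
        assume "\<not> ?thesis"
        moreover have "S \<union> {v} \<subseteq> ?C" using v S' by auto
        ultimately have "S \<union> {v} = S" using S(2) unfolding maximal_def by blast
        then show False using False by auto
      qed
      then show ?thesis using lin_dep_iff_in_span[of S v] S' C v False by auto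
    qed
  qed
  then have "span ?C \<subseteq> span S"
    using S' C by (intro span_is_subset span_is_submodule) auto
  moreover have "span S \<subseteq> span ?C" using S'(1) by (rule span_is_monotone)
  ultimately have "span ?C = span S" by auto
  then show ?thesis
    unfolding col_space_def rank_card_indpt[OF A S(2)]
    using card_span_indpt[OF fin S(1) _ S'(2)] S' C by auto
qed

text \<open>The bridge from ranks to counting: the coding argument sees ranks only as sizes of
  images and kernels.\<close>

lemma card_app_image:
  fixes A :: "'a::{field,finite} mat"
  shows "card (app A ` vecs {..<dim_col A}) = CARD('a) ^ mat_rank A"
proof -
  let ?nr = "dim_row A" and ?nc = "dim_col A"
  interpret vec_space "TYPE('a)" ?nr .
  have A: "A \<in> carrier_mat ?nr ?nc" by simp
  have mv: "vec ?nr (app A x) = A *\<^sub>v vec ?nc x" for x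
    by (rule eq_vecI) (auto simp: app_def scalar_prod_def lessThan_atLeast0 intro!: sum.cong)
  have "bij_betw (vec ?nr) (app A ` vecs {..<?nc}) (col_space A)"
    unfolding bij_betw_def
  proof
    show "inj_on (vec ?nr) (app A ` vecs {..<?nc})"
    proof (rule inj_onI)
      fix x y assume x: "x \<in> app A ` vecs {..<?nc}" and y: "y \<in> app A ` vecs {..<?nc}" and eq: "vec ?nr x = vec ?nr y"
      show "x = y"
      proof
        fix i
        have "x i = 0" "y i = 0" if "\<not> i < ?nr" using that x y by (auto simp: app_def)
        moreover have "x i = y i" if "i < ?nr" using that arg_cong[OF eq, of "\<lambda>v. v $ i"] by simp
        ultimately show "x i = y i" by (cases "i < ?nr") auto
      qed
    qed
    have sur: "\<exists>x\<in>vecs {..<?nc}. vec ?nr (app A x) = A *\<^sub>v v" if "v \<in> carrier_vec ?nc" for v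
    proof (intro bexI)
      have "vec ?nc (\<lambda>i. if i < ?nc then v $ i else 0) = v" using that by auto
      then show "vec ?nr (app A (\<lambda>i. if i < ?nc then v $ i else 0)) = A *\<^sub>v v" by (simp only: mv)
    qed (simp add: fam_def)
    show "vec ?nr ` app A ` vecs {..<?nc} = col_space A"
      unfolding col_space_eq[OF A]
    proof (intro equalityI subsetI)
      fix y assume "y \<in> vec ?nr ` app A ` vecs {..<?nc}"
      then obtain x where "y = A *\<^sub>v vec ?nc x" unfolding mv[symmetric] by blast
      then show "y \<in> {y \<in> carrier_vec ?nr. \<exists>x\<in>carrier_vec ?nc. A *\<^sub>v x = y}"
        by (auto intro: mult_mat_vec_carrier[OF A])
    next
      fix y assume "y \<in> {y \<in> carrier_vec ?nr. \<exists>x\<in>carrier_vec ?nc. A *\<^sub>v x = y}"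
      then obtain v where "v \<in> carrier_vec ?nc" "A *\<^sub>v v = y" by blast
      then show "y \<in> vec ?nr ` app A ` vecs {..<?nc}" using sur[of v] by (metis imageI)
    qed
  qed
  then have "card (app A ` vecs {..<?nc}) = card (col_space A)" by (rule bij_betw_same_card)
  then show ?thesis by (simp add: card_col_space[OF _ A])
qed

section \<open>Existence of the two linear codes\<close>

lemma subspc_ker: "lin f \<Longrightarrow> subspc {x \<in> vecs I. f x = 0}"
  by (auto simp: subspc_def addsub_def lin_diff lin_smul lin_0 smul_vecs addsub_zero[OF addsub_vecs]
      addsub_diff[OF addsub_vecs]) (simp add: smul_def fun_eq_iff)

text \<open>Each point of \<open>T\<close> has at most as many preimages as the kernel has elements;
  the hypothesis on the kernel expresses that \<open>f\<close> has rank \<open>r\<close>.\<close>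

lemma card_lin_preimage:
  fixes f :: "('i \<Rightarrow> 'a::{field,finite}) \<Rightarrow> 'j \<Rightarrow> 'a"
  assumes "lin f" "finite I" "card {x \<in> vecs I. f x = 0} * CARD('a) ^ r = CARD('a) ^ card I" "finite T"
  shows "card {x \<in> vecs I. f x \<in> T} * CARD('a) ^ r \<le> CARD('a) ^ card I * card T"
proof -
  have "card {x \<in> vecs I. f x \<in> T} = card {x \<in> vecs I. f x = 0} * card (T \<inter> f ` vecs I)"
    using assms(1,2) by (intro card_preimage finite_vecs addsub_vecs lin_diff)
  also have "\<dots> \<le> card {x \<in> vecs I. f x = 0} * card T"
    using assms(4) by (intro mult_left_mono card_mono) auto
  finally have "card {x \<in> vecs I. f x \<in> T} * CARD('a) ^ r \<le> (card {x \<in> vecs I. f x = 0} * card T) * CARD('a) ^ r"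
    by (rule mult_right_mono) simp
  also have "\<dots> = CARD('a) ^ card I * card T" by (simp add: assms(3)[symmetric])
  finally show ?thesis .
qed

lemma le_of_mult_power_le:
  fixes q :: nat
  assumes "q > 0" "x * q ^ (r + s) \<le> y * q ^ s"
  shows "x * q ^ r \<le> y"
  using assms by (simp add: power_add mult.assoc[symmetric])

text \<open>If all multiples \<open>y\<^sub>c x\<close> were hit modulo \<open>S\<close>, the codewords hitting them would be
  \<open>q\<^sup>l\<close> many, all lying columnwise in the preimage of \<open>S + \<langle>x\<rangle>\<close>.\<close>

lemma thin_of_few_codewords:
  fixes K :: "(nat \<Rightarrow> 'a::{field,finite}) \<Rightarrow> nat \<Rightarrow> 'a"
  assumes K: "lin K" "subspc S" "x \<notin> S" and J: "finite J"
    and H: "\<And>L c. cw J H L c \<in> vecs B"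
    and few: "card {L \<in> vecs J. L \<noteq> 0 \<and> (\<forall>c\<in>{..<l}. cw J H L c \<in> {v \<in> vecs B. K v \<in> {s + smul k x |s k. s \<in> S}})} + 1
      < CARD('a) ^ l"
  shows "\<exists>y\<in>vecs {..<l}. \<not> (\<exists>L\<in>vecs J. \<forall>c\<in>{..<l}. smul (y c) x - K (cw J H L c) \<in> S)"
proof (rule ccontr)
  let ?N = "{v \<in> vecs B. K v \<in> {s + smul k x |s k. s \<in> S}}"
  let ?L = "{L \<in> vecs J. \<forall>c\<in>{..<l}. cw J H L c \<in> ?N}"
  let ?L' = "{L \<in> vecs J. L \<noteq> 0 \<and> (\<forall>c\<in>{..<l}. cw J H L c \<in> ?N)}"
  assume "\<not> ?thesis"
  then have "\<forall>y\<in>vecs {..<l}. \<exists>L\<in>vecs J. \<forall>c\<in>{..<l}. smul (y c) x - K (cw J H L c) \<in> S" by blast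
  then obtain f where f: "\<And>y. y \<in> vecs {..<l} \<Longrightarrow> f y \<in> vecs J"
    "\<And>y c. y \<in> vecs {..<l} \<Longrightarrow> c < l \<Longrightarrow> smul (y c) x - K (cw J H (f y) c) \<in> S"
    by (metis lessThan_iff)
  have S: "addsub S" using K(2) by (rule subspc_addsub)
  have inj: "inj_on f (vecs {..<l})"
  proof (rule inj_onI)
    fix y z assume y: "y \<in> vecs {..<l}" and z: "z \<in> vecs {..<l}" and eq: "f y = f z"
    show "y = z"
    proof
      fix c
      show "y c = z c"
      proof (cases "c < l")
        case True
        \<comment> \<open>With equal information vectors the codeword cancels and leaves a multiple
          of \<open>x\<close> in \<open>S\<close>; its coefficient must vanish, as \<open>x\<close>
          is not in \<open>S\<close>.\<close>
        have "(smul (y c) x - K (cw J H (f y) c)) - (smul (z c) x - K (cw J H (f y) c)) \<in> S"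
          using f(2)[OF y True] f(2)[OF z True] S eq by (simp only: addsub_diff)
        then have m: "smul (y c - z c) x \<in> S" by (simp add: smul_diff_left)
        show ?thesis
        proof (rule ccontr)
          assume "y c \<noteq> z c"
          then have "smul (1 / (y c - z c)) (smul (y c - z c) x) = x" by (simp add: smul_def fun_eq_iff)
          then show False using subspc_smul[OF K(2) m] K(3) by metis
        qed
      next
        case False
        then show ?thesis using fam_out[OF y] fam_out[OF z] by simp
      qed
    qed
  qed
  have im: "f ` vecs {..<l} \<subseteq> ?L"
  proof
    fix L assume "L \<in> f ` vecs {..<l}"
    then obtain y where y: "y \<in> vecs {..<l}" and L: "L = f y" by auto
    have "K (cw J H L c) \<in> {s + smul k x |s k. s \<in> S}" if "c < l" for c
    proof -
      have "- (smul (y c) x - K (cw J H L c)) \<in> S"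
        using f(2)[OF y that] unfolding L by (rule addsub_minus[OF S])
      moreover have "K (cw J H L c) = - (smul (y c) x - K (cw J H L c)) + smul (y c) x" by simp
      ultimately show ?thesis by blast
    qed
    then show "L \<in> ?L" using f(1)[OF y] H L by auto
  qed
  have fL: "finite ?L" using finite_vecs[OF J] by (rule rev_finite_subset) auto
  have fL': "finite ?L'" using fL by (rule rev_finite_subset) auto
  from inj im fL have "card (vecs {..<l} :: (nat \<Rightarrow> 'a) set) \<le> card ?L" by (rule card_inj_on_le)
  \<comment> \<open>The zero vector is excluded in \<open>few\<close>, whence the \<open>+ 1\<close>
    there.\<close>
  also have "card ?L \<le> card (insert 0 ?L')"
    using fL' by (intro card_mono) auto
  also have "\<dots> \<le> card ?L' + 1" using card_insert_if[OF fL', of 0] by simp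
  finally show False using few by (simp add: card_vecs)
qed

text \<open>\<open>a\<close> and \<open>l\<close> do not depend on \<open>p\<close> or
  \<open>k\<close>. The main code has dimension \<open>k + m2 p^2 + a = (m0 - m1) p^2 - a\<close>:
  the surplus \<open>a\<close> in the scramble part makes it cover Eve's view, and the deficit
  \<open>a\<close> against \<open>(m0 - m1) p^2\<close> makes the code injective modulo the noise.
  The signal code has dimension \<open>m2 l + a\<close>, but the number of its words compatible with
  a false direction is bounded independently of \<open>l\<close>, so that a large \<open>l\<close>
  makes it thin.\<close>

lemma secret_scheme_exists:
  fixes KK :: "(((nat \<Rightarrow> 'a::{field,finite}) \<Rightarrow> nat \<Rightarrow> 'a) \<times> (nat \<Rightarrow> 'a) set) set"
    and EE :: "((nat \<Rightarrow> 'a) \<Rightarrow> nat \<Rightarrow> 'a) set"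
  assumes KK: "finite KK" "\<And>K S. (K, S) \<in> KK \<Longrightarrow> lin K" "\<And>K S. (K, S) \<in> KK \<Longrightarrow> subspc S"
      "\<And>K S. (K, S) \<in> KK \<Longrightarrow> finite S" "\<And>K S. (K, S) \<in> KK \<Longrightarrow> card S = CARD('a) ^ m1"
      "\<And>K S. (K, S) \<in> KK \<Longrightarrow> card {x \<in> vecs {..<m}. K x = 0} * CARD('a) ^ m0 = CARD('a) ^ m"
    and EE: "\<And>E. E \<in> EE \<Longrightarrow> lin E"
      "\<And>E. E \<in> EE \<Longrightarrow> card {x \<in> vecs {..<m}. E x = 0} * CARD('a) ^ m2 = CARD('a) ^ m"
    and less: "m2 + m1 < m0"
  obtains a l where "\<And>p k. k + 2 * a = (m0 - m1 - m2) * p\<^sup>2 \<Longrightarrow>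
    \<exists>G H. secret_scheme m p l KK EE {..<k} {k..<k + (m2 * p\<^sup>2 + a)} {..<m2 * l + a} G H"
proof -
  let ?q = "CARD('a)" and ?B = "{..<m}"
  have q: "?q \<ge> 2" by (rule CARD_field_ge_2)
  have q0: "?q > 0" using q by linarith
  define VV where "VV = {V :: (nat \<Rightarrow> 'a) set. subspc V \<and> V \<subseteq> vecs ?B \<and> card (perp ?B V) \<le> ?q ^ m2}"
  define NN where "NN r = {N :: (nat \<Rightarrow> 'a) set. N \<subseteq> vecs ?B \<and> card N * ?q ^ r \<le> ?q ^ card ?B}" for r
  have fB: "finite (vecs ?B :: (nat \<Rightarrow> 'a) set)" by (simp add: finite_vecs)
  then have fPow: "finite (Pow (vecs ?B :: (nat \<Rightarrow> 'a) set))" by simp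
  have fVV: "finite VV" using fPow by (rule rev_finite_subset) (auto simp: VV_def)
  have fNN: "finite (NN r)" for r using fPow by (rule rev_finite_subset) (auto simp: NN_def)
  have ker: "{x \<in> vecs ?B. E x = 0} \<in> VV" if E: "E \<in> EE" for E
  proof -
    let ?V = "{x \<in> vecs ?B. E x = 0}"
    have s: "subspc ?V" by (rule subspc_ker[OF EE(1)[OF E]])
    then have "card ?V * card (perp ?B ?V) = card ?V * ?q ^ m2"
      using card_perp[OF _ s] EE(2)[OF E] by simp
    moreover have "card ?V > 0" by (rule gr0I) (use EE(2)[OF E] q0 in simp)
    ultimately show ?thesis using s by (auto simp: VV_def)
  qed
  have pre: "{x \<in> vecs ?B. K x \<in> S} \<in> NN (m0 - m1)" if K: "(K, S) \<in> KK" for K S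
  proof -
    have "card {x \<in> vecs ?B. K x \<in> S} * ?q ^ m0 \<le> ?q ^ m * ?q ^ m1"
      using card_lin_preimage[OF KK(2)[OF K], of ?B m0 S] KK(4,5,6)[OF K] by simp
    then have "card {x \<in> vecs ?B. K x \<in> S} * ?q ^ ((m0 - m1) + m1) \<le> ?q ^ m * ?q ^ m1"
      using less by simp
    then have "card {x \<in> vecs ?B. K x \<in> S} * ?q ^ (m0 - m1) \<le> ?q ^ m"
      by (rule le_of_mult_power_le[OF q0])
    then show ?thesis by (auto simp: NN_def)
  qed
  \<comment> \<open>Adding the line through \<open>x\<close> enlarges \<open>S\<close> at most
    \<open>q\<close> times, and as \<open>m2 + m1 + 1 \<le> m0\<close>, the preimage still has
    density at most \<open>q ^ - m2\<close>.\<close>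
  have pre': "{v \<in> vecs ?B. K v \<in> {s + smul k x |s k. s \<in> S}} \<in> NN m2" if K: "(K, S) \<in> KK" for K S x
  proof -
    let ?T = "{s + smul k x |s k. s \<in> S}"
    have T: "?T = (\<lambda>(s, k). s + smul k x) ` (S \<times> UNIV)" by auto
    have fT: "finite ?T" unfolding T using KK(4)[OF K] by auto
    have "card ?T \<le> card (S \<times> (UNIV :: 'a set))"
      unfolding T using KK(4)[OF K] by (intro card_image_le) auto
    then have cT: "card ?T \<le> ?q ^ (m1 + 1)" using KK(5)[OF K] by (simp add: card_cartesian_product mult.commute)
    have "card {v \<in> vecs ?B. K v \<in> ?T} * ?q ^ (m2 + (m1 + 1)) \<le> card {v \<in> vecs ?B. K v \<in> ?T} * ?q ^ m0"
      using less q by (intro mult_left_mono power_increasing) auto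
    also have "\<dots> \<le> ?q ^ m * card ?T"
      using card_lin_preimage[OF KK(2)[OF K], of ?B m0 ?T] KK(6)[OF K] fT by simp
    also have "\<dots> \<le> ?q ^ m * ?q ^ (m1 + 1)" using cT by (rule mult_left_mono) simp
    finally have "card {v \<in> vecs ?B. K v \<in> ?T} * ?q ^ m2 \<le> ?q ^ m"
      by (rule le_of_mult_power_le[OF q0])
    then show ?thesis by (auto simp: NN_def)
  qed
  define a where "a = 2 * card VV + 2 * card (NN (m0 - m1))"
  \<comment> \<open>The first summand bounds the nonzero words compatible with a false direction,
    and the \<open>1\<close> accounts for the zero word; their sum \<open>l\<close> is below
    \<open>q ^ l\<close>.\<close>
  define l where "l = 2 * card (NN m2) * ?q ^ a + 1"
  have big: "x < ?q ^ x" for x using q less_exp[of x] power_mono[of 2 ?q x] by linarith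
  have a: "2 * card VV < ?q ^ a" "2 * card (NN (m0 - m1)) < ?q ^ a"
    using big[of a] by (simp_all add: a_def)
  \<comment> \<open>Were there no such vector, the kernel of \<open>E\<close>, of size
    \<open>q ^ (m - m2)\<close>, would lie in the preimage of \<open>S'\<close>, of size at most
    \<open>q ^ (m - m0 + m1)\<close>.\<close>
  have sep: "\<exists>v\<in>vecs ?B. E v = 0 \<and> K v \<notin> S'" if K: "(K, S) \<in> KK" and K': "(K', S') \<in> KK" and E: "E \<in> EE" for K S K' S' E
  proof (rule ccontr)
    assume "\<not> ?thesis"
    then have "{v \<in> vecs ?B. E v = 0} \<subseteq> {v \<in> vecs ?B. K v \<in> S'}" by auto
    then have "card {v \<in> vecs ?B. E v = 0} \<le> card {v \<in> vecs ?B. K v \<in> S'}"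
      using fB by (intro card_mono) auto
    then have "card {v \<in> vecs ?B. E v = 0} * ?q ^ m0 \<le> card {v \<in> vecs ?B. K v \<in> S'} * ?q ^ m0"
      by (rule mult_right_mono) simp
    also have "\<dots> \<le> ?q ^ m * ?q ^ m1"
      using card_lin_preimage[OF KK(2)[OF K], of ?B m0 S'] KK(6)[OF K] KK(4,5)[OF K'] by simp
    also have "\<dots> = card {v \<in> vecs ?B. E v = 0} * ?q ^ (m2 + m1)"
      using EE(2)[OF E] by (simp add: power_add)
    finally have "?q ^ m0 \<le> ?q ^ (m2 + m1)"
      using EE(2)[OF E] q by (cases "card {v \<in> vecs ?B. E v = 0} = 0") auto
    then show False using less q by (simp add: power_le_imp_le_exp leD)
  qed
  have "card {..<l} = l" "card {..<m2 * l + a} = m2 * l + a" by simp_all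
  then have sizeH: "2 * card VV * ?q ^ (m2 * card {..<l}) < ?q ^ card {..<m2 * l + a}"
    using a(1) q by (simp add: power_add mult.commute)
  obtain H :: "nat \<Rightarrow> nat \<times> nat \<Rightarrow> 'a" where H: "\<And>i. i \<in> {..<m2 * l + a} \<Longrightarrow> H i \<in> vecs ({..<l} \<times> ?B)"
    "\<And>V X. V \<in> VV \<Longrightarrow> X \<in> fam {..<l} (vecs ?B) \<Longrightarrow>
      \<exists>L\<in>vecs {..<m2 * l + a}. \<forall>c\<in>{..<l}. X c - cw {..<m2 * l + a} H L c \<in> V"
    "\<And>N. N \<in> NN m2 \<Longrightarrow> card {u \<in> vecs {..<m2 * l + a}. u \<noteq> 0 \<and> (\<forall>c\<in>{..<l}. cw {..<m2 * l + a} H u c \<in> N)}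
      * ?q ^ (m2 * card {..<l}) \<le> 2 * card (NN m2) * ?q ^ card {..<m2 * l + a}"
    by (rule code_exists[where I = "{..<m2 * l + a}" and J = "{..<m2 * l + a}" and C = "{..<l}" and B = ?B
          and VV = VV and NN = "NN m2" and m = m2 and r = m2])
       (use fVV fNN sizeH in \<open>auto simp: VV_def NN_def\<close>)
  have Hthin: "\<exists>y\<in>vecs {..<l}. \<not> (\<exists>L\<in>vecs {..<m2 * l + a}. \<forall>c\<in>{..<l}. smul (y c) x - K (cw {..<m2 * l + a} H L c) \<in> S)"
    if K: "(K, S) \<in> KK" "x \<notin> S" for K S x
  proof (rule thin_of_few_codewords[OF KK(2)[OF K(1)] KK(3)[OF K(1)] K(2), where B = ?B])
    show "cw {..<m2 * l + a} H L c \<in> vecs ?B" for L c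
      by (rule fam_mem'[OF cw_vecs[OF H(1)] addsub_zero[OF addsub_vecs]])
    have "card {L \<in> vecs {..<m2 * l + a}. L \<noteq> 0 \<and>
        (\<forall>c\<in>{..<l}. cw {..<m2 * l + a} H L c \<in> {v \<in> vecs ?B. K v \<in> {s + smul k x |s k. s \<in> S}})} * ?q ^ (m2 * l)
      \<le> (2 * card (NN m2) * ?q ^ a) * ?q ^ (m2 * l)"
      using H(3)[OF pre'[OF K(1)]] by (simp add: power_add mult_ac)
    then have "card {L \<in> vecs {..<m2 * l + a}. L \<noteq> 0 \<and>
        (\<forall>c\<in>{..<l}. cw {..<m2 * l + a} H L c \<in> {v \<in> vecs ?B. K v \<in> {s + smul k x |s k. s \<in> S}})}
      \<le> 2 * card (NN m2) * ?q ^ a" using q by simp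
    then show "card {L \<in> vecs {..<m2 * l + a}. L \<noteq> 0 \<and>
        (\<forall>c\<in>{..<l}. cw {..<m2 * l + a} H L c \<in> {v \<in> vecs ?B. K v \<in> {s + smul k x |s k. s \<in> S}})} + 1
      < ?q ^ l" using big[of l] unfolding l_def by linarith
  qed simp
  have surj: "\<exists>L\<in>vecs J. \<forall>c\<in>C. E (cw I F L c) = E (X c)"
    if E: "E \<in> EE" and L: "\<exists>L\<in>vecs J. \<forall>c\<in>C. X c - cw I F L c \<in> {x \<in> vecs ?B. E x = 0}"
    for E and J I :: "nat set" and C :: "'c set" and F X
  proof -
    from L obtain L where "L \<in> vecs J" "\<And>c. c \<in> C \<Longrightarrow> E (X c - cw I F L c) = 0" by auto
    then have "E (cw I F L c) = E (X c)" if "c \<in> C" for c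
      using that by (simp add: lin_diff[OF EE(1)[OF E]])
    then show ?thesis using \<open>L \<in> vecs J\<close> by blast
  qed
  show thesis
  proof (rule that)
    fix p k assume k: "k + 2 * a = (m0 - m1 - m2) * p\<^sup>2"
    let ?C = "{..<p} \<times> {..<p}" and ?IM = "{..<k}" and ?IL = "{k..<k + (m2 * p\<^sup>2 + a)}"
    have cC: "card ?C = p\<^sup>2" by (simp add: card_cartesian_product power2_eq_square)
    have I: "?IM \<union> ?IL = {..<k + (m2 * p\<^sup>2 + a)}" by auto
    have sizeG: "2 * card VV * ?q ^ (m2 * card ?C) < ?q ^ card ?IL"
      using a(1) q by (simp add: cC power_add mult.commute)
    obtain G :: "nat \<Rightarrow> (nat \<times> nat) \<times> nat \<Rightarrow> 'a" where G: "\<And>i. i \<in> ?IM \<union> ?IL \<Longrightarrow> G i \<in> vecs (?C \<times> ?B)"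
      "\<And>V X. V \<in> VV \<Longrightarrow> X \<in> fam ?C (vecs ?B) \<Longrightarrow> \<exists>L\<in>vecs ?IL. \<forall>c\<in>?C. X c - cw (?IM \<union> ?IL) G L c \<in> V"
      "\<And>N. N \<in> NN (m0 - m1) \<Longrightarrow> card {u \<in> vecs (?IM \<union> ?IL). u \<noteq> 0 \<and> (\<forall>c\<in>?C. cw (?IM \<union> ?IL) G u c \<in> N)}
        * ?q ^ ((m0 - m1) * card ?C) \<le> 2 * card (NN (m0 - m1)) * ?q ^ card (?IM \<union> ?IL)"
      by (rule code_exists[where I = "?IM \<union> ?IL" and J = ?IL and C = ?C and B = ?B
            and VV = VV and NN = "NN (m0 - m1)" and m = m2 and r = "m0 - m1"])
         (use fVV fNN sizeG in \<open>auto simp: VV_def NN_def\<close>)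
    have dims: "card (?IM \<union> ?IL) + a = (m0 - m1) * p\<^sup>2"
    proof -
      have "card (?IM \<union> ?IL) + a = (m0 - m1 - m2) * p\<^sup>2 + m2 * p\<^sup>2" using k by (simp add: I)
      also have "\<dots> = (m0 - m1) * p\<^sup>2" using less by (simp add: distrib_right[symmetric])
      finally show ?thesis .
    qed
    \<comment> \<open>By the deficit \<open>a\<close> in \<open>dims\<close>, the bound on the
      number of such nonzero \<open>u\<close> is below one.\<close>
    have Ginj: "u = 0" if K: "(K, S) \<in> KK" and u: "u \<in> vecs (?IM \<union> ?IL)"
      and S: "\<And>c. c \<in> ?C \<Longrightarrow> K (cw (?IM \<union> ?IL) G u c) \<in> S" for K S u
    proof (rule ccontr)
      assume "u \<noteq> 0"
      let ?U = "{u \<in> vecs (?IM \<union> ?IL). u \<noteq> 0 \<and> (\<forall>c\<in>?C. cw (?IM \<union> ?IL) G u c \<in> {x \<in> vecs ?B. K x \<in> S})}"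
      have "cw (?IM \<union> ?IL) G u c \<in> vecs ?B" for c
        by (rule fam_mem'[OF cw_vecs[OF G(1)] addsub_zero[OF addsub_vecs]])
      then have "u \<in> ?U" using u S \<open>u \<noteq> 0\<close> by blast
      moreover have "finite ?U" using finite_vecs[of "?IM \<union> ?IL", where 'a = 'a] by auto
      ultimately have "card ?U > 0" unfolding card_gt_0_iff by blast
      then have "?q ^ ((m0 - m1) * p\<^sup>2) \<le> card ?U * ?q ^ ((m0 - m1) * p\<^sup>2)" by simp
      also have "\<dots> \<le> 2 * card (NN (m0 - m1)) * ?q ^ card (?IM \<union> ?IL)"
        using G(3)[OF pre[OF K]] unfolding cC .
      also have "\<dots> < ?q ^ a * ?q ^ card (?IM \<union> ?IL)"
        using a(2) q by (intro mult_strict_right_mono) auto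
      finally show False unfolding dims[symmetric] by (simp add: power_add mult.commute)
    qed
    have "secret_scheme m p l KK EE ?IM ?IL {..<m2 * l + a} G H"
    proof
      show "\<exists>v\<in>vecs ?B. E v = 0 \<and> K v \<notin> S'" if "(K, S) \<in> KK" "(K', S') \<in> KK" "E \<in> EE" for K S K' S' E
        using that by (rule sep)
      show "u = 0" if "(K, S) \<in> KK" "u \<in> vecs (?IM \<union> ?IL)" "\<And>c. c \<in> ?C \<Longrightarrow> K (cw (?IM \<union> ?IL) G u c) \<in> S" for K S u
        using that by (rule Ginj)
      show "\<exists>L\<in>vecs ?IL. \<forall>c\<in>?C. E (cw (?IM \<union> ?IL) G L c) = E (X c)"
        if "E \<in> EE" "X \<in> fam ?C (vecs ?B)" for E X
        by (rule surj[OF that(1) G(2)[OF ker[OF that(1)] that(2)]])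
      show "\<exists>L\<in>vecs {..<m2 * l + a}. \<forall>c\<in>{..<l}. E (cw {..<m2 * l + a} H L c) = E (X c)"
        if "E \<in> EE" "X \<in> fam {..<l} (vecs ?B)" for E X
        by (rule surj[OF that(1) H(2)[OF ker[OF that(1)] that(2)]])
    qed (use KK EE G(1) H(1) Hthin in auto)
    then show "\<exists>G H. secret_scheme m p l KK EE ?IM ?IL {..<m2 * l + a} G H" by blast
  qed
qed

section \<open>Probability and information\<close>

lemma uniform_count_measure_times:
  assumes "finite A" "finite B"
  shows "uniform_count_measure A \<Otimes>\<^sub>M uniform_count_measure B = uniform_count_measure (A \<times> B)"
proof (rule measure_eqI_finite)
  show "sets (uniform_count_measure A \<Otimes>\<^sub>M uniform_count_measure B) = Pow (A \<times> B)"
  proof -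
    have "sets (uniform_count_measure A \<Otimes>\<^sub>M uniform_count_measure B) = sets (count_space A \<Otimes>\<^sub>M count_space B)"
      by (intro sets_pair_measure_cong sets_uniform_count_measure_count_space)
    then show ?thesis by (simp only: pair_measure_count_space[OF assms] sets_count_space)
  qed
  show "sets (uniform_count_measure (A \<times> B)) = Pow (A \<times> B)" by (simp add: sets_uniform_count_measure)
  show "finite (A \<times> B)" using assms by simp
  fix x assume x: "x \<in> A \<times> B"
  then obtain a b where ab: "x = (a, b)" "a \<in> A" "b \<in> B" by auto
  interpret prob_space "uniform_count_measure B"
    using ab assms(2) by (intro prob_space_uniform_count_measure) auto
  have "emeasure (uniform_count_measure A \<Otimes>\<^sub>M uniform_count_measure B) ({a} \<times> {b})
      = emeasure (uniform_count_measure A) {a} * emeasure (uniform_count_measure B) {b}"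
    using ab by (intro emeasure_pair_measure_Times) (auto simp: sets_uniform_count_measure)
  then show "emeasure (uniform_count_measure A \<Otimes>\<^sub>M uniform_count_measure B) {x} = emeasure (uniform_count_measure (A \<times> B)) {x}"
    using ab assms by (simp add: emeasure_uniform_count_measure card_cartesian_product ennreal_mult[symmetric])
qed

lemma code_space_uniform:
  "finite (messages \<Phi>) \<Longrightarrow> finite (scrambles \<Phi>) \<Longrightarrow>
    code_space \<Phi> = uniform_count_measure (messages \<Phi> \<times> scrambles \<Phi>)"
  by (simp add: code_space_def uniform_count_measure_times)

lemma error_prob_le:
  assumes fin: "finite (messages \<Phi>)" "finite (scrambles \<Phi>)" "scrambles \<Phi> \<noteq> {}"
    and bound: "\<And>m. m \<in> messages \<Phi> \<Longrightarrow>
      real (card {s \<in> scrambles \<Phi>. decoder \<Phi> (bob_obs K H \<alpha> (encoder \<Phi> m s)) \<noteq> m}) \<le> e * real (card (scrambles \<Phi>))"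
    and e: "e \<ge> 0"
  shows "error_prob \<Phi> K H \<alpha> \<le> e"
proof -
  let ?M = "messages \<Phi>" and ?S = "scrambles \<Phi>"
  let ?bad = "{(m, s) \<in> ?M \<times> ?S. decoder \<Phi> (bob_obs K H \<alpha> (encoder \<Phi> m s)) \<noteq> m}"
  have "?bad = Sigma ?M (\<lambda>m. {s \<in> ?S. decoder \<Phi> (bob_obs K H \<alpha> (encoder \<Phi> m s)) \<noteq> m})" by auto
  then have "card ?bad = (\<Sum>m\<in>?M. card {s \<in> ?S. decoder \<Phi> (bob_obs K H \<alpha> (encoder \<Phi> m s)) \<noteq> m})"
    using fin by simp
  then have "real (card ?bad) = (\<Sum>m\<in>?M. real (card {s \<in> ?S. decoder \<Phi> (bob_obs K H \<alpha> (encoder \<Phi> m s)) \<noteq> m}))"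
    by simp
  also have "\<dots> \<le> (\<Sum>m\<in>?M. e * real (card ?S))" using bound by (rule sum_mono)
  finally have "real (card ?bad) \<le> (\<Sum>m\<in>?M. e * real (card ?S))" .
  then have le: "real (card ?bad) \<le> e * (real (card ?M) * real (card ?S))" by (simp add: mult_ac)
  have "error_prob \<Phi> K H \<alpha> = real (card ?bad) / real (card (?M \<times> ?S))"
    using fin by (simp add: error_prob_def code_space_uniform space_uniform_count_measure)
      (subst measure_uniform_count_measure, auto simp: card_cartesian_product)
  also have "\<dots> \<le> e"
  proof (cases "?M = {}")
    case False
    then have "real (card ?M) * real (card ?S) > 0" using fin by (simp add: card_gt_0_iff)
    then show ?thesis using le by (simp add: card_cartesian_product divide_le_eq)
  qed (use e in simp)
  finally show ?thesis .
qed

text \<open>By \<open>same\<close>, message and observation are independent, so the joint law is the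
  product of the marginals, and the divergence of a measure from itself is zero.\<close>

lemma eve_information_zero:
  fixes \<Phi> :: "('a::semiring_0, 'm, 's) network_code"
  assumes fin: "finite (messages \<Phi>)" "finite (scrambles \<Phi>)" "messages \<Phi> \<noteq> {}" "scrambles \<Phi> \<noteq> {}"
    and same: "\<And>m m' y. m \<in> messages \<Phi> \<Longrightarrow> m' \<in> messages \<Phi> \<Longrightarrow>
      card {s \<in> scrambles \<Phi>. eve_obs (snd K) (snd H) \<alpha> (encoder \<Phi> m s) = y}
      = card {s \<in> scrambles \<Phi>. eve_obs (snd K) (snd H) \<alpha> (encoder \<Phi> m' s) = y}"
  shows "eve_information \<Phi> K H \<alpha> = 0"
proof -
  let ?M = "messages \<Phi>" and ?S = "scrambles \<Phi>"
  define X where "X = (\<lambda>(m :: 'm, s :: 's). m)"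
  define Y where "Y = (\<lambda>(m, s). eve_obs (snd K) (snd H) \<alpha> (encoder \<Phi> m s))"
  define P where "P = uniform_count_measure (?M \<times> ?S)"
  define T where "T = Y ` (?M \<times> ?S)"
  have sp: "space P = ?M \<times> ?S" and sets: "sets P = Pow (?M \<times> ?S)"
    by (simp_all add: P_def space_uniform_count_measure sets_uniform_count_measure)
  interpret prob_space P unfolding P_def using fin by (intro prob_space_uniform_count_measure) auto
  have XM: "X ` (?M \<times> ?S) = ?M" using fin(4) by (force simp: X_def)
  have fT: "finite T" using fin by (simp add: T_def)
  have mX: "X \<in> measurable P (count_space ?M)" and mY: "Y \<in> measurable P (count_space T)"
    by (auto simp: measurable_def sets sp X_def T_def)
  have mXY: "(\<lambda>x. (X x, Y x)) \<in> measurable P (count_space (?M \<times> T))"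
    by (auto simp: measurable_def sets sp X_def T_def)
  let ?c = "\<lambda>m y. card {s \<in> ?S. Y (m, s) = y}"
  have pr: "emeasure P A = ennreal (real (card A) / (real (card ?M) * real (card ?S)))" if "A \<subseteq> ?M \<times> ?S" for A
    unfolding P_def using that fin by (simp add: emeasure_uniform_count_measure card_cartesian_product)
  have pos: "real (card ?M) > 0" "real (card ?S) > 0" using fin by (simp_all add: card_gt_0_iff)
  have "distr P (count_space ?M) X \<Otimes>\<^sub>M distr P (count_space T) Y
      = distr P (count_space ?M \<Otimes>\<^sub>M count_space T) (\<lambda>x. (X x, Y x))"
  proof (rule measure_eqI_finite)
    have "sets (distr P (count_space ?M) X \<Otimes>\<^sub>M distr P (count_space T) Y) = sets (count_space ?M \<Otimes>\<^sub>M count_space T)"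
      by (intro sets_pair_measure_cong) auto
    then show "sets (distr P (count_space ?M) X \<Otimes>\<^sub>M distr P (count_space T) Y) = Pow (?M \<times> T)"
      by (simp only: pair_measure_count_space[OF fin(1) fT] sets_count_space)
    show "sets (distr P (count_space ?M \<Otimes>\<^sub>M count_space T) (\<lambda>x. (X x, Y x))) = Pow (?M \<times> T)"
      by (simp only: pair_measure_count_space[OF fin(1) fT] sets_distr sets_count_space)
    show "finite (?M \<times> T)" using fin fT by simp
    fix x assume "x \<in> ?M \<times> T"
    then obtain m y where x: "x = (m, y)" "m \<in> ?M" "y \<in> T" by auto
    interpret D: prob_space "distr P (count_space T) Y" using mY by (rule prob_space_distr)
    have "emeasure (distr P (count_space ?M) X \<Otimes>\<^sub>M distr P (count_space T) Y) ({m} \<times> {y})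
        = emeasure (distr P (count_space ?M) X) {m} * emeasure (distr P (count_space T) Y) {y}"
      using x by (intro D.emeasure_pair_measure_Times) auto
    also have "emeasure (distr P (count_space ?M) X) {m} = ennreal (1 / real (card ?M))"
    proof -
      have "X -` {m} \<inter> space P = {m} \<times> ?S" using x by (auto simp: sp X_def)
      moreover have "emeasure P ({m} \<times> ?S) = ennreal (1 / real (card ?M))"
        using pr[of "{m} \<times> ?S"] x pos by (auto simp: card_cartesian_product)
      ultimately show ?thesis using x mX by (simp add: emeasure_distr)
    qed
    \<comment> \<open>The marginal averages counts that \<open>same\<close> makes equal for all
      messages, so the count for \<open>m\<close> can stand for all of them.\<close>
    also have "emeasure (distr P (count_space T) Y) {y} = ennreal (real (?c m y) / real (card ?S))"
    proof -
      have "Y -` {y} \<inter> space P = Sigma ?M (\<lambda>m'. {s \<in> ?S. Y (m', s) = y})" by (auto simp: sp)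
      moreover have "card (Sigma ?M (\<lambda>m'. {s \<in> ?S. Y (m', s) = y})) = (\<Sum>m'\<in>?M. ?c m' y)"
        using fin by simp
      moreover have "\<dots> = (\<Sum>m'\<in>?M. ?c m y)"
      proof (rule sum.cong[OF refl])
        fix m' assume "m' \<in> ?M"
        from same[OF this x(2)] show "?c m' y = ?c m y" by (simp add: Y_def)
      qed
      moreover have "Sigma ?M (\<lambda>m'. {s \<in> ?S. Y (m', s) = y}) \<subseteq> ?M \<times> ?S" by auto
      ultimately show ?thesis using x mY pos by (simp add: emeasure_distr pr)
    qed
    also have "ennreal (1 / real (card ?M)) * ennreal (real (?c m y) / real (card ?S))
        = emeasure P ((\<lambda>x. (X x, Y x)) -` {(m, y)} \<inter> space P)"
    proof -
      have "(\<lambda>x. (X x, Y x)) -` {(m, y)} \<inter> space P = {m} \<times> {s \<in> ?S. Y (m, s) = y}"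
        using x by (auto simp: sp X_def)
      moreover have "{m} \<times> {s \<in> ?S. Y (m, s) = y} \<subseteq> ?M \<times> ?S" using x by auto
      ultimately show ?thesis by (simp add: pr card_cartesian_product ennreal_mult[symmetric])
    qed
    also have "\<dots> = emeasure (distr P (count_space ?M \<Otimes>\<^sub>M count_space T) (\<lambda>x. (X x, Y x))) {(m, y)}"
      using x mXY fin fT by (simp add: emeasure_distr pair_measure_count_space)
    finally show "emeasure (distr P (count_space ?M) X \<Otimes>\<^sub>M distr P (count_space T) Y) {x}
        = emeasure (distr P (count_space ?M \<Otimes>\<^sub>M count_space T) (\<lambda>x. (X x, Y x))) {x}" using x by simp
  qed
  moreover have "prob_space (distr P (count_space ?M \<Otimes>\<^sub>M count_space T) (\<lambda>x. (X x, Y x)))"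
    using mXY fin fT by (intro prob_space_distr) (simp add: pair_measure_count_space)
  ultimately have "mutual_information 2 (count_space ?M) (count_space T) X Y = 0"
    unfolding mutual_information_def
    by (simp add: sigma_finite_measure.KL_same_eq_0 prob_space_imp_sigma_finite)
  then show ?thesis
    unfolding eve_information_def Let_def code_space_uniform[OF fin(1,2)] P_def[symmetric] X_def[symmetric] Y_def[symmetric]
    by (simp add: sp XM T_def)
qed

section \<open>Flattening the columns\<close>

lemma app_in_image: "app A x \<in> app A ` vecs {..<dim_col A}"
proof (rule image_eqI)
  show "app A x = app A (\<lambda>i. if i < dim_col A then x i else 0)"
    by (rule ext) (auto simp: app_def intro!: sum.cong)
qed (simp add: fam_def)

definition fun_of :: "'a::zero vec \<Rightarrow> nat \<Rightarrow> 'a"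
  where "fun_of v = (\<lambda>i. if i < dim_vec v then v $ i else 0)"

lemma fun_of_vecs: "v \<in> carrier_vec k \<Longrightarrow> fun_of v \<in> vecs {..<k}"
  by (auto simp: fun_of_def fam_def)

lemma vec_fun_of: "v \<in> carrier_vec k \<Longrightarrow> vec k (fun_of v) = v"
  by (auto simp: fun_of_def)

context secret_scheme
begin

definition cols :: "(nat \<times> nat + (sym \<times> 'a \<times> nat) \<times> nat) set"
  where "cols = mcols <+> (sigs \<times> {..<l})"

lemma finite_cols: "finite cols"
  by (simp add: cols_def finite_syms)

lemma card_cols: "card cols = p\<^sup>2 + n * p * (m + 1) * CARD('a) * n * l"
  by (simp add: cols_def card_Plus finite_syms card_cartesian_product card_syms power2_eq_square mult_ac)

text \<open>Any order of the columns will do, as the network matrices act on each column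
  separately.\<close>

definition enum where
  "enum = (SOME e. bij_betw e {..<card cols} cols)"

lemma enum: "bij_betw enum {..<card cols} cols"
proof -
  have "\<exists>e. bij_betw e {..<card cols} cols"
    using ex_bij_betw_nat_finite[OF finite_cols] by (simp add: lessThan_atLeast0)
  then show ?thesis unfolding enum_def by (rule someI_ex)
qed

definition pos where
  "pos = inv_into {..<card cols} enum"

lemma pos_less: "c \<in> cols \<Longrightarrow> pos c < card cols"
  and enum_pos: "c \<in> cols \<Longrightarrow> enum (pos c) = c"
  and pos_enum: "j < card cols \<Longrightarrow> pos (enum j) = j"
  and enum_cols: "j < card cols \<Longrightarrow> enum j \<in> cols"
proof -
  show "pos c < card cols" if "c \<in> cols"
    using that enum bij_betw_imp_surj_on[OF enum] inv_into_into[of c enum "{..<card cols}"] by (simp add: pos_def)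
  show "enum (pos c) = c" if "c \<in> cols"
    using that bij_betw_imp_surj_on[OF enum] f_inv_into_f[of c enum "{..<card cols}"] by (simp add: pos_def)
  show "pos (enum j) = j" if "j < card cols"
    using that bij_betw_imp_inj_on[OF enum] by (simp add: pos_def inv_into_f_f)
  show "enum j \<in> cols" if "j < card cols"
    using that bij_betw_imp_surj_on[OF enum] by blast
qed

definition to_mat where
  "to_mat r x = mat r (card cols) (\<lambda>(i, j). case enum j of Inl c \<Rightarrow> fst x c i | Inr (\<sigma>, c) \<Rightarrow> snd x \<sigma> c i)"

text \<open>Values outside the index range are zero, matching \<open>fam\<close>, so that
  \<open>to_mat\<close> is inverted by plain equality of functions.\<close>

definition main_of where
  "main_of Y c = (if c \<in> mcols then \<lambda>i. if i < dim_row Y then Y $$ (i, pos (Inl c)) else 0 else 0)"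

definition sig_of where
  "sig_of Y \<sigma> c = (if \<sigma> \<in> sigs \<and> c < l then \<lambda>i. if i < dim_row Y then Y $$ (i, pos (Inr (\<sigma>, c))) else 0 else 0)"

lemma Inl_cols: "b \<in> mcols \<Longrightarrow> Inl b \<in> cols"
  and Inr_cols: "\<sigma> \<in> sigs \<Longrightarrow> c < l \<Longrightarrow> Inr (\<sigma>, c) \<in> cols"
  by (auto simp: cols_def)

lemma to_mat_carrier: "to_mat r x \<in> carrier_mat r (card cols)"
  by (simp add: to_mat_def)

lemma main_of_to_mat:
  assumes "x \<in> fam mcols (vecs {..<r})"
  shows "main_of (to_mat r (x, y)) = x"
proof (intro ext)
  fix c i
  show "main_of (to_mat r (x, y)) c i = x c i"
  proof (cases "c \<in> mcols")
    case True
    have "x c i = 0" if "\<not> i < r" using fam_vecs_out[OF assms, of i c] that by simp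
    then show ?thesis
      using True pos_less[OF Inl_cols[OF True]] enum_pos[OF Inl_cols[OF True]] by (simp add: main_of_def to_mat_def)
  next
    case False
    then show ?thesis using fam_out[OF assms False] by (simp add: main_of_def)
  qed
qed

lemma sig_of_to_mat:
  assumes "x \<in> fam sigs (fam {..<l} (vecs {..<r}))"
  shows "sig_of (to_mat r (y, x)) = x"
proof (intro ext)
  fix \<sigma> c i
  show "sig_of (to_mat r (y, x)) \<sigma> c i = x \<sigma> c i"
  proof (cases "\<sigma> \<in> sigs \<and> c < l")
    case True
    have "x \<sigma> \<in> fam {..<l} (vecs {..<r})" using assms True by (blast intro: fam_mem)
    then have "x \<sigma> c i = 0" if "\<not> i < r" using fam_vecs_out[of "x \<sigma>" "{..<l}" "{..<r}" i c] that by simp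
    then show ?thesis
      using True pos_less[OF Inr_cols, of \<sigma> c] enum_pos[OF Inr_cols, of \<sigma> c] by (simp add: sig_of_def to_mat_def)
  next
    case False
    have "x \<sigma> c = 0"
    proof (cases "\<sigma> \<in> sigs")
      case True
      then have "c \<notin> {..<l}" using False by simp
      then show ?thesis using fam_out[OF fam_mem[OF assms True]] by blast
    next
      case False
      then show ?thesis using fam_out[OF assms False] by simp
    qed
    then show ?thesis unfolding sig_of_def if_not_P[OF False] by simp
  qed
qed

lemma to_mat_of:
  assumes "Y \<in> carrier_mat r (card cols)"
  shows "to_mat r (main_of Y, sig_of Y) = Y"
proof (rule eq_matI)
  fix i j assume "i < dim_row Y" "j < dim_col Y"
  then have i: "i < r" and j: "j < card cols" using assms by auto
  from enum_cols[OF j] pos_enum[OF j] i assms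
  show "to_mat r (main_of Y, sig_of Y) $$ (i, j) = Y $$ (i, j)"
    using j by (cases "enum j") (auto simp: to_mat_def main_of_def sig_of_def cols_def)
qed (use assms in \<open>auto simp: to_mat_def\<close>)

lemma app_column:
  assumes "A \<in> carrier_mat r s" "X \<in> carrier_mat s k" "j < k"
  shows "(\<lambda>i. if i < dim_row (A * X) then (A * X) $$ (i, j) else 0)
    = app A (\<lambda>i. if i < dim_row X then X $$ (i, j) else 0)"
  using assms by (intro ext) (auto simp: app_def scalar_prod_def lessThan_atLeast0 intro!: sum.cong)

lemma app_zero: "app (A :: 'b::field mat) 0 = 0"
  by (rule lin_0[OF lin_app])

lemma main_of_mult:
  fixes A X :: "'b::field mat"
  assumes "A \<in> carrier_mat r s" "X \<in> carrier_mat s (card cols)"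
  shows "main_of (A * X) c = app A (main_of X c)"
proof (cases "c \<in> mcols")
  case True
  then show ?thesis using app_column[OF assms pos_less[OF Inl_cols[OF True]]] by (simp add: main_of_def)
qed (simp add: main_of_def app_zero)

lemma sig_of_mult:
  fixes A X :: "'b::field mat"
  assumes "A \<in> carrier_mat r s" "X \<in> carrier_mat s (card cols)"
  shows "sig_of (A * X) \<sigma> c = app A (sig_of X \<sigma> c)"
proof (cases "\<sigma> \<in> sigs \<and> c < l")
  case True
  then show ?thesis using app_column[OF assms pos_less[OF Inr_cols, of \<sigma> c]] by (simp add: sig_of_def)
next
  case False
  show ?thesis unfolding sig_of_def if_not_P[OF False] app_zero ..
qed

lemma main_of_add:
  fixes X Y :: "'b::field mat"
  assumes "X \<in> carrier_mat s (card cols)" "Y \<in> carrier_mat s (card cols)"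
  shows "main_of (X + Y) c = main_of X c + main_of Y c"
  using assms pos_less[OF Inl_cols, of c] by (auto simp: main_of_def fun_eq_iff)

lemma sig_of_add:
  fixes X Y :: "'b::field mat"
  assumes "X \<in> carrier_mat s (card cols)" "Y \<in> carrier_mat s (card cols)"
  shows "sig_of (X + Y) \<sigma> c = sig_of X \<sigma> c + sig_of Y \<sigma> c"
proof (cases "\<sigma> \<in> sigs \<and> c < l")
  case True
  then show ?thesis using assms pos_less[OF Inr_cols, of \<sigma> c] by (auto simp: sig_of_def fun_eq_iff)
next
  case False
  then show ?thesis unfolding sig_of_def if_not_P[OF False] by simp
qed

section \<open>The scheme as a network code\<close>

definition sent where
  "sent M \<omega> = to_mat m (enc_main M \<omega>, enc_sig M \<omega>)"

lemma sent_carrier: "sent M \<omega> \<in> carrier_mat m (card cols)"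
  by (simp add: sent_def to_mat_carrier)

lemma main_of_sent: "main_of (sent M \<omega>) = enc_main M \<omega>"
  by (simp add: sent_def main_of_to_mat[OF enc_main_fam])

lemma sig_of_sent: "\<omega> \<in> rands \<Longrightarrow> sig_of (sent M \<omega>) = enc_sig M \<omega>"
  by (simp add: sent_def sig_of_to_mat[OF enc_sig_fam])

definition obs where
  "obs K\<^sub>E H\<^sub>E \<alpha> w = (THE Y. Y \<in> carrier_mat (dim_row K\<^sub>E) (card cols) \<and> Y = to_mat (dim_row K\<^sub>E) w + H\<^sub>E * \<alpha> Y)"

text \<open>The input occurs in Eve's fixed point equation only within \<open>K\<^sub>E * X\<close>,
  whose columns are her view. So an adaptive strategy, too, yields a function of the view.\<close>

lemma eve_obs_sent:
  assumes KE: "K\<^sub>E \<in> carrier_mat r m" and \<omega>: "\<omega> \<in> rands"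
  shows "eve_obs K\<^sub>E H\<^sub>E \<alpha> (sent M \<omega>) = obs K\<^sub>E H\<^sub>E \<alpha> (eve_view (app K\<^sub>E) M \<omega>)"
proof -
  have "K\<^sub>E * sent M \<omega> = to_mat r (main_of (K\<^sub>E * sent M \<omega>), sig_of (K\<^sub>E * sent M \<omega>))"
    using KE sent_carrier by (intro to_mat_of[symmetric]) (rule mult_carrier_mat)
  also have "(main_of (K\<^sub>E * sent M \<omega>), sig_of (K\<^sub>E * sent M \<omega>)) = eve_view (app K\<^sub>E) M \<omega>"
    using main_of_mult[OF KE sent_carrier] sig_of_mult[OF KE sent_carrier]
    by (simp add: eve_view_def fun_eq_iff main_of_sent sig_of_sent[OF \<omega>])
  finally show ?thesis
    using KE sent_carrier[of M \<omega>] by (simp add: eve_obs_def obs_def)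
qed

text \<open>The noise on Bob's side as a function of Eve's view: the \<open>z\<close> of the
  abstract scheme.\<close>

definition noise where
  "noise K\<^sub>E H\<^sub>B H\<^sub>E \<alpha> w = ((\<lambda>c. app H\<^sub>B (main_of (\<alpha> (obs K\<^sub>E H\<^sub>E \<alpha> w)) c)),
    (\<lambda>\<sigma> c. app H\<^sub>B (sig_of (\<alpha> (obs K\<^sub>E H\<^sub>E \<alpha> w)) \<sigma> c)))"

lemma bob_obs_sent:
  fixes M :: "nat \<Rightarrow> 'a"
  assumes dims: "K\<^sub>B \<in> carrier_mat r4 m" "H\<^sub>B \<in> carrier_mat r4 r5" "K\<^sub>E \<in> carrier_mat r6 m" "H\<^sub>E \<in> carrier_mat r6 r5"
    and \<alpha>: "\<alpha> \<in> strategies (card cols) K\<^sub>E H\<^sub>E" and \<omega>: "\<omega> \<in> rands"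
  defines "Y \<equiv> bob_obs (K\<^sub>B, K\<^sub>E) (H\<^sub>B, H\<^sub>E) \<alpha> (sent M \<omega>)"
  shows "main_of Y = bob_main (app K\<^sub>B) (app K\<^sub>E) (noise K\<^sub>E H\<^sub>B H\<^sub>E \<alpha>) M \<omega>"
    and "sig_of Y = bob_sig (app K\<^sub>B) (app K\<^sub>E) (noise K\<^sub>E H\<^sub>B H\<^sub>E \<alpha>) M \<omega>"
proof -
  let ?X = "sent M \<omega>" and ?o = "eve_obs K\<^sub>E H\<^sub>E \<alpha> (sent M \<omega>)"
  have X: "?X \<in> carrier_mat m (card cols)" by (rule sent_carrier)
  \<comment> \<open>The uniqueness condition makes Eve's observation a genuine solution of the right
    size, so that \<open>\<alpha>\<close> yields a matrix of the right size there.\<close>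
  have "\<exists>!Y. Y \<in> carrier_mat (dim_row K\<^sub>E) (card cols) \<and> Y = K\<^sub>E * ?X + H\<^sub>E * \<alpha> Y"
    using \<alpha> X dims(3) unfolding strategies_def by auto
  from theI'[OF this] have "?o \<in> carrier_mat (dim_row K\<^sub>E) (card cols)"
    using X by (simp add: eve_obs_def)
  then have Z: "\<alpha> ?o \<in> carrier_mat r5 (card cols)"
    using \<alpha> dims(4) unfolding strategies_def by auto
  have Y: "Y = K\<^sub>B * ?X + H\<^sub>B * \<alpha> ?o" by (simp add: Y_def bob_obs_def)
  have o: "?o = obs K\<^sub>E H\<^sub>E \<alpha> (eve_view (app K\<^sub>E) M \<omega>)" by (rule eve_obs_sent[OF dims(3) \<omega>])
  have c: "K\<^sub>B * ?X \<in> carrier_mat r4 (card cols)" "H\<^sub>B * \<alpha> ?o \<in> carrier_mat r4 (card cols)"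
    using dims X Z by (auto intro: mult_carrier_mat)
  show "main_of Y = bob_main (app K\<^sub>B) (app K\<^sub>E) (noise K\<^sub>E H\<^sub>B H\<^sub>E \<alpha>) M \<omega>"
    unfolding Y main_of_add[OF c, THEN ext] main_of_mult[OF dims(1) X] main_of_mult[OF dims(2) Z] main_of_sent
    by (intro ext) (simp add: bob_main_def noise_def o)
  have "sig_of Y \<sigma> c = bob_sig (app K\<^sub>B) (app K\<^sub>E) (noise K\<^sub>E H\<^sub>B H\<^sub>E \<alpha>) M \<omega> \<sigma> c" for \<sigma> c
    unfolding Y sig_of_add[OF c] sig_of_mult[OF dims(1) X] sig_of_mult[OF dims(2) Z] sig_of_sent[OF \<omega>]
    by (simp add: bob_sig_def noise_def o)
  then show "sig_of Y = bob_sig (app K\<^sub>B) (app K\<^sub>E) (noise K\<^sub>E H\<^sub>B H\<^sub>E \<alpha>) M \<omega>" by blast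
qed

text \<open>Scrambles of the final code are natural numbers, so the random choices are relabelled by
  a bijection, which preserves all counts.\<close>

definition rnd where
  "rnd = (SOME g. bij_betw g {..<card rands} rands)"

lemma rnd: "bij_betw rnd {..<card rands} rands"
proof -
  have "\<exists>g. bij_betw g {..<card rands} rands"
    using ex_bij_betw_nat_finite[OF finite_rands] by (simp add: lessThan_atLeast0)
  then show ?thesis unfolding rnd_def by (rule someI_ex)
qed

lemma rnd_rands: "s < card rands \<Longrightarrow> rnd s \<in> rands"
  using bij_betw_imp_surj_on[OF rnd] by blast

lemma card_rnd: "card {s \<in> {..<card rands}. Q (rnd s)} = card {\<omega> \<in> rands. Q \<omega>}"
proof (rule bij_betw_same_card[of rnd])
  have "rnd ` {s \<in> {..<card rands}. Q (rnd s)} = {\<omega> \<in> rands. Q \<omega>}"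
  proof (intro equalityI subsetI)
    fix \<omega> assume "\<omega> \<in> {\<omega> \<in> rands. Q \<omega>}"
    then have "\<omega> \<in> rands" "Q \<omega>" by auto
    moreover from this(1) have "\<omega> \<in> rnd ` {..<card rands}" using bij_betw_imp_surj_on[OF rnd] by simp
    ultimately show "\<omega> \<in> rnd ` {s \<in> {..<card rands}. Q (rnd s)}" by auto
  qed (auto simp: rnd_rands)
  moreover have "inj_on rnd {s \<in> {..<card rands}. Q (rnd s)}"
    using bij_betw_imp_inj_on[OF rnd] by (rule inj_on_subset) auto
  ultimately show "bij_betw rnd {s \<in> {..<card rands}. Q (rnd s)} {\<omega> \<in> rands. Q \<omega>}"
    by (simp add: bij_betw_def)
qed

definition net_code :: "nat \<Rightarrow> ('a, 'a vec, nat) network_code" where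
  "net_code k = \<lparr>messages = carrier_vec k, scrambles = {..<card rands},
    encoder = (\<lambda>v s. sent (fun_of v) (rnd s)), decoder = (\<lambda>Y. vec k (decode (main_of Y) (sig_of Y)))\<rparr>"

lemma finite_carrier_vec: "finite (carrier_vec k :: 'a vec set)"
proof -
  have "inj_on fun_of (carrier_vec k :: 'a vec set)"
    by (rule inj_on_inverseI[where g = "vec k"]) (rule vec_fun_of)
  moreover have "fun_of ` (carrier_vec k :: 'a vec set) \<subseteq> vecs {..<k}"
    by (intro image_subsetI fun_of_vecs)
  moreover have "finite (vecs {..<k} :: (nat \<Rightarrow> 'a) set)" by (simp add: finite_vecs)
  ultimately show ?thesis by (rule inj_on_finite)
qed

lemma scrambles_nonempty: "{..<card rands} \<noteq> {}"
  using rands_nonempty finite_rands by (simp add: lessThan_empty_iff)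

lemma carrier_vec_nonempty: "(carrier_vec k :: 'a vec set) \<noteq> {}"
  by (metis empty_iff zero_carrier_vec)

lemma net_code: "is_network_code m r (card cols) (net_code k)"
  using finite_carrier_vec[of k] carrier_vec_nonempty[of k] scrambles_nonempty sent_carrier
  by (auto simp: is_network_code_def net_code_def)

lemma net_code_error:
  assumes dims: "K\<^sub>B \<in> carrier_mat r4 m" "H\<^sub>B \<in> carrier_mat r4 r5" "K\<^sub>E \<in> carrier_mat r6 m" "H\<^sub>E \<in> carrier_mat r6 r5"
    and net: "(app K\<^sub>B, app H\<^sub>B ` vecs {..<r5}) \<in> KK" "app K\<^sub>E \<in> EE"
    and \<alpha>: "\<alpha> \<in> strategies (card cols) K\<^sub>E H\<^sub>E" and k: "IM = {..<k}"
  shows "error_prob (net_code k) (K\<^sub>B, K\<^sub>E) (H\<^sub>B, H\<^sub>E) \<alpha>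
    \<le> real (card KK * (card syms * CARD('a) + 1)) / 2 ^ n"
proof (rule error_prob_le)
  show "finite (messages (net_code k))" "finite (scrambles (net_code k))" "scrambles (net_code k) \<noteq> {}"
    using finite_carrier_vec scrambles_nonempty by (simp_all add: net_code_def)
  fix v :: "'a vec" assume "v \<in> messages (net_code k)"
  then have v: "v \<in> carrier_vec k" by (simp add: net_code_def)
  let ?z = "noise K\<^sub>E H\<^sub>B H\<^sub>E \<alpha>" and ?M = "fun_of v"
  have M: "?M \<in> vecs IM" using fun_of_vecs[OF v] by (simp add: k)
  let ?d = "\<lambda>\<omega>. decode (bob_main (app K\<^sub>B) (app K\<^sub>E) ?z ?M \<omega>) (bob_sig (app K\<^sub>B) (app K\<^sub>E) ?z ?M \<omega>)"
  have dec: "decoder (net_code k) (bob_obs (K\<^sub>B, K\<^sub>E) (H\<^sub>B, H\<^sub>E) \<alpha> (encoder (net_code k) v s)) = vec k (?d (rnd s))"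
    if "s < card rands" for s
    using bob_obs_sent[OF dims \<alpha> rnd_rands[OF that], of ?M] by (simp add: net_code_def)
  have "{s \<in> scrambles (net_code k).
      decoder (net_code k) (bob_obs (K\<^sub>B, K\<^sub>E) (H\<^sub>B, H\<^sub>E) \<alpha> (encoder (net_code k) v s)) \<noteq> v}
    \<subseteq> {s \<in> {..<card rands}. ?d (rnd s) \<noteq> ?M}"
  proof
    fix s assume s: "s \<in> {s \<in> scrambles (net_code k).
      decoder (net_code k) (bob_obs (K\<^sub>B, K\<^sub>E) (H\<^sub>B, H\<^sub>E) \<alpha> (encoder (net_code k) v s)) \<noteq> v}"
    then have s': "s < card rands" by (simp add: net_code_def)
    then have "vec k (?d (rnd s)) \<noteq> vec k ?M" using s dec vec_fun_of[OF v] by simp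
    then show "s \<in> {s \<in> {..<card rands}. ?d (rnd s) \<noteq> ?M}" using s' by auto
  qed
  then have "card {s \<in> scrambles (net_code k).
      decoder (net_code k) (bob_obs (K\<^sub>B, K\<^sub>E) (H\<^sub>B, H\<^sub>E) \<alpha> (encoder (net_code k) v s)) \<noteq> v}
    \<le> card {s \<in> {..<card rands}. ?d (rnd s) \<noteq> ?M}"
    by (rule card_mono[rotated]) simp
  also have "\<dots> = card {\<omega> \<in> rands. ?d \<omega> \<noteq> ?M}" by (rule card_rnd)
  finally have le: "card {s \<in> scrambles (net_code k).
      decoder (net_code k) (bob_obs (K\<^sub>B, K\<^sub>E) (H\<^sub>B, H\<^sub>E) \<alpha> (encoder (net_code k) v s)) \<noteq> v}
    \<le> card {\<omega> \<in> rands. ?d \<omega> \<noteq> ?M}" .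
  \<comment> \<open>Every noise column lies in the image of \<open>H\<^sub>B\<close>, the subspace
    of the true candidate.\<close>
  have "fst (?z w) c \<in> app H\<^sub>B ` vecs {..<r5}" "snd (?z w) \<sigma> c' \<in> app H\<^sub>B ` vecs {..<r5}" for w c \<sigma> c'
    using app_in_image[of H\<^sub>B] dims(2) by (auto simp: noise_def)
  then have "card {\<omega> \<in> rands. ?d \<omega> \<noteq> ?M} * 2 ^ n \<le> card KK * (card syms * CARD('a) + 1) * card rands"
    by (intro decode_error_count[OF net M])
  then have "card {s \<in> scrambles (net_code k).
      decoder (net_code k) (bob_obs (K\<^sub>B, K\<^sub>E) (H\<^sub>B, H\<^sub>E) \<alpha> (encoder (net_code k) v s)) \<noteq> v} * 2 ^ n
    \<le> card KK * (card syms * CARD('a) + 1) * card (scrambles (net_code k))"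
    using le by (simp add: net_code_def) (meson le_trans mult_le_mono1)
  from this[THEN of_nat_mono, where 'a = real]
  show "real (card {s \<in> scrambles (net_code k).
      decoder (net_code k) (bob_obs (K\<^sub>B, K\<^sub>E) (H\<^sub>B, H\<^sub>E) \<alpha> (encoder (net_code k) v s)) \<noteq> v})
    \<le> real (card KK * (card syms * CARD('a) + 1)) / 2 ^ n * real (card (scrambles (net_code k)))"
    by (simp add: field_simps)
qed simp

lemma net_code_secret:
  assumes KE: "K\<^sub>E \<in> carrier_mat r6 m" and net: "app K\<^sub>E \<in> EE"
  shows "eve_information (net_code k) (K\<^sub>B, K\<^sub>E) (H\<^sub>B, H\<^sub>E) \<alpha> = 0"
proof (rule eve_information_zero)
  show "finite (messages (net_code k))" "finite (scrambles (net_code k))"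
    "scrambles (net_code k) \<noteq> {}" "messages (net_code k) \<noteq> {}"
    using finite_carrier_vec scrambles_nonempty carrier_vec_nonempty by (simp_all add: net_code_def)
  fix v v' :: "'a vec" and y
  have *: "card {s \<in> scrambles (net_code k). eve_obs (snd (K\<^sub>B, K\<^sub>E)) (snd (H\<^sub>B, H\<^sub>E)) \<alpha> (encoder (net_code k) v s) = y}
    = card {(L, R, LS, US) \<in> rands. obs K\<^sub>E H\<^sub>E \<alpha> (base_view (app K\<^sub>E) L LS) = y}" for v
  proof -
    have "{s \<in> scrambles (net_code k). eve_obs (snd (K\<^sub>B, K\<^sub>E)) (snd (H\<^sub>B, H\<^sub>E)) \<alpha> (encoder (net_code k) v s) = y}
      = {s \<in> {..<card rands}. obs K\<^sub>E H\<^sub>E \<alpha> (eve_view (app K\<^sub>E) (fun_of v) (rnd s)) = y}"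
      using eve_obs_sent[OF KE rnd_rands] by (auto simp: net_code_def)
    then show ?thesis
      using card_rnd[of "\<lambda>\<omega>. obs K\<^sub>E H\<^sub>E \<alpha> (eve_view (app K\<^sub>E) (fun_of v) \<omega>) = y"]
        eve_view_count[OF net, of "\<lambda>w. obs K\<^sub>E H\<^sub>E \<alpha> w = y" "fun_of v"] by simp
  qed
  show "card {s \<in> scrambles (net_code k). eve_obs (snd (K\<^sub>B, K\<^sub>E)) (snd (H\<^sub>B, H\<^sub>E)) \<alpha> (encoder (net_code k) v s) = y}
    = card {s \<in> scrambles (net_code k). eve_obs (snd (K\<^sub>B, K\<^sub>E)) (snd (H\<^sub>B, H\<^sub>E)) \<alpha> (encoder (net_code k) v' s) = y}"
    unfolding * ..
qed

end

section \<open>The code sequence\<close>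

lemma subspc_image:
  assumes "lin f"
  shows "subspc (f ` vecs I)"
proof -
  have "f x - f y \<in> f ` vecs I" if "x \<in> vecs I" "y \<in> vecs I" for x y
    using that by (intro image_eqI[of _ _ "x - y"]) (simp_all add: lin_diff[OF assms] addsub_diff[OF addsub_vecs])
  moreover have "smul c (f x) \<in> f ` vecs I" if "x \<in> vecs I" for c x
    using that by (intro image_eqI[of _ _ "smul c x"]) (simp_all add: lin_smul[OF assms] smul_vecs)
  moreover have "0 \<in> f ` vecs I"
    by (intro image_eqI[of _ _ 0]) (simp_all add: lin_0[OF assms] addsub_zero[OF addsub_vecs])
  ultimately show ?thesis by (auto simp: subspc_def addsub_def)
qed

lemma card_app_kernel:
  fixes A :: "'a::{field,finite} mat"
  shows "card {x \<in> vecs {..<dim_col A}. app A x = 0} * CARD('a) ^ mat_rank A = CARD('a) ^ dim_col A"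
  using card_ker_image[of "vecs {..<dim_col A} :: (nat \<Rightarrow> 'a) set" "app A"]
  by (simp add: finite_vecs addsub_vecs lin_diff[OF lin_app] card_app_image card_vecs)

section \<open>Finite, nonempty ranges for the maxima over networks and strategies\<close>

lemma finite_carrier_mat: "finite (carrier_mat r c :: 'a::finite mat set)"
proof -
  have "carrier_mat r c \<subseteq> mat r c ` (PiE ({..<r} \<times> {..<c}) (\<lambda>_. UNIV :: 'a set))"
  proof
    fix A :: "'a mat" assume A: "A \<in> carrier_mat r c"
    show "A \<in> mat r c ` (PiE ({..<r} \<times> {..<c}) (\<lambda>_. UNIV))"
      by (rule image_eqI[of _ _ "restrict (\<lambda>ij. A $$ ij) ({..<r} \<times> {..<c})"]) (use A in auto)
  qed
  then show ?thesis by (rule finite_subset) (auto intro!: finite_imageI finite_PiE)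
qed

text \<open>A truncated identity matrix. Such matrices make the set of networks nonempty, so that
  \<open>Max\<close> over it is a genuine maximum.\<close>

lemma exists_rank:
  assumes "k \<le> r" "k \<le> c"
  shows "\<exists>A :: 'a::{field,finite} mat. A \<in> carrier_mat r c \<and> mat_rank A = k"
proof -
  let ?A = "mat r c (\<lambda>(i, j). if i = j \<and> i < k then 1 else 0) :: 'a mat"
  have app: "app ?A x = (\<lambda>i. if i < k then x i else 0)" for x
  proof
    fix i
    show "app ?A x i = (if i < k then x i else 0)"
    proof (cases "i < k")
      case True
      have "(\<Sum>j<c. ?A $$ (i, j) * x j) = (\<Sum>j<c. if j = i then x j else 0)"
        by (rule sum.cong) (use True assms in auto)
      then show ?thesis using True assms by (simp add: app_def)
    next
      case False
      then show ?thesis by (auto simp: app_def intro!: sum.neutral)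
    qed
  qed
  have "app ?A ` vecs {..<c} = vecs {..<k}"
  proof (intro equalityI subsetI)
    fix x assume x: "x \<in> (vecs {..<k} :: (nat \<Rightarrow> 'a) set)"
    then have "x = app ?A x" using fam_out[OF x] by (auto simp: app)
    moreover have "x \<in> vecs {..<c}" using x assms by (auto simp: fam_def)
    ultimately show "x \<in> app ?A ` vecs {..<c}" by (rule image_eqI)
  qed (auto simp: app fam_def)
  then have "CARD('a) ^ mat_rank ?A = CARD('a) ^ k"
    using card_app_image[of ?A] by (simp add: card_vecs)
  then have "mat_rank ?A = k" using CARD_field_ge_2[where 'a = 'a] by (simp add: power_inject_exp)
  then show ?thesis by (intro exI[of _ ?A]) simp
qed

lemma finite_networks: "finite (networks m0 m1 m2 m3 m4 m5 m6 :: (('a::{field,finite} mat \<times> 'a mat) \<times> ('a mat \<times> 'a mat)) set)"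
  by (rule finite_subset[of _ "(carrier_mat m4 m3 \<times> carrier_mat m6 m3) \<times> (carrier_mat m4 m5 \<times> carrier_mat m6 m5)"])
     (auto simp: networks_def finite_carrier_mat)

lemma networks_nonempty:
  assumes "m0 \<le> min m3 m4" "m1 \<le> min m4 m5" "m2 \<le> min m6 m3"
  shows "(networks m0 m1 m2 m3 m4 m5 m6 :: (('a::{field,finite} mat \<times> 'a mat) \<times> ('a mat \<times> 'a mat)) set) \<noteq> {}"
proof -
  obtain KB :: "'a mat" where "KB \<in> carrier_mat m4 m3" "mat_rank KB = m0"
    using exists_rank[of m0 m4 m3, where 'a = 'a] assms by auto
  moreover obtain HB :: "'a mat" where "HB \<in> carrier_mat m4 m5" "mat_rank HB = m1"
    using exists_rank[of m1 m4 m5, where 'a = 'a] assms by auto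
  moreover obtain KE :: "'a mat" where "KE \<in> carrier_mat m6 m3" "mat_rank KE = m2"
    using exists_rank[of m2 m6 m3, where 'a = 'a] assms by auto
  ultimately have "((KB, KE), (HB, 0\<^sub>m m6 m5)) \<in> networks m0 m1 m2 m3 m4 m5 m6"
    by (simp add: networks_def)
  then show ?thesis by blast
qed

lemma finite_strategies: "finite (strategies l (K :: 'a::{field,finite} mat) H)"
proof (rule finite_subset)
  show "strategies l K H \<subseteq> PiE (carrier_mat (dim_row K) l) (\<lambda>_. carrier_mat (dim_col H) l)"
    by (auto simp: strategies_def)
qed (intro finite_PiE finite_carrier_mat)

text \<open>The passive strategy, which always injects zero.\<close>

lemma strategies_nonempty:
  assumes "dim_row H = dim_row K"
  shows "strategies l (K :: 'a::{field,finite} mat) H \<noteq> {}"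
proof -
  let ?\<alpha> = "restrict (\<lambda>_. 0\<^sub>m (dim_col H) l) (carrier_mat (dim_row K) l) :: 'a mat \<Rightarrow> 'a mat"
  have H: "H \<in> carrier_mat (dim_row K) (dim_col H)" using assms by auto
  have "\<exists>!Y. Y \<in> carrier_mat (dim_row K) l \<and> Y = K * X + H * ?\<alpha> Y" if X: "X \<in> carrier_mat (dim_col K) l" for X
  proof -
    have KX: "K * X \<in> carrier_mat (dim_row K) l" using X by auto
    have "K * X + H * ?\<alpha> Y = K * X" if "Y \<in> carrier_mat (dim_row K) l" for Y
      using that KX right_mult_zero_mat[OF H] by simp
    then show ?thesis using KX by (intro ex1I[of _ "K * X"]) auto
  qed
  then have "?\<alpha> \<in> strategies l K H" by (auto simp: strategies_def)
  then show ?thesis by blast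
qed

lemma Max_image_bounds:
  fixes f :: "'b \<Rightarrow> real"
  assumes "finite A" "A \<noteq> {}" "\<And>x. x \<in> A \<Longrightarrow> b \<le> f x \<and> f x \<le> c"
  shows "b \<le> Max (f ` A) \<and> Max (f ` A) \<le> c"
proof -
  have "Max (f ` A) \<in> f ` A" using assms(1,2) by (intro Max_in) auto
  then obtain x where "x \<in> A" "Max (f ` A) = f x" by (rule imageE) blast
  then show ?thesis using assms(3) by simp
qed

lemma max_over_networks:
  fixes f :: "('a::{field,finite} mat \<times> 'a mat) \<Rightarrow> ('a mat \<times> 'a mat) \<Rightarrow> ('a mat \<Rightarrow> 'a mat) \<Rightarrow> real"
  assumes ranks: "m0 \<le> min m3 m4" "m1 \<le> min m4 m5" "m2 \<le> min m6 m3"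
    and f: "\<And>K H \<alpha>. (K, H) \<in> networks m0 m1 m2 m3 m4 m5 m6 \<Longrightarrow> \<alpha> \<in> strategies l (snd K) (snd H) \<Longrightarrow>
      b \<le> f K H \<alpha> \<and> f K H \<alpha> \<le> c"
  shows "b \<le> (MAX (K, H) \<in> networks m0 m1 m2 m3 m4 m5 m6. MAX \<alpha> \<in> strategies l (snd K) (snd H). f K H \<alpha>) \<and>
    (MAX (K, H) \<in> networks m0 m1 m2 m3 m4 m5 m6. MAX \<alpha> \<in> strategies l (snd K) (snd H). f K H \<alpha>) \<le> c"
proof (rule Max_image_bounds[OF finite_networks networks_nonempty[OF ranks]])
  fix KH :: "('a mat \<times> 'a mat) \<times> ('a mat \<times> 'a mat)"
  assume KH: "KH \<in> networks m0 m1 m2 m3 m4 m5 m6"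
  obtain K H where KH': "KH = (K, H)" by (cases KH)
  have "dim_row (snd H) = dim_row (snd K)" using KH by (auto simp: KH' networks_def)
  then show "b \<le> (case KH of (K, H) \<Rightarrow> MAX \<alpha> \<in> strategies l (snd K) (snd H). f K H \<alpha>) \<and>
      (case KH of (K, H) \<Rightarrow> MAX \<alpha> \<in> strategies l (snd K) (snd H). f K H \<alpha>) \<le> c"
    unfolding KH' prod.case
    using KH f[of K H] by (intro Max_image_bounds finite_strategies strategies_nonempty) (auto simp: KH')
qed

text \<open>The scheme with \<open>n = N\<close> and \<open>p = N ^ 3\<close>: its
  \<open>N ^ 6\<close> main columns dominate the signal columns. \<open>KK\<close> pairs every
  \<open>K\<^sub>B\<close> with every image of an \<open>H\<^sub>B\<close> of the given ranks, and
  \<open>c\<close> is its size; none of \<open>a\<close>, \<open>l\<^sub>1\<close> and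
  \<open>c\<close> depends on \<open>N\<close>.\<close>

lemma secret_codes_exist:
  assumes less: "m2 + m1 < m0"
  obtains a l\<^sub>1 c where "\<And>N k. k + 2 * a = (m0 - m1 - m2) * N ^ 6 \<Longrightarrow>
    \<exists>\<Phi> :: ('a::{field,finite}, 'a vec, nat) network_code.
      is_network_code m3 m4 (N ^ 6 + (m3 + 1) * CARD('a) * l\<^sub>1 * N ^ 5) \<Phi> \<and> messages \<Phi> = carrier_vec k \<and>
      (\<forall>K H \<alpha>. (K, H) \<in> networks m0 m1 m2 m3 m4 m5 m6 \<longrightarrow>
        \<alpha> \<in> strategies (N ^ 6 + (m3 + 1) * CARD('a) * l\<^sub>1 * N ^ 5) (snd K) (snd H) \<longrightarrow>
        error_prob \<Phi> K H \<alpha> \<le> real c * (real ((m3 + 1) * CARD('a)) * real N ^ 4 + 1) / 2 ^ N \<and>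
        eve_information \<Phi> K H \<alpha> = 0)"
proof -
  let ?q = "CARD('a)"
  define KK :: "(((nat \<Rightarrow> 'a) \<Rightarrow> nat \<Rightarrow> 'a) \<times> (nat \<Rightarrow> 'a) set) set" where
    "KK = {(app K, app H ` vecs {..<m5}) |K H. K \<in> carrier_mat m4 m3 \<and> H \<in> carrier_mat m4 m5 \<and>
    mat_rank K = m0 \<and> mat_rank H = m1}"
  define EE :: "((nat \<Rightarrow> 'a) \<Rightarrow> nat \<Rightarrow> 'a) set" where
    "EE = {app K |K. K \<in> carrier_mat m6 m3 \<and> mat_rank K = m2}"
  have fin: "finite KK"
    by (rule finite_subset[of _ "(\<lambda>(K, H). (app K, app H ` vecs {..<m5})) ` (carrier_mat m4 m3 \<times> carrier_mat m4 m5)"])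
       (auto simp: KK_def finite_carrier_mat)
  obtain a l\<^sub>1 where sch: "\<And>p k. k + 2 * a = (m0 - m1 - m2) * p\<^sup>2 \<Longrightarrow>
    \<exists>G H. secret_scheme m3 p l\<^sub>1 KK EE {..<k} {k..<k + (m2 * p\<^sup>2 + a)} {..<m2 * l\<^sub>1 + a} G H"
  proof (rule secret_scheme_exists[of KK m1 m3 m0 EE m2])
    show "finite KK" by (rule fin)
    fix K S assume "(K, S) \<in> KK"
    then obtain A B where AB: "K = app A" "S = app B ` vecs {..<m5}" "A \<in> carrier_mat m4 m3" "B \<in> carrier_mat m4 m5"
      "mat_rank A = m0" "mat_rank B = m1" by (auto simp: KK_def)
    show "lin K" "subspc S" "finite S" by (simp_all add: AB(1,2) lin_app subspc_image finite_vecs)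
    show "card S = ?q ^ m1" using card_app_image[of B] AB by simp
    show "card {x \<in> vecs {..<m3}. K x = 0} * ?q ^ m0 = ?q ^ m3" using card_app_kernel[of A] AB by simp
  next
    fix E assume "E \<in> EE"
    then obtain A where A: "E = app A" "A \<in> carrier_mat m6 m3" "mat_rank A = m2" by (auto simp: EE_def)
    show "lin E" by (simp add: A(1) lin_app)
    show "card {x \<in> vecs {..<m3}. E x = 0} * ?q ^ m2 = ?q ^ m3" using card_app_kernel[of A] A by simp
  qed (use less in auto)
  show thesis
  proof (rule that)
    fix N k :: nat
    let ?l = "N ^ 6 + (m3 + 1) * ?q * l\<^sub>1 * N ^ 5"
    assume "k + 2 * a = (m0 - m1 - m2) * N ^ 6"
    then have "k + 2 * a = (m0 - m1 - m2) * (N ^ 3)\<^sup>2" by simp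
    from sch[OF this] obtain G H where
      "secret_scheme m3 (N ^ 3) l\<^sub>1 KK EE {..<k} {k..<k + (m2 * (N ^ 3)\<^sup>2 + a)} {..<m2 * l\<^sub>1 + a} G H" by blast
    then interpret secret_scheme m3 N "N ^ 3" l\<^sub>1 KK EE "{..<k}" "{k..<k + (m2 * (N ^ 3)\<^sup>2 + a)}" "{..<m2 * l\<^sub>1 + a}" G H .
    have len: "card cols = ?l"
      unfolding card_cols by (simp add: power2_eq_square) (simp add: eval_nat_numeral algebra_simps)
    have syms: "card syms * ?q = (m3 + 1) * ?q * N ^ 4"
      unfolding card_syms by (simp add: eval_nat_numeral algebra_simps)
    show "\<exists>\<Phi> :: ('a, 'a vec, nat) network_code. is_network_code m3 m4 ?l \<Phi> \<and> messages \<Phi> = carrier_vec k \<and>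
      (\<forall>K H \<alpha>. (K, H) \<in> networks m0 m1 m2 m3 m4 m5 m6 \<longrightarrow> \<alpha> \<in> strategies ?l (snd K) (snd H) \<longrightarrow>
        error_prob \<Phi> K H \<alpha> \<le> real (card KK) * (real ((m3 + 1) * ?q) * real N ^ 4 + 1) / 2 ^ N \<and>
        eve_information \<Phi> K H \<alpha> = 0)"
    proof (intro exI[of _ "net_code k"] conjI allI impI)
      show "is_network_code m3 m4 ?l (net_code k)" using net_code unfolding len .
      show "messages (net_code k) = carrier_vec k" unfolding net_code_def by (rule network_code.select_convs)
      fix K H :: "'a mat \<times> 'a mat" and \<alpha>
      assume net: "(K, H) \<in> networks m0 m1 m2 m3 m4 m5 m6" and \<alpha>: "\<alpha> \<in> strategies ?l (snd K) (snd H)"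
      obtain KB KE HB HE where KH: "K = (KB, KE)" "H = (HB, HE)" by (cases K, cases H)
      from net have dims: "KB \<in> carrier_mat m4 m3" "HB \<in> carrier_mat m4 m5" "KE \<in> carrier_mat m6 m3" "HE \<in> carrier_mat m6 m5"
        and ranks: "mat_rank KB = m0" "mat_rank HB = m1" "mat_rank KE = m2"
        by (auto simp: KH networks_def)
      have in_KK: "(app KB, app HB ` vecs {..<m5}) \<in> KK" and in_EE: "app KE \<in> EE"
        using dims ranks by (auto simp: KK_def EE_def)
      have \<alpha>': "\<alpha> \<in> strategies (card cols) KE HE" using \<alpha> unfolding len by (simp add: KH)
      have "error_prob (net_code k) K H \<alpha> \<le> real (card KK * (card syms * ?q + 1)) / 2 ^ N"
        unfolding KH by (rule net_code_error[OF dims in_KK in_EE \<alpha>' refl])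
      then show "error_prob (net_code k) K H \<alpha> \<le> real (card KK) * (real ((m3 + 1) * ?q) * real N ^ 4 + 1) / 2 ^ N"
        unfolding syms by (simp only: of_nat_mult of_nat_add of_nat_power of_nat_1)
      show "eve_information (net_code k) K H \<alpha> = 0"
        unfolding KH by (rule net_code_secret[OF dims(3) in_EE])
    qed
  qed
qed

lemma rate_limit: "(\<lambda>n. (d * real n ^ 6 - b) / (real n ^ 6 + c * real n ^ 5)) \<longlonglongrightarrow> d"
proof -
  have "(\<lambda>n. (d - b / real n ^ 6) / (1 + c / real n)) \<longlonglongrightarrow> (d - 0) / (1 + 0)"
    by (intro tendsto_intros) (real_asymp+, simp)
  moreover have "eventually (\<lambda>n. (d - b / real n ^ 6) / (1 + c / real n)
      = (d * real n ^ 6 - b) / (real n ^ 6 + c * real n ^ 5)) sequentially"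
    using eventually_gt_at_top[of 0]
  proof eventually_elim
    case (elim n)
    then have x: "real n \<noteq> 0" by simp
    have "(d - b / real n ^ 6) / (1 + c / real n) = (real n ^ 6 * (d - b / real n ^ 6)) / (real n ^ 6 * (1 + c / real n))"
      using x by simp
    also have "real n ^ 6 * (d - b / real n ^ 6) = d * real n ^ 6 - b" using x by (simp add: field_simps)
    also have "real n ^ 6 * (1 + c / real n) = real n ^ 6 + c * real n ^ 5"
      using x by (simp add: field_simps eval_nat_numeral)
    finally show ?case .
  qed
  ultimately show ?thesis by (simp add: tendsto_cong)
qed

lemma error_limit: "(\<lambda>n. c * (b * real n ^ 4 + 1) / 2 ^ n) \<longlonglongrightarrow> 0"
proof -
  have "(\<lambda>n. c * b * (real n ^ 4 / 2 ^ n) + c * (1 / 2 ^ n)) \<longlonglongrightarrow> c * b * 0 + c * 0"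
    by (intro tendsto_intros) real_asymp+
  then show ?thesis by (simp add: field_simps)
qed

theorem theorem2:
  fixes m0 m1 m2 m3 m4 m5 m6 :: nat
  assumes "m3 > 0" "m4 > 0" "m5 > 0" "m6 > 0"
    and "m0 \<le> min m3 m4" "m1 \<le> min m4 m5" "m2 \<le> min m6 m3"
    and "m2 + m1 < m0"
  shows "\<exists>(l :: nat \<Rightarrow> nat) (k :: nat \<Rightarrow> nat)
      (\<Phi> :: nat \<Rightarrow> ('a :: {field, finite}, 'a vec, nat) network_code).
    (\<forall>n\<ge>1. l n > 0 \<and> is_network_code m3 m4 (l n) (\<Phi> n) \<and> messages (\<Phi> n) = carrier_vec (k n)) \<and>
    (\<lambda>n. real (k n) / real (l n)) \<longlonglongrightarrow> real m0 - real m1 - real m2 \<and>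
    (\<lambda>n. MAX (K, H) \<in> networks m0 m1 m2 m3 m4 m5 m6.
           MAX \<alpha> \<in> strategies (l n) (snd K) (snd H). error_prob (\<Phi> n) K H \<alpha>) \<longlonglongrightarrow> 0 \<and>
    (\<forall>n\<ge>1. (MAX (K, H) \<in> networks m0 m1 m2 m3 m4 m5 m6.
             MAX \<alpha> \<in> strategies (l n) (snd K) (snd H). eve_information (\<Phi> n) K H \<alpha>) = 0)"
proof -
  let ?q = "CARD('a)" and ?net = "networks m0 m1 m2 m3 m4 m5 m6 :: (('a mat \<times> 'a mat) \<times> ('a mat \<times> 'a mat)) set"
  note ranks = assms(5,6,7)
  obtain a l\<^sub>1 c where codes: "\<And>N k. k + 2 * a = (m0 - m1 - m2) * N ^ 6 \<Longrightarrow>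
    \<exists>\<Phi> :: ('a, 'a vec, nat) network_code.
      is_network_code m3 m4 (N ^ 6 + (m3 + 1) * ?q * l\<^sub>1 * N ^ 5) \<Phi> \<and> messages \<Phi> = carrier_vec k \<and>
      (\<forall>K H \<alpha>. (K, H) \<in> ?net \<longrightarrow> \<alpha> \<in> strategies (N ^ 6 + (m3 + 1) * ?q * l\<^sub>1 * N ^ 5) (snd K) (snd H) \<longrightarrow>
        error_prob \<Phi> K H \<alpha> \<le> real c * (real ((m3 + 1) * ?q) * real N ^ 4 + 1) / 2 ^ N \<and>
        eve_information \<Phi> K H \<alpha> = 0)"
    using secret_codes_exist[OF assms(8), where 'a = 'a and ?m3.0 = m3 and ?m4.0 = m4 and ?m5.0 = m5 and ?m6.0 = m6]
    by metis
  \<comment> \<open>Starting at \<open>N = s\<close> makes \<open>N\<close> large enough for the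
    subtraction in \<open>k\<close> not to be truncated, and keeps the block-length
    positive.\<close>
  define s where "s = 2 * a + 1"
  define l where "l n = (n + s) ^ 6 + (m3 + 1) * ?q * l\<^sub>1 * (n + s) ^ 5" for n
  define k where "k n = (m0 - m1 - m2) * (n + s) ^ 6 - 2 * a" for n
  have k: "k n + 2 * a = (m0 - m1 - m2) * (n + s) ^ 6" for n
  proof -
    have "2 * a \<le> n + s" by (simp add: s_def)
    also have "\<dots> \<le> (n + s) ^ 6" by (rule self_le_power) (simp_all add: s_def)
    also have "\<dots> \<le> (m0 - m1 - m2) * (n + s) ^ 6"
    proof -
      have "1 \<le> m0 - m1 - m2" using assms(8) by linarith
      then show ?thesis using mult_le_mono1[of 1 "m0 - m1 - m2" "(n + s) ^ 6"] by (simp only: mult_1)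
    qed
    finally show ?thesis by (simp add: k_def)
  qed
  have "\<forall>n. \<exists>\<Phi> :: ('a, 'a vec, nat) network_code.
      is_network_code m3 m4 (l n) \<Phi> \<and> messages \<Phi> = carrier_vec (k n) \<and>
      (\<forall>K H \<alpha>. (K, H) \<in> ?net \<longrightarrow> \<alpha> \<in> strategies (l n) (snd K) (snd H) \<longrightarrow>
        error_prob \<Phi> K H \<alpha> \<le> real c * (real ((m3 + 1) * ?q) * real (n + s) ^ 4 + 1) / 2 ^ (n + s) \<and>
        eve_information \<Phi> K H \<alpha> = 0)"
    unfolding l_def using codes[OF k] by blast
  from choice[OF this] obtain \<Phi> :: "nat \<Rightarrow> ('a, 'a vec, nat) network_code" where
    \<Phi>: "\<And>n. is_network_code m3 m4 (l n) (\<Phi> n)" "\<And>n. messages (\<Phi> n) = carrier_vec (k n)"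
    and err: "\<And>n K H \<alpha>. (K, H) \<in> ?net \<Longrightarrow> \<alpha> \<in> strategies (l n) (snd K) (snd H) \<Longrightarrow>
      error_prob (\<Phi> n) K H \<alpha> \<le> real c * (real ((m3 + 1) * ?q) * real (n + s) ^ 4 + 1) / 2 ^ (n + s)"
    and sec: "\<And>n K H \<alpha>. (K, H) \<in> ?net \<Longrightarrow> \<alpha> \<in> strategies (l n) (snd K) (snd H) \<Longrightarrow>
      eve_information (\<Phi> n) K H \<alpha> = 0"
    by blast
  have rate: "(\<lambda>n. real (k n) / real (l n)) \<longlonglongrightarrow> real m0 - real m1 - real m2"
  proof -
    have "real (k n) = real (m0 - m1 - m2) * real (n + s) ^ 6 - real (2 * a)" for n
      using arg_cong[OF k[of n], of real] by simp
    moreover have "real (l n) = real (n + s) ^ 6 + real ((m3 + 1) * ?q * l\<^sub>1) * real (n + s) ^ 5" for n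
      by (simp add: l_def)
    moreover have "real (m0 - m1 - m2) = real m0 - real m1 - real m2" using assms(8) by simp
    ultimately show ?thesis
      using LIMSEQ_ignore_initial_segment[OF rate_limit[of "real (m0 - m1 - m2)" "real (2 * a)"
          "real ((m3 + 1) * ?q * l\<^sub>1)"], of s]
      by (simp only:)
  qed
  have error: "(\<lambda>n. MAX (K, H) \<in> ?net. MAX \<alpha> \<in> strategies (l n) (snd K) (snd H). error_prob (\<Phi> n) K H \<alpha>) \<longlonglongrightarrow> 0"
  proof (rule tendsto_sandwich[OF _ _ tendsto_const])
    have "0 \<le> (MAX (K, H) \<in> ?net. MAX \<alpha> \<in> strategies (l n) (snd K) (snd H). error_prob (\<Phi> n) K H \<alpha>) \<and>
      (MAX (K, H) \<in> ?net. MAX \<alpha> \<in> strategies (l n) (snd K) (snd H). error_prob (\<Phi> n) K H \<alpha>)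
        \<le> real c * (real ((m3 + 1) * ?q) * real (n + s) ^ 4 + 1) / 2 ^ (n + s)" for n
      using err by (intro max_over_networks[OF ranks]) (simp_all add: error_prob_def)
    then show "\<forall>\<^sub>F n in sequentially. 0 \<le> (MAX (K, H) \<in> ?net. MAX \<alpha> \<in> strategies (l n) (snd K) (snd H). error_prob (\<Phi> n) K H \<alpha>)"
      and "\<forall>\<^sub>F n in sequentially. (MAX (K, H) \<in> ?net. MAX \<alpha> \<in> strategies (l n) (snd K) (snd H). error_prob (\<Phi> n) K H \<alpha>)
        \<le> real c * (real ((m3 + 1) * ?q) * real (n + s) ^ 4 + 1) / 2 ^ (n + s)"
      by (intro always_eventually allI; blast)+
    show "(\<lambda>n. real c * (real ((m3 + 1) * ?q) * real (n + s) ^ 4 + 1) / 2 ^ (n + s)) \<longlonglongrightarrow> 0"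
      by (rule LIMSEQ_ignore_initial_segment[OF error_limit])
  qed
  have secret: "(MAX (K, H) \<in> ?net. MAX \<alpha> \<in> strategies (l n) (snd K) (snd H). eve_information (\<Phi> n) K H \<alpha>) = 0" for n
  proof -
    have "0 \<le> (MAX (K, H) \<in> ?net. MAX \<alpha> \<in> strategies (l n) (snd K) (snd H). eve_information (\<Phi> n) K H \<alpha>) \<and>
      (MAX (K, H) \<in> ?net. MAX \<alpha> \<in> strategies (l n) (snd K) (snd H). eve_information (\<Phi> n) K H \<alpha>) \<le> 0"
      by (intro max_over_networks[OF ranks]) (simp add: sec)
    then show ?thesis by linarith
  qed
  have "l n > 0" for n by (simp add: l_def s_def)
  then show ?thesis using \<Phi> rate error secret by blast
qed

end
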